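(* Let $L\subset S^3$ be an oriented link with odd Khovanov homology $\mathrm{Kh}'(L)=\bigoplus_{m,s}\mathrm{Kh}'_{m,s}(L)$, and let $\widehat J(L)\in\mathbb Z[q,q^{-1}]$ be its unnormalized Jones polynomial. Then $$\widehat J(L)=\sum_{m,s\in\mathbb Z}(-1)^m\,\operatorname{rank}\big(\mathrm{Kh}'_{m,s}(L)\big)\,q^s .$$
   Context: Unnormalized Jones polynomial. $\widehat J$ satisfies $\widehat J(\emptyset)=1$, $\widehat J(\text{unknot}\sqcup L)=(q+q^{-1})\widehat J(L)$, and, up to multiplication by $\pm q^j$, $\widehat J(\mathcal D)=\widehat J(\mathcal D_0)-q\widehat J(\mathcal D_1)$ where $\mathcal D_0,\mathcal D_1$ are the $0$- and $1$-resolutions of $\mathcal D$ at a crossing. Precisely: for a diagram $\mathcal D$ of $L$ with $n_+$ positive and $n_-$ negative crossings, $\widehat J(L)=(-1)^{n_-}q^{n_+-2n_-}\langle\mathcal D\rangle$, where the bracket is determined by $\langle\emptyset\rangle=1$, $\langle\text{circle}\sqcup\mathcal D\rangle=(q+q^{-1})\langle\mathcal D\rangle$, $\langle\mathcal D\rangle=\langle\mathcal D_0\rangle-q\langle\mathcal D_1\rangle$. Odd Khovanov homology. Resolutions and arrows: let $\mathcal D$ be a planar link diagram with set of crossings $\mathcal X$. Near a crossing, drawn so that the over-strand runs from upper left to lower right, the $0$-resolution joins the two upper ends by an arc and the two lower ends by an arc, and the $1$-resolution joins the two left ends and the two right ends. At each crossing $x$ let $\gamma_x$ be a short arc at $x$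 joining the two strands of the $0$-resolution; surgery along $\gamma_x$ turns the $0$-resolution into the $1$-resolution. Choose an orientation (arrow) on each $\gamma_x$. Rotating the arrow $90^\circ$ counterclockwise gives an oriented arc $\gamma_x^*$ joining the two strands of the $1$-resolution at $x$. Hypercube: vertices are maps $I:\mathcal X\to\{0,1\}$; $\mathcal D(I)$ is the collection of disjoint planar circles obtained by resolving each $x$ according to $I(x)$. There is an edge $e$ from $I_0$ to $I_1$ if they agree except at one crossing $x$, where $I_0(x)=0$, $I_1(x)=1$. $V(\mathcal D(I))$ is the free abelian group on the circles of $\mathcal D(I)$. The map $F_e:\Lambda^*V(\mathcal D(I_0))\to\Lambda^*V(\mathcal D(I_1))$ is: (merge) if circles $a_1,a_2$ of $\mathcal D(I_0)$ are joined, $F_e$ is induced by $V(\mathcal D(I_0))\to V(\mathcal D(I_0))/(a_1-a_2)\cong V(\mathcal D(I_1))$; (split) if a circle divides into $a_1,a_2$, with $\gamma_x^*$ pointing from $a_1$ to $a_2$, then $F_e(v)=(a_1-a_2)\wedge\tilde v$, where $\tilde v$ is any lift of $v$ under $\Lambda^*V(\mathcal D(I_1))\to\Lambda^*(V(\mathcal D(I_1))/(a_1-a_2))\cong\Lambda^*V(\mathcal D(I_0))$. Types of squares: a square face is given by a vertex $I_{00}$ and crossings $x_1,x_2$ with $I_{00}(x_1)=I_{00}(x_2)=0$. If the two composites of edge maps around the square are nonzero, they agree up to sign; the square is of type $C$ if they are equal, type $A$ if they are negatives. They are both zero exactly when $\gamma_{x_1},\gamma_{x_2}$ have all endpoints on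 one circle of $\mathcal D(I_{00})$ and these interleave; then one arc lies inside the circle and the other outside. Traverse the circle counterclockwise from the tail of the inside arc: the square is of type $X$ if the next endpoint met is the tail of the outside arc, type $Y$ if it is the head. Edge assignments: maps $\epsilon:\{\text{edges}\}\to\{\pm1\}$; a square is even (odd) if it has an even (odd) number of edges with $\epsilon=-1$. Type $X$: squares of types $A,X$ are even and of types $C,Y$ odd. Type $Y$: squares of types $A,Y$ are even and of types $C,X$ odd. Complex: $C(\mathcal D)=\bigoplus_I\Lambda^*V(\mathcal D(I))$, $\partial_\epsilon(v)=\sum_e\epsilon(e)F_e(v)$ over edges $e$ starting at $I$, for $v\in\Lambda^*V(\mathcal D(I))$, with $\epsilon$ of type $X$ or $Y$. On $\Lambda^rV(\mathcal D(I))$ put $M_0=\sum_xI(x)$, $Q_0=\operatorname{rank}V(\mathcal D(I))-2r$, homological grading $m=M_0-n_-$, $q$-grading $s=Q_0+M_0+n_+-2n_-$. Then $\mathrm{Kh}'_{m,s}(L)$ is the bigraded homology of $(C(\mathcal D),\partial_\epsilon)$, which up to isomorphism depends only on $L$. *)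

theory Defs
  imports "HOL-Algebra.Free_Abelian_Groups" "HOL-Library.Poly_Mapping"
begin

section \<open>Planar link diagrams\<close>

text \<open>
  Diagrams are given by planar diagram (PD) codes.  Edges of the underlying 4-valent plane graph
  are labelled by natural numbers; \<open>Crossing a b c d\<close> lists the four edges at a crossing in
  counterclockwise order, \<open>a\<close> and \<open>c\<close> belonging to the under-strand.  In the picture in which the
  over-strand runs from upper left to lower right, \<open>a, b, c, d\<close> are the lower left, lower right,
  upper right and upper left ends.  A label that occurs at no crossing is a component without
  crossings.
\<close>

datatype 'e crossing = Crossing 'e 'e 'e 'e

datatype diagram = Diagram (edges: "nat set") (crossings: "nat crossing list")

abbreviation num_crossings :: "diagram \<Rightarrow> nat" where
  "num_crossings D \<equiv> length (crossings D)"

fun ends :: "'e crossing \<Rightarrow> 'e list" where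
  "ends (Crossing a b c d) = [a, b, c, d]"

text \<open>
  Orientation: \<open>a\<close> is always the incoming end of the under-strand, and \<open>pos x\<close> says that crossing
  \<open>x\<close> is positive.  At a positive crossing the over-strand runs from \<open>d\<close> to \<open>b\<close>, at a negative one
  from \<open>b\<close> to \<open>d\<close>.
\<close>

fun incoming :: "bool \<Rightarrow> 'e crossing \<Rightarrow> 'e list" where
  "incoming p (Crossing a b c d) = (if p then [a, d] else [a, b])"

fun outgoing :: "bool \<Rightarrow> 'e crossing \<Rightarrow> 'e list" where
  "outgoing p (Crossing a b c d) = (if p then [c, b] else [c, d])"

definition oriented_diagram :: "diagram \<Rightarrow> (nat \<Rightarrow> bool) \<Rightarrow> bool" where
  "oriented_diagram D pos \<longleftrightarrow>
     (let ins = concat (map (\<lambda>x. incoming (pos x) (crossings D ! x)) [0..<num_crossings D]);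
          outs = concat (map (\<lambda>x. outgoing (pos x) (crossings D ! x)) [0..<num_crossings D])
      in finite (edges D) \<and> distinct ins \<and> distinct outs \<and>
         set ins = set outs \<and> set ins \<subseteq> edges D)"

definition n_plus :: "diagram \<Rightarrow> (nat \<Rightarrow> bool) \<Rightarrow> nat" where
  "n_plus D pos = card {x. x < num_crossings D \<and> pos x}"

definition n_minus :: "diagram \<Rightarrow> (nat \<Rightarrow> bool) \<Rightarrow> nat" where
  "n_minus D pos = card {x. x < num_crossings D \<and> \<not> pos x}"

text \<open>A dart \<open>(x, k)\<close> is the half-edge at position \<open>k\<close> of the crossing \<open>x\<close>.\<close>

type_synonym dart = "nat \<times> nat"

definition darts :: "diagram \<Rightarrow> dart set" where
  "darts D = {..<num_crossings D} \<times> {..<4}"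

definition label :: "diagram \<Rightarrow> dart \<Rightarrow> nat" where
  "label D d = ends (crossings D ! fst d) ! snd d"

definition opposite :: "diagram \<Rightarrow> dart \<Rightarrow> dart" where
  "opposite D d = (THE d'. d' \<in> darts D \<and> d' \<noteq> d \<and> label D d' = label D d)"

definition equiv_closure :: "('a \<times> 'a) set \<Rightarrow> ('a \<times> 'a) set" where
  "equiv_closure r = (r \<union> r\<inverse>)\<^sup>*"

text \<open>
  The dart \<open>(x, k)\<close> also names the corner at \<open>x\<close> between the positions \<open>k\<close> and \<open>k + 1\<close>.  Leaving
  \<open>x\<close> along the dart \<open>k + 1\<close> with this corner on the right, one reaches the next corner of the
  same face.
\<close>

definition next_corner :: "diagram \<Rightarrow> dart \<Rightarrow> dart" where
  "next_corner D d = opposite D (fst d, Suc (snd d) mod 4)"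

definition faces :: "diagram \<Rightarrow> dart set set" where
  "faces D = darts D // equiv_closure {(d, next_corner D d) | d. d \<in> darts D}"

definition graph_components :: "diagram \<Rightarrow> nat set set" where
  "graph_components D =
     {..<num_crossings D} // equiv_closure {(fst d, fst (opposite D d)) | d. d \<in> darts D}"

text \<open>
  Planarity: every component of the 4-valent graph, with the faces determined by the cyclic orders
  at the crossings, has Euler characteristic 2.
\<close>

definition planar :: "diagram \<Rightarrow> bool" where
  "planar D \<longleftrightarrow>
     int (num_crossings D) - int (card (label D ` darts D)) + int (card (faces D))
       = 2 * int (card (graph_components D))"

section \<open>The unnormalized Jones polynomial\<close>

text \<open>The pairs of ends joined by the 0-resolution (\<open>False\<close>) and the 1-resolution (\<open>True\<close>).\<close>

fun smoothing :: "bool \<Rightarrow> 'e crossing \<Rightarrow> ('e \<times> 'e) list" where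
  "smoothing False (Crossing a b c d) = [(a, b), (c, d)]"
| "smoothing True (Crossing a b c d) = [(a, d), (b, c)]"

fun identify :: "nat \<times> nat \<Rightarrow> nat \<Rightarrow> nat" where
  "identify (a, b) e = (if e = max a b then min a b else e)"

definition relabel :: "(nat \<Rightarrow> nat) \<Rightarrow> diagram \<Rightarrow> diagram" where
  "relabel f D = Diagram (f ` edges D) (map (map_crossing f) (crossings D))"

text \<open>\<open>glue ps\<close> sends a label to the least label of its class under the equivalence relation
  generated by the pairs in \<open>ps\<close>.\<close>

fun glue :: "(nat \<times> nat) list \<Rightarrow> nat \<Rightarrow> nat" where
  "glue [] e = e"
| "glue (p # ps) e = glue (map (map_prod (identify p) (identify p)) ps) (identify p e)"

definition resolve :: "bool \<Rightarrow> nat \<Rightarrow> diagram \<Rightarrow> diagram" where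
  "resolve r x D = relabel (glue (smoothing r (crossings D ! x)))
     (Diagram (edges D) (take x (crossings D) @ drop (Suc x) (crossings D)))"

text \<open>The ring of integer Laurent polynomials in \<open>q\<close> is the group ring of the integers.\<close>

type_synonym laurent = "int \<Rightarrow>\<^sub>0 int"

definition qpow :: "int \<Rightarrow> laurent" where
  "qpow s = Poly_Mapping.single s 1"

lemma crossings_relabel [simp]: "crossings (relabel f D) = map (map_crossing f) (crossings D)"
  and edges_relabel [simp]: "edges (relabel f D) = f ` edges D"
  by (simp_all add: relabel_def)

lemma length_crossings_resolve:
  "x < num_crossings D \<Longrightarrow> num_crossings (resolve r x D) < num_crossings D"
  by (simp add: resolve_def)

text \<open>
  The bracket is computed by resolving the first crossing repeatedly; the lemmas
  \<open>bracket_empty\<close>, \<open>bracket_circle\<close> and \<open>bracket_resolve\<close> below are its defining properties, the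
  last one for an arbitrary crossing.
\<close>

function bracket :: "diagram \<Rightarrow> laurent" where
  "bracket D =
     (if crossings D = [] then (qpow 1 + qpow (- 1)) ^ card (edges D)
      else bracket (resolve False 0 D) - qpow 1 * bracket (resolve True 0 D))"
  by auto
termination
  by (relation "measure num_crossings") (auto intro: length_crossings_resolve)

declare bracket.simps [simp del]

lemma bracket_empty: "bracket (Diagram {} []) = 1"
  by (simp add: bracket.simps)

lemma relabel_relabel: "relabel f (relabel g D) = relabel (f \<circ> g) D"
  by (simp add: relabel_def image_comp crossing.map_comp)

lemma glue_append:
  "glue (ps @ qs) = glue (map (map_prod (glue ps) (glue ps)) qs) \<circ> glue ps"
proof (rule ext)
  fix e
  show "glue (ps @ qs) e = (glue (map (map_prod (glue ps) (glue ps)) qs) \<circ> glue ps) e"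
  proof (induction ps e arbitrary: qs rule: glue.induct)
    case (1 e)
    have "glue [] = id" by auto
    then show ?case by (simp add: prod.map_id0)
  next
    case (2 p ps e)
    have "glue (p # ps) = glue (map (map_prod (identify p) (identify p)) ps) \<circ> identify p"
      by auto
    then show ?case
      using 2[of "map (map_prod (identify p) (identify p)) qs"]
      by (simp add: o_def prod.map_comp)
  qed
qed

lemma identify_eq: "identify (a, b) e = (if e = a \<or> e = b then min a b else e)"
  by (auto simp: max_def min_def)

lemma identify_overlap:
  assumes "c = a \<or> c = b \<or> d = a \<or> d = b"
  shows "identify (identify (a, b) c, identify (a, b) d) (identify (a, b) e) =
     (if e \<in> {a, b, c, d} then min (min a b) (min c d) else e)"
proof -
  have m: "min a b = a \<or> min a b = b" by (auto simp: min_def)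
  have mm: "min (min a b) (min c d) = min (min a b) d" if "c = a \<or> c = b"
    using that by (auto simp: min_def)
  have mm': "min (min a b) (min c d) = min (min a b) c" if "d = a \<or> d = b"
    using that by (auto simp: min_def)
  have le: "min (min a b) x = min a b" if "x = a \<or> x = b" for x
    using that by (auto simp: min_def)
  from assms consider "c = a \<or> c = b" | "c \<noteq> a" "c \<noteq> b" "d = a \<or> d = b" by blast
  then show ?thesis
  proof cases
    case 1
    then show ?thesis unfolding mm[OF 1] using m le[of d] by (simp only: identify_eq) auto
  next
    case 2
    then show ?thesis unfolding mm'[OF 2(3)]
      using m by (simp only: identify_eq) (auto simp: min.commute)
  qed
qed

lemma identify_commute:
  "identify (identify (a, b) c, identify (a, b) d) (identify (a, b) e) =
   identify (identify (c, d) a, identify (c, d) b) (identify (c, d) e)"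
proof (cases "c = a \<or> c = b \<or> d = a \<or> d = b")
  case True
  then have "a = c \<or> a = d \<or> b = c \<or> b = d" by blast
  from identify_overlap[OF True] identify_overlap[OF this] show ?thesis
    by (auto simp: min.commute)
next
  case False
  moreover have "min a b = a \<or> min a b = b" "min c d = c \<or> min c d = d"
    by (auto simp: min_def)
  ultimately show ?thesis by (simp only: identify_eq) auto
qed

lemma glue_swap_head: "glue (p # q # ps) e = glue (q # p # ps) e"
proof -
  obtain a b c d where pq: "p = (a, b)" "q = (c, d)" by (cases p, cases q)
  have *: "identify (map_prod (identify p) (identify p) q) (identify p e)
      = identify (map_prod (identify q) (identify q) p) (identify q e)" for e
    using identify_commute by (simp only: pq map_prod_simp)
  then show ?thesis
    by (simp only: glue.simps list.map map_map prod.map_comp o_def)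
qed

lemma glue_cong_Cons:
  "(\<And>e. glue (map (map_prod (identify p) (identify p)) ps) e
      = glue (map (map_prod (identify p) (identify p)) qs) e)
    \<Longrightarrow> glue (p # ps) e = glue (p # qs) e"
  by simp

lemma glue_move: "glue (ps @ p # qs) e = glue (p # ps @ qs) e"
proof (induction "length ps" arbitrary: ps p qs e)
  case 0
  then show ?case by simp
next
  case (Suc n)
  then obtain r rs where ps: "ps = r # rs" "length rs = n" by (cases ps) auto
  let ?f = "map_prod (identify r) (identify r)"
  have "glue (r # rs @ p # qs) e = glue (r # p # rs @ qs) e"
    using Suc.hyps(1)[of "map ?f rs" "?f p" "map ?f qs"] ps(2)
    by (intro glue_cong_Cons) simp
  also have "\<dots> = glue (p # r # rs @ qs) e"
    by (rule glue_swap_head)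
  finally show ?case by (simp add: ps)
qed

lemma glue_append_commute: "glue (ps @ qs) e = glue (qs @ ps) e"
proof (induction "length ps" arbitrary: ps qs e)
  case 0
  then show ?case by simp
next
  case (Suc n)
  then obtain r rs where ps: "ps = r # rs" "length rs = n" by (cases ps) auto
  let ?f = "map_prod (identify r) (identify r)"
  have "glue (r # rs @ qs) e = glue (r # qs @ rs) e"
    using Suc.hyps(1)[of "map ?f rs" "map ?f qs"] ps(2)
    by (intro glue_cong_Cons) simp
  also have "\<dots> = glue (qs @ r # rs) e"
    by (rule glue_move[symmetric])
  finally show ?case by (simp add: ps)
qed

lemma smoothing_map: "smoothing r (map_crossing f c) = map (map_prod f f) (smoothing r c)"
  by (cases r; cases c) auto

lemma resolve_commute:
  assumes D: "crossings D = c # cs" and y: "y < length cs"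
  shows "resolve r y (resolve s 0 D) = resolve s 0 (resolve r (Suc y) D)"
proof -
  let ?ps = "smoothing s c" and ?qs = "smoothing r (cs ! y)"
  let ?D = "Diagram (edges D) (take y cs @ drop (Suc y) cs)"
  have 1: "Diagram (edges (relabel f (Diagram E xs))) (map (map_crossing f) ys)
      = relabel f (Diagram E ys)" for f E xs ys
    by (simp add: relabel_def)
  have "resolve r y (resolve s 0 D) = relabel (glue (?ps @ ?qs)) ?D"
    using y by (simp add: resolve_def D smoothing_map glue_append 1 take_map drop_map
        flip: relabel_relabel map_append) (simp add: relabel_def)
  also have "glue (?ps @ ?qs) = glue (?qs @ ?ps)"
    by (intro ext glue_append_commute)
  also have "relabel (glue (?qs @ ?ps)) ?D = resolve s 0 (resolve r (Suc y) D)"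
    using y by (simp add: resolve_def D smoothing_map glue_append 1 take_map drop_map
        flip: relabel_relabel map_append) (simp add: relabel_def)
  finally show ?thesis .
qed

lemma bracket_resolve:
  "x < num_crossings D \<Longrightarrow>
     bracket D = bracket (resolve False x D) - qpow 1 * bracket (resolve True x D)"
proof (induction "num_crossings D" arbitrary: D x rule: less_induct)
  case less
  from less.prems obtain c cs where D: "crossings D = c # cs"
    by (cases "crossings D") auto
  have head: "bracket D = bracket (resolve False 0 D) - qpow 1 * bracket (resolve True 0 D)"
    by (simp add: bracket.simps[of D] D)
  show ?case
  proof (cases x)
    case 0
    then show ?thesis using head by simp
  next
    case (Suc y)
    then have y: "y < length cs" using less.prems D by simp
    have len: "num_crossings (resolve s 0 D) = length cs" for s
      by (simp add: resolve_def D)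
    have ind: "bracket (resolve s 0 D) = bracket (resolve False y (resolve s 0 D))
        - qpow 1 * bracket (resolve True y (resolve s 0 D))" for s
      by (rule less.hyps) (simp_all add: len y, simp add: D)
    have "crossings (resolve r x D) \<noteq> []" for r
      by (simp add: resolve_def D Suc)
    then have exp: "bracket (resolve r x D) = bracket (resolve False 0 (resolve r x D))
        - qpow 1 * bracket (resolve True 0 (resolve r x D))" for r
      using bracket.simps[of "resolve r x D"] by simp
    show ?thesis
      unfolding head ind[of False] ind[of True] Suc exp[of False, unfolded Suc]
        exp[of True, unfolded Suc] resolve_commute[OF D y]
      by (simp add: algebra_simps)
  qed
qed

lemma glue_closed:
  assumes "set ps \<subseteq> E \<times> E"
  shows "(e \<in> E \<longrightarrow> glue ps e \<in> E) \<and> (e \<notin> E \<longrightarrow> glue ps e = e)"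
  using assms
proof (induction ps e rule: glue.induct)
  case (1 e)
  then show ?case by simp
next
  case (2 p ps e)
  have p: "identify p e \<in> E" if "e \<in> E" for e
    using that 2(2) by (cases p) (auto simp: min_def)
  have p': "identify p e = e" if "e \<notin> E" for e
    using that 2(2) by (cases p) (auto simp: max_def)
  have "set (map (map_prod (identify p) (identify p)) ps) \<subseteq> E \<times> E"
    using 2(2) p by auto
  from 2(1)[OF this] show ?case
    using p[of e] p'[of e] by auto
qed

lemma bracket_circle:
  assumes "finite E" "\<And>c. c \<in> set cs \<Longrightarrow> set_crossing c \<subseteq> E" "e \<notin> E"
  shows "bracket (Diagram (insert e E) cs) = (qpow 1 + qpow (- 1)) * bracket (Diagram E cs)"
  using assms
proof (induction "length cs" arbitrary: E cs)
  case 0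
  then show ?case by (simp add: bracket.simps)
next
  case (Suc n)
  then obtain c ds where cs: "cs = c # ds" "length ds = n" by (cases cs) auto
  have IH: "bracket (resolve r 0 (Diagram (insert e E) cs))
      = (qpow 1 + qpow (- 1)) * bracket (resolve r 0 (Diagram E cs))" for r
  proof -
    let ?f = "glue (smoothing r c)"
    have "set_crossing c \<subseteq> E" using Suc.prems(2) cs by auto
    then have "set (smoothing r c) \<subseteq> E \<times> E"
      by (cases c; cases r) auto
    from glue_closed[OF this] have f: "?f ` E \<subseteq> E" "?f e = e"
      using Suc.prems(3) by auto
    have "bracket (Diagram (insert e (?f ` E)) (map (map_crossing ?f) ds))
        = (qpow 1 + qpow (- 1)) * bracket (Diagram (?f ` E) (map (map_crossing ?f) ds))"
    proof (rule Suc.hyps(1))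
      fix c' assume "c' \<in> set (map (map_crossing ?f) ds)"
      then obtain d where "d \<in> set ds" "c' = map_crossing ?f d" by auto
      moreover have "set_crossing d \<subseteq> E" using Suc.prems(2) cs \<open>d \<in> set ds\<close> by simp
      ultimately show "set_crossing c' \<subseteq> ?f ` E" by (auto simp: crossing.set_map)
    qed (use f Suc.prems Suc.hyps(2) cs in auto)
    then show ?thesis
      using f(2) by (simp add: resolve_def relabel_def cs)
  qed
  show ?case
    using bracket.simps[of "Diagram (insert e E) cs"] bracket.simps[of "Diagram E cs"]
    by (simp add: cs(1)) (simp add: IH[unfolded cs(1)] algebra_simps)
qed

definition unnormalized_jones :: "diagram \<Rightarrow> (nat \<Rightarrow> bool) \<Rightarrow> laurent" where
  "unnormalized_jones D pos =
     (- 1) ^ n_minus D pos * qpow (int (n_plus D pos) - 2 * int (n_minus D pos)) * bracket D"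

section \<open>Exterior algebras of free abelian groups\<close>

text \<open>
  For a finite set \<open>S\<close> of natural numbers, the exterior algebra of the free abelian group on \<open>S\<close>
  is the free abelian group on the subsets of \<open>S\<close>; the subset \<open>{a\<^sub>1 < \<dots> < a\<^sub>r}\<close> stands for
  the monomial \<open>a\<^sub>1 \<and> \<dots> \<and> a\<^sub>r\<close>.
\<close>

definition exterior :: "nat set \<Rightarrow> (nat set \<Rightarrow>\<^sub>0 int) set" where
  "exterior S = carrier (free_Abelian_group (Pow S))"

definition wedge_monomials :: "nat set \<Rightarrow> nat set \<Rightarrow> (nat set \<Rightarrow>\<^sub>0 int)" where
  "wedge_monomials A B =
     (if A \<inter> B = {}
      then frag_cmul ((- 1) ^ card {(a, b). a \<in> A \<and> b \<in> B \<and> b < a}) (frag_of (A \<union> B))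
      else 0)"

definition wedge :: "(nat set \<Rightarrow>\<^sub>0 int) \<Rightarrow> (nat set \<Rightarrow>\<^sub>0 int) \<Rightarrow> (nat set \<Rightarrow>\<^sub>0 int)" where
  "wedge u v = frag_extend (\<lambda>A. frag_extend (wedge_monomials A) v) u"

text \<open>A generator, as an element of degree 1.\<close>

definition gen :: "nat \<Rightarrow> (nat set \<Rightarrow>\<^sub>0 int)" where
  "gen a = frag_of {a}"

text \<open>The algebra homomorphism induced by a map of generators.\<close>

definition exterior_map :: "(nat \<Rightarrow> nat) \<Rightarrow> (nat set \<Rightarrow>\<^sub>0 int) \<Rightarrow> (nat set \<Rightarrow>\<^sub>0 int)" where
  "exterior_map f =
     frag_extend (\<lambda>A. foldr (\<lambda>a. wedge (gen (f a))) (sorted_list_of_set A) (frag_of {}))"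

section \<open>The hypercube of resolutions\<close>

text \<open>
  A vertex of the hypercube is given by the set \<open>I\<close> of crossings where it takes the value 1.  A
  circle of the resolution is a class of edges joined by the resolution, named by its least edge.
\<close>

definition joined :: "diagram \<Rightarrow> nat set \<Rightarrow> (nat \<times> nat) set" where
  "joined D I =
     (\<Union>x\<in>{..<num_crossings D}. set (smoothing (x \<in> I) (crossings D ! x)))"

definition circle_of :: "diagram \<Rightarrow> nat set \<Rightarrow> nat \<Rightarrow> nat" where
  "circle_of D I e = Min (equiv_closure (joined D I) `` {e})"

definition circles :: "diagram \<Rightarrow> nat set \<Rightarrow> nat set" where
  "circles D I = circle_of D I ` edges D"

text \<open>
  The arrow \<open>\<gamma>\<^sub>x\<close> joins the strands \<open>ab\<close> and \<open>cd\<close> of the 0-resolution; \<open>arr x\<close> says that it points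
  from \<open>ab\<close> to \<open>cd\<close>.  Rotated by 90 degrees counterclockwise it then points from the strand \<open>bc\<close> to
  the strand \<open>ad\<close> of the 1-resolution, and otherwise from \<open>ad\<close> to \<open>bc\<close>.
\<close>

fun dual_tail :: "bool \<Rightarrow> 'e crossing \<Rightarrow> 'e" where
  "dual_tail r (Crossing a b c d) = (if r then b else a)"

fun dual_head :: "bool \<Rightarrow> 'e crossing \<Rightarrow> 'e" where
  "dual_head r (Crossing a b c d) = (if r then a else b)"

text \<open>
  The edge of the hypercube from \<open>I\<close> to \<open>insert x I\<close> is a merge if the strands \<open>ab\<close> and \<open>cd\<close> at
  \<open>x\<close> lie on different circles; for a planar diagram it is a split otherwise.
\<close>

definition is_merge :: "diagram \<Rightarrow> nat set \<Rightarrow> nat \<Rightarrow> bool" where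
  "is_merge D I x \<longleftrightarrow>
     (case crossings D ! x of Crossing a b c d \<Rightarrow> circle_of D I a \<noteq> circle_of D I c)"

definition merge_map :: "diagram \<Rightarrow> nat set \<Rightarrow> nat \<Rightarrow> (nat set \<Rightarrow>\<^sub>0 int) \<Rightarrow> (nat set \<Rightarrow>\<^sub>0 int)" where
  "merge_map D I x = exterior_map (circle_of D (insert x I))"

definition split_map ::
    "diagram \<Rightarrow> (nat \<Rightarrow> bool) \<Rightarrow> nat set \<Rightarrow> nat \<Rightarrow> (nat set \<Rightarrow>\<^sub>0 int) \<Rightarrow> (nat set \<Rightarrow>\<^sub>0 int)" where
  "split_map D arr I x v =
     (let J = insert x I;
          a1 = circle_of D J (dual_tail (arr x) (crossings D ! x));
          a2 = circle_of D J (dual_head (arr x) (crossings D ! x));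
          lift = (SOME w. w \<in> exterior (circles D J) \<and> exterior_map (circle_of D I) w = v)
      in wedge (gen a1 - gen a2) lift)"

definition edge_map ::
    "diagram \<Rightarrow> (nat \<Rightarrow> bool) \<Rightarrow> nat set \<Rightarrow> nat \<Rightarrow> (nat set \<Rightarrow>\<^sub>0 int) \<Rightarrow> (nat set \<Rightarrow>\<^sub>0 int)" where
  "edge_map D arr I x = (if is_merge D I x then merge_map D I x else split_map D arr I x)"

definition hypercube_edges :: "diagram \<Rightarrow> (nat set \<times> nat) set" where
  "hypercube_edges D = {(I, x). I \<subseteq> {..<num_crossings D} \<and> x < num_crossings D \<and> x \<notin> I}"

definition hypercube_squares :: "diagram \<Rightarrow> (nat set \<times> nat \<times> nat) set" where
  "hypercube_squares D =
     {(I, x, y). I \<subseteq> {..<num_crossings D} \<and> x < num_crossings D \<and> y < num_crossings D \<and>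
        x \<notin> I \<and> y \<notin> I \<and> x \<noteq> y}"

definition square_edges :: "nat set \<Rightarrow> nat \<Rightarrow> nat \<Rightarrow> (nat set \<times> nat) set" where
  "square_edges I x y = {(I, x), (insert x I, y), (I, y), (insert y I, x)}"

definition square_map ::
    "diagram \<Rightarrow> (nat \<Rightarrow> bool) \<Rightarrow> nat set \<Rightarrow> nat \<Rightarrow> nat \<Rightarrow> (nat set \<Rightarrow>\<^sub>0 int) \<Rightarrow> (nat set \<Rightarrow>\<^sub>0 int)" where
  "square_map D arr I x y v = edge_map D arr (insert x I) y (edge_map D arr I x v)"

section \<open>Types of squares\<close>

definition nonzero_square :: "diagram \<Rightarrow> (nat \<Rightarrow> bool) \<Rightarrow> nat set \<Rightarrow> nat \<Rightarrow> nat \<Rightarrow> bool" where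
  "nonzero_square D arr I x y \<longleftrightarrow>
     (\<exists>v\<in>exterior (circles D I). square_map D arr I x y v \<noteq> 0) \<and>
     (\<exists>v\<in>exterior (circles D I). square_map D arr I y x v \<noteq> 0)"

definition type_C :: "diagram \<Rightarrow> (nat \<Rightarrow> bool) \<Rightarrow> nat set \<Rightarrow> nat \<Rightarrow> nat \<Rightarrow> bool" where
  "type_C D arr I x y \<longleftrightarrow> nonzero_square D arr I x y \<and>
     (\<forall>v\<in>exterior (circles D I). square_map D arr I x y v = square_map D arr I y x v)"

definition type_A :: "diagram \<Rightarrow> (nat \<Rightarrow> bool) \<Rightarrow> nat set \<Rightarrow> nat \<Rightarrow> nat \<Rightarrow> bool" where
  "type_A D arr I x y \<longleftrightarrow> nonzero_square D arr I x y \<and>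
     (\<forall>v\<in>exterior (circles D I). square_map D arr I x y v = - square_map D arr I y x v)"

text \<open>
  Travelling along a circle of \<open>I\<close>: \<open>next_dart\<close> leaves a crossing along a dart, arrives at the
  opposite dart and follows the resolution to the dart along which it leaves again.  The strand
  just traversed consists of the positions 0, 1 (strand 0) or 2, 3 (strand 1) if the crossing is
  0-resolved.
\<close>

definition partner :: "bool \<Rightarrow> nat \<Rightarrow> nat" where
  "partner r k = (if r then 3 - k else if even k then k + 1 else k - 1)"

definition next_dart :: "diagram \<Rightarrow> nat set \<Rightarrow> dart \<Rightarrow> dart" where
  "next_dart D I d = (let (x, k) = opposite D d in (x, partner (x \<in> I) k))"

definition strand :: "dart \<Rightarrow> nat \<times> nat" where
  "strand d = (fst d, snd d div 2)"

text \<open>The next time one of the crossings in \<open>A\<close> is passed.\<close>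

definition next_visit :: "diagram \<Rightarrow> nat set \<Rightarrow> nat set \<Rightarrow> dart \<Rightarrow> dart" where
  "next_visit D I A d =
     (next_dart D I ^^ (LEAST n. 0 < n \<and> fst ((next_dart D I ^^ n) d) \<in> A)) d"

text \<open>The strands of the 0-resolution at which \<open>\<gamma>\<^sub>x\<close> has its tail and its head.\<close>

definition tail_strand :: "(nat \<Rightarrow> bool) \<Rightarrow> nat \<Rightarrow> nat \<times> nat" where
  "tail_strand arr x = (x, if arr x then 0 else 1)"

definition head_strand :: "(nat \<Rightarrow> bool) \<Rightarrow> nat \<Rightarrow> nat \<times> nat" where
  "head_strand arr x = (x, if arr x then 1 else 0)"

text \<open>
  The start of the traversal used for the types X and Y.  A strand of the 0-resolution at \<open>x\<close> that
  is left along an odd dart has \<open>\<gamma>\<^sub>x\<close> on its left, so if \<open>\<gamma>\<^sub>x\<close> is the inside arc, leaving the tail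
  strand along its odd dart is the counterclockwise direction.
\<close>

definition tail_dart :: "(nat \<Rightarrow> bool) \<Rightarrow> nat \<Rightarrow> dart" where
  "tail_dart arr x = (x, if arr x then 1 else 3)"

text \<open>
  Both arcs have all endpoints on one circle, and these interleave: from the tail of \<open>\<gamma>\<^sub>x\<close> one
  meets, in this order, one end of \<open>\<gamma>\<^sub>y\<close>, the head of \<open>\<gamma>\<^sub>x\<close> and the other end of \<open>\<gamma>\<^sub>y\<close>.
\<close>

definition interleaved :: "diagram \<Rightarrow> (nat \<Rightarrow> bool) \<Rightarrow> nat set \<Rightarrow> nat \<Rightarrow> nat \<Rightarrow> bool" where
  "interleaved D arr I x y \<longleftrightarrow>
     (let nxt = next_visit D I {x, y}; d1 = nxt (tail_dart arr x); d2 = nxt d1; d3 = nxt d2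
      in strand d2 = head_strand arr x \<and>
         {strand d1, strand d3} = {tail_strand arr y, head_strand arr y})"

text \<open>
  Here the first crossing \<open>x\<close> plays the role of the one with the inside arc.  If the inside and the
  outside of the circle are exchanged (equivalently, \<open>x\<close> and \<open>y\<close>), the traversal starts at the
  other tail and runs in the other direction, which leads to the same type; so the type does not
  depend on which face of the diagram on the sphere contains the point at infinity.
\<close>

definition type_X :: "diagram \<Rightarrow> (nat \<Rightarrow> bool) \<Rightarrow> nat set \<Rightarrow> nat \<Rightarrow> nat \<Rightarrow> bool" where
  "type_X D arr I x y \<longleftrightarrow> interleaved D arr I x y \<and>
     strand (next_visit D I {x, y} (tail_dart arr x)) = tail_strand arr y"

definition type_Y :: "diagram \<Rightarrow> (nat \<Rightarrow> bool) \<Rightarrow> nat set \<Rightarrow> nat \<Rightarrow> nat \<Rightarrow> bool" where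
  "type_Y D arr I x y \<longleftrightarrow> interleaved D arr I x y \<and>
     strand (next_visit D I {x, y} (tail_dart arr x)) = head_strand arr y"

section \<open>Edge assignments\<close>

definition sign_assignment :: "diagram \<Rightarrow> (nat set \<times> nat \<Rightarrow> int) \<Rightarrow> bool" where
  "sign_assignment D \<epsilon> \<longleftrightarrow> (\<forall>e\<in>hypercube_edges D. \<epsilon> e = 1 \<or> \<epsilon> e = - 1)"

definition even_square :: "(nat set \<times> nat \<Rightarrow> int) \<Rightarrow> nat set \<Rightarrow> nat \<Rightarrow> nat \<Rightarrow> bool" where
  "even_square \<epsilon> I x y \<longleftrightarrow> even (card {e \<in> square_edges I x y. \<epsilon> e = - 1})"

definition edge_assignment_X ::
    "diagram \<Rightarrow> (nat \<Rightarrow> bool) \<Rightarrow> (nat set \<times> nat \<Rightarrow> int) \<Rightarrow> bool" where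
  "edge_assignment_X D arr \<epsilon> \<longleftrightarrow> sign_assignment D \<epsilon> \<and>
     (\<forall>(I, x, y)\<in>hypercube_squares D.
        (type_A D arr I x y \<or> type_X D arr I x y \<longrightarrow> even_square \<epsilon> I x y) \<and>
        (type_C D arr I x y \<or> type_Y D arr I x y \<longrightarrow> \<not> even_square \<epsilon> I x y))"

definition edge_assignment_Y ::
    "diagram \<Rightarrow> (nat \<Rightarrow> bool) \<Rightarrow> (nat set \<times> nat \<Rightarrow> int) \<Rightarrow> bool" where
  "edge_assignment_Y D arr \<epsilon> \<longleftrightarrow> sign_assignment D \<epsilon> \<and>
     (\<forall>(I, x, y)\<in>hypercube_squares D.
        (type_A D arr I x y \<or> type_Y D arr I x y \<longrightarrow> even_square \<epsilon> I x y) \<and>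
        (type_C D arr I x y \<or> type_X D arr I x y \<longrightarrow> \<not> even_square \<epsilon> I x y))"

section \<open>Odd Khovanov homology\<close>

text \<open>
  The direct sum of the exterior algebras over all vertices \<open>I\<close> is the free abelian group on the
  pairs \<open>(I, A)\<close> where \<open>A\<close> is a set of circles of \<open>I\<close>.
\<close>

type_synonym chain = "nat set \<times> nat set \<Rightarrow>\<^sub>0 int"

definition at_vertex :: "nat set \<Rightarrow> (nat set \<Rightarrow>\<^sub>0 int) \<Rightarrow> chain" where
  "at_vertex I = frag_extend (\<lambda>A. frag_of (I, A))"

definition differential ::
    "diagram \<Rightarrow> (nat \<Rightarrow> bool) \<Rightarrow> (nat set \<times> nat \<Rightarrow> int) \<Rightarrow> chain \<Rightarrow> chain" where
  "differential D arr \<epsilon> = frag_extend (\<lambda>(I, A).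
     \<Sum>x\<in>{..<num_crossings D} - I.
       frag_cmul (\<epsilon> (I, x)) (at_vertex (insert x I) (edge_map D arr I x (frag_of A))))"

definition homological_degree :: "diagram \<Rightarrow> (nat \<Rightarrow> bool) \<Rightarrow> nat set \<times> nat set \<Rightarrow> int" where
  "homological_degree D pos = (\<lambda>(I, A). int (card I) - int (n_minus D pos))"

definition q_degree :: "diagram \<Rightarrow> (nat \<Rightarrow> bool) \<Rightarrow> nat set \<times> nat set \<Rightarrow> int" where
  "q_degree D pos = (\<lambda>(I, A). (int (card (circles D I)) - 2 * int (card A)) + int (card I)
     + int (n_plus D pos) - 2 * int (n_minus D pos))"

definition chain_group :: "diagram \<Rightarrow> (nat \<Rightarrow> bool) \<Rightarrow> int \<Rightarrow> int \<Rightarrow> chain monoid" where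
  "chain_group D pos m s = free_Abelian_group
     {(I, A). I \<subseteq> {..<num_crossings D} \<and> A \<subseteq> circles D I \<and>
        homological_degree D pos (I, A) = m \<and> q_degree D pos (I, A) = s}"

definition odd_khovanov ::
    "diagram \<Rightarrow> (nat \<Rightarrow> bool) \<Rightarrow> (nat \<Rightarrow> bool) \<Rightarrow> (nat set \<times> nat \<Rightarrow> int) \<Rightarrow> int \<Rightarrow> int \<Rightarrow>
       chain set monoid" where
  "odd_khovanov D pos arr \<epsilon> m s =
     subgroup_generated (chain_group D pos m s)
       (kernel (chain_group D pos m s) (chain_group D pos (m + 1) s) (differential D arr \<epsilon>))
     Mod (differential D arr \<epsilon> ` carrier (chain_group D pos (m - 1) s))"

text \<open>The rank of an abelian group: the largest size of a finite \<open>\<int>\<close>-linearly independent subset.\<close>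

definition int_independent :: "('a, 'b) monoid_scheme \<Rightarrow> 'a set \<Rightarrow> bool" where
  "int_independent G S \<longleftrightarrow> S \<subseteq> carrier G \<and> finite S \<and>
     (\<forall>c :: 'a \<Rightarrow> int. finprod G (\<lambda>x. x [^]\<^bsub>G\<^esub> c x) S = \<one>\<^bsub>G\<^esub> \<longrightarrow> (\<forall>x\<in>S. c x = 0))"

definition ab_rank :: "('a, 'b) monoid_scheme \<Rightarrow> nat" where
  "ab_rank G = Sup {card S | S. int_independent G S}"

end

theory Submission
  imports Defs "HOL-Library.Function_Algebras" HOL.Vector_Spaces HOL.Rat
begin

text \<open>
  Resolving all crossings expresses the bracket as a sum over the vertices \<open>I\<close> of the hypercube,
  and expanding \<open>(q + q\<^sup>-\<^sup>1)\<^sup>n\<close> over the subsets of the circles of \<open>I\<close> turns the Jones polynomial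
  into the graded Euler characteristic of the chain groups.  It agrees with that of the homology by
  rank and nullity, once the differential is known to square to zero and to preserve the
  \<open>q\<close>-grading.

  Both are seen by writing every element of \<open>\<Lambda>\<^sup>*V(\<D>(I))\<close> as the image \<open>[w]\<^sub>I\<close> of an element \<open>w\<close> of the
  exterior algebra on the edges of the diagram.  A merge sends \<open>[w]\<^sub>I\<close> to \<open>[w]\<^sub>J\<close>, any other edge of
  the hypercube sends it to \<open>[(a - b) \<and> w]\<^sub>J\<close> where \<open>a\<close> and \<open>b\<close> are two edges at the crossing.  The
  two composites around a square thus wedge \<open>[w]\<^sub>K\<close> with at most two differences of circles of the
  last vertex \<open>K\<close>, and counting circles shows that these factors agree up to sign.
\<close>

section \<open>Circles of resolutions\<close>

text \<open>A split map wedges with an arbitrarily chosen lift, so its definition shows neither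
  additivity nor a formula. Labels of diagram edges, unlike circles, do not change with the vertex;
  they provide a lift at every vertex and separate the wedge algebra from the renaming of circles.

  Squares are not classified by pictures. A resolution is remembered only as a partition of the
  edges, and changing one crossing joins or divides classes. That the two circles of a merge become
  one circle is not formal: it rests on parity, every used edge having two ends. This keeps the
  formulas for the maps uniform.

  For the cancellation around a square the sign relating the composites must not depend on the
  element they are applied to. The rank is a supremum over independent subsets of a quotient group;
  it is matched with dimensions over the rationals by lifting such subsets to cycles and adjoining a
  basis of the boundaries.\<close>

lemma equiv_equiv_closure: "equiv UNIV (equiv_closure r)"
  unfolding equiv_closure_def
  by (intro equivI refl_rtrancl sym_rtrancl sym_Un_converse trans_rtrancl) auto


lemma equiv_closure_refl [simp]: "(x, x) \<in> equiv_closure r"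
  by (simp add: equiv_closure_def)

lemma equiv_closure_sym: "(x, y) \<in> equiv_closure r \<Longrightarrow> (y, x) \<in> equiv_closure r"
  by (metis equiv_equiv_closure equiv_def symD)

lemma equiv_closure_trans:
  "(x, y) \<in> equiv_closure r \<Longrightarrow> (y, z) \<in> equiv_closure r \<Longrightarrow> (x, z) \<in> equiv_closure r"
  by (metis equiv_equiv_closure equiv_def transD)

lemma equiv_closure_base: "(x, y) \<in> r \<Longrightarrow> (x, y) \<in> equiv_closure r"
  unfolding equiv_closure_def by blast

lemma equiv_closure_least:
  assumes "r \<subseteq> s" "equiv UNIV s" shows "equiv_closure r \<subseteq> s"
proof
  fix z assume "z \<in> equiv_closure r"
  then obtain x y where z: "z = (x, y)" "(x, y) \<in> (r \<union> r\<inverse>)\<^sup>*"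
    unfolding equiv_closure_def by (cases z) auto
  from z(2) have "(x, y) \<in> s"
  proof (induction rule: rtrancl_induct)
    case base
    then show ?case using assms(2) by (auto simp: equiv_def refl_on_def)
  next
    case (step y z)
    then have "(y, z) \<in> s" using assms by (auto simp: equiv_def sym_def)
    then show ?case using step.IH assms(2) by (meson equiv_def transD)
  qed
  then show "z \<in> s" by (simp add: z)
qed

lemma equiv_closure_subset_iff: "equiv_closure r \<subseteq> equiv_closure s \<longleftrightarrow> r \<subseteq> equiv_closure s"
proof
  show "r \<subseteq> equiv_closure s" if "equiv_closure r \<subseteq> equiv_closure s"
    using that by (auto intro: equiv_closure_base)
  show "equiv_closure r \<subseteq> equiv_closure s" if "r \<subseteq> equiv_closure s"
    using that by (rule equiv_closure_least) (rule equiv_equiv_closure)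
qed

lemma equiv_closure_mono: "r \<subseteq> s \<Longrightarrow> (x, y) \<in> equiv_closure r \<Longrightarrow> (x, y) \<in> equiv_closure s"
  using equiv_closure_subset_iff[of r s] equiv_closure_base[of _ _ s] by auto

lemma equiv_closure_iff_class:
  "(x, y) \<in> equiv_closure r \<longleftrightarrow> equiv_closure r `` {x} = equiv_closure r `` {y}"
  by (rule eq_equiv_class_iff[OF equiv_equiv_closure UNIV_I UNIV_I, symmetric])

text \<open>The right-hand side is itself an equivalence relation containing the enlarged generating
  set, so minimality of the closure gives the harder direction.\<close>

lemma equiv_closure_insert_iff:
  "(x, y) \<in> equiv_closure (insert (u, v) r) \<longleftrightarrow>
     (x, y) \<in> equiv_closure r \<or>
     ((x, u) \<in> equiv_closure r \<or> (x, v) \<in> equiv_closure r) \<and>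
     ((y, u) \<in> equiv_closure r \<or> (y, v) \<in> equiv_closure r)"
  (is "_ \<longleftrightarrow> ?P x y")
proof
  have "equiv_closure (insert (u, v) r) \<subseteq> {(x, y). ?P x y}"
  proof (rule equiv_closure_least)
    show "insert (u, v) r \<subseteq> {(x, y). ?P x y}"
      by (auto intro: equiv_closure_base)
    show "equiv UNIV {(x, y). ?P x y}"
      unfolding equiv_closure_iff_class
      by (rule equivI) (auto simp: refl_on_def sym_def trans_def)
  qed
  then show "?P x y" if "(x, y) \<in> equiv_closure (insert (u, v) r)" using that by blast
next
  let ?c = "\<lambda>x. equiv_closure (insert (u, v) r) `` {x}"
  have uv: "?c u = ?c v"
    by (subst equiv_closure_iff_class[symmetric]) (simp add: equiv_closure_base)
  have "?c s = ?c t" if "(s, t) \<in> equiv_closure r" for s t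
    using equiv_closure_mono[OF subset_insertI that] by (simp only: equiv_closure_iff_class)
  then show "(x, y) \<in> equiv_closure (insert (u, v) r)" if "?P x y"
    using that uv by (subst equiv_closure_iff_class) metis
qed

text \<open>Both images are in bijection with the common partition of \<open>A\<close> into fibres.
  This compares numbers of circles when the circles are named differently.\<close>

lemma card_image_eq_kernel:
  assumes "\<And>x y. x \<in> A \<Longrightarrow> y \<in> A \<Longrightarrow> f x = f y \<longleftrightarrow> g x = g y"
  shows "card (f ` A) = card (g ` A)"
proof (rule bij_betw_same_card)
  have h: "(g \<circ> inv_into A f) (f x) = g x" if "x \<in> A" for x
    using assms[of "inv_into A f (f x)" x] that by (simp add: inv_into_into f_inv_into_f)
  show "bij_betw (g \<circ> inv_into A f) (f ` A) (g ` A)"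
    unfolding bij_betw_def
  proof
    show "inj_on (g \<circ> inv_into A f) (f ` A)"
    proof (rule inj_onI)
      fix u v assume "u \<in> f ` A" "v \<in> f ` A"
        and eq: "(g \<circ> inv_into A f) u = (g \<circ> inv_into A f) v"
      then obtain x y where "u = f x" "v = f y" "x \<in> A" "y \<in> A" by auto
      then show "u = v" using eq h assms by metis
    qed
    show "(g \<circ> inv_into A f) ` f ` A = g ` A"
      using h by (force simp: image_image simp del: comp_apply)
  qed
qed

text \<open>Weaker than \<open>oriented_diagram\<close> and stable under \<open>resolve\<close>,
  unlike an orientation: a smoothing may join two incoming ends. The induction for the state sum
  runs over such diagrams.\<close>

definition wf_diagram :: "diagram \<Rightarrow> bool" where
  "wf_diagram D \<longleftrightarrow> finite (edges D) \<and> (\<forall>c\<in>set (crossings D). set_crossing c \<subseteq> edges D)"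

abbreviation same_circle :: "diagram \<Rightarrow> nat set \<Rightarrow> (nat \<times> nat) set" where
  "same_circle D I \<equiv> equiv_closure (joined D I)"

lemma joined_subset: "wf_diagram D \<Longrightarrow> joined D I \<subseteq> edges D \<times> edges D"
proof -
  assume wf: "wf_diagram D"
  have "set (smoothing r c) \<subseteq> set_crossing c \<times> set_crossing c" for r and c :: "nat crossing"
    by (cases r; cases c) auto
  with wf show ?thesis by (fastforce simp: joined_def wf_diagram_def)
qed

text \<open>Labels outside \<open>edges D\<close> are alone in their classes. Hence all classes are
  finite, and the minimum in \<open>circle_of\<close> is a member of its class.\<close>

lemma same_circle_closed:
  assumes "wf_diagram D"
  shows "same_circle D I \<subseteq> Id \<union> edges D \<times> edges D"
proof (rule equiv_closure_least)
  show "joined D I \<subseteq> Id \<union> edges D \<times> edges D" using joined_subset[OF assms] by blast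
  show "equiv UNIV (Id \<union> edges D \<times> edges D)"
    by (intro equivI) (auto simp: refl_on_def sym_def trans_def)
qed

lemma circle_of_mem: "wf_diagram D \<Longrightarrow> (e, circle_of D I e) \<in> same_circle D I"
proof -
  assume wf: "wf_diagram D"
  have "same_circle D I `` {e} \<subseteq> insert e (edges D)" using same_circle_closed[OF wf] by blast
  then have "finite (same_circle D I `` {e})"
    using wf by (meson finite_insert finite_subset wf_diagram_def)
  moreover have "e \<in> same_circle D I `` {e}" by simp
  ultimately have "circle_of D I e \<in> same_circle D I `` {e}"
    unfolding circle_of_def by (intro Min_in) (assumption, metis empty_iff)
  then show ?thesis by simp
qed

lemma circle_of_eq_iff:
  assumes "wf_diagram D"
  shows "circle_of D I e = circle_of D I e' \<longleftrightarrow> (e, e') \<in> same_circle D I"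
proof
  show "(e, e') \<in> same_circle D I" if "circle_of D I e = circle_of D I e'"
  proof (rule equiv_closure_trans)
    show "(e, circle_of D I e') \<in> same_circle D I"
      using circle_of_mem[OF assms, of e I] that by simp
    show "(circle_of D I e', e') \<in> same_circle D I"
      using circle_of_mem[OF assms] by (rule equiv_closure_sym)
  qed
  show "circle_of D I e = circle_of D I e'" if "(e, e') \<in> same_circle D I"
    using equiv_class_eq[OF equiv_equiv_closure that] by (simp add: circle_of_def)
qed

lemma finite_circles: "wf_diagram D \<Longrightarrow> finite (circles D I)"
  by (simp add: circles_def wf_diagram_def)

lemma circles_subset: "wf_diagram D \<Longrightarrow> circles D I \<subseteq> edges D"
proof -
  assume wf: "wf_diagram D"
  have "circle_of D I e \<in> edges D" if "e \<in> edges D" for e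
    using subsetD[OF same_circle_closed[OF wf] circle_of_mem[OF wf, of e I]] that by auto
  then show ?thesis by (auto simp: circles_def)
qed

lemma circle_of_circle [simp]:
  "wf_diagram D \<Longrightarrow> circle_of D I (circle_of D I e) = circle_of D I e"
  by (simp add: circle_of_eq_iff equiv_closure_sym[OF circle_of_mem])

lemma oriented_diagram_wf: assumes "oriented_diagram D pos" shows "wf_diagram D"
proof -
  have "set_crossing c \<subseteq> edges D" if c: "c \<in> set (crossings D)" for c
  proof -
    obtain x where x: "x < num_crossings D" "c = crossings D ! x"
      using c by (metis in_set_conv_nth)
    have "set_crossing c \<subseteq> set (incoming (pos x) c) \<union> set (outgoing (pos x) c)"
      by (cases c) auto
    also have "\<dots> \<subseteq> edges D"
    proof -
      have "set (concat (map (\<lambda>x. incoming (pos x) (crossings D ! x)) [0..<num_crossings D])) \<subseteq> edges D"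
        "set (concat (map (\<lambda>x. outgoing (pos x) (crossings D ! x)) [0..<num_crossings D])) \<subseteq> edges D"
        using assms unfolding oriented_diagram_def Let_def by argo+
      then show ?thesis using x by (auto simp: UN_subset_iff)
    qed
    finally show ?thesis .
  qed
  moreover have "finite (edges D)"
    using assms unfolding oriented_diagram_def Let_def by argo
  ultimately show ?thesis by (simp add: wf_diagram_def)
qed

section \<open>Parity of ends and the effect of changing one crossing\<close>

lemma length_filter_concat_upt:
  "length (filter P (concat (map f [0..<n]))) = (\<Sum>x<n. length (filter P (f x)))"
  by (induction n) auto

text \<open>A label in use occurs exactly once as incoming and once as outgoing end, so both kinds
  of ends meet \<open>S\<close> equally often.\<close>

lemma even_ends:
  assumes "oriented_diagram D pos"
  shows "even (\<Sum>x<num_crossings D. length (filter (\<lambda>e. e \<in> S) (ends (crossings D ! x))))"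
proof -
  let ?n = "num_crossings D" and ?P = "\<lambda>e. e \<in> S"
  let ?ins = "concat (map (\<lambda>x. incoming (pos x) (crossings D ! x)) [0..<?n])"
  let ?outs = "concat (map (\<lambda>x. outgoing (pos x) (crossings D ! x)) [0..<?n])"
  have "distinct ?ins" "distinct ?outs" "set ?ins = set ?outs"
    using assms unfolding oriented_diagram_def Let_def by argo+
  then have "length (filter ?P ?ins) = length (filter ?P ?outs)"
    by (simp only: distinct_length_filter)
  moreover have "length (filter ?P (ends (crossings D ! x)))
      = length (filter ?P (incoming (pos x) (crossings D ! x)))
        + length (filter ?P (outgoing (pos x) (crossings D ! x)))" for x
    by (cases "crossings D ! x") auto
  ultimately show ?thesis
    by (simp add: length_filter_concat_upt sum.distrib)
qed

definition joined_away :: "diagram \<Rightarrow> nat \<Rightarrow> nat set \<Rightarrow> (nat \<times> nat) set" where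
  "joined_away D x I =
     (\<Union>y\<in>{..<num_crossings D} - {x}. set (smoothing (y \<in> I) (crossings D ! y)))"

lemma joined_split:
  "x < num_crossings D \<Longrightarrow>
     joined D I = set (smoothing (x \<in> I) (crossings D ! x)) \<union> joined_away D x I"
  unfolding joined_def joined_away_def by auto

lemma joined_away_insert [simp]: "joined_away D x (insert x I) = joined_away D x I"
  unfolding joined_away_def by auto

text \<open>Every other crossing is smoothed into pairs of ends that lie both inside or both outside
  \<open>S\<close>, hence contributes an even number; the total is even, which leaves an even number
  at \<open>x\<close>.\<close>

lemma even_ends_closed:
  assumes D: "oriented_diagram D pos" and x: "x < num_crossings D"
    and S: "\<And>u v. (u, v) \<in> joined_away D x I \<Longrightarrow> u \<in> S \<longleftrightarrow> v \<in> S"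
  shows "even (length (filter (\<lambda>e. e \<in> S) (ends (crossings D ! x))))"
proof -
  let ?f = "\<lambda>y. length (filter (\<lambda>e. e \<in> S) (ends (crossings D ! y)))"
  have "even (?f y)" if y: "y < num_crossings D" "y \<noteq> x" for y
  proof -
    obtain a b c d where abcd: "crossings D ! y = Crossing a b c d" by (cases "crossings D ! y")
    have "set (smoothing (y \<in> I) (crossings D ! y)) \<subseteq> joined_away D x I"
      using y by (auto simp: joined_away_def)
    then have "\<And>u v. (u, v) \<in> set (smoothing (y \<in> I) (crossings D ! y)) \<Longrightarrow> u \<in> S \<longleftrightarrow> v \<in> S"
      using S by blast
    then show ?thesis by (cases "y \<in> I") (auto simp: abcd)
  qed
  then have "even (\<Sum>y\<in>{..<num_crossings D} - {x}. ?f y)" by (intro dvd_sum) auto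
  moreover have "even (?f x + (\<Sum>y\<in>{..<num_crossings D} - {x}. ?f y))"
    using even_ends[OF D, of S] sum.remove[of "{..<num_crossings D}" x ?f] x by simp
  ultimately show ?thesis by simp
qed

text \<open>
  Away from a crossing \<open>(a, b, c, d)\<close> the strands of a resolution pair up the four ends.  If \<open>a\<close>
  and \<open>c\<close> are separated in the 0-resolution, \<open>a\<close> can only be paired with \<open>b\<close>.
\<close>

lemma same_circle_merge:
  assumes D: "oriented_diagram D pos" and x: "x < num_crossings D" "x \<notin> I"
    and abcd: "crossings D ! x = Crossing a b c d"
    and ac: "(a, c) \<notin> same_circle D I"
  shows "same_circle D (insert x I) = equiv_closure (insert (a, c) (joined D I))"
proof -
  let ?R = "joined_away D x I"
  have I: "joined D I = {(a, b), (c, d)} \<union> ?R"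
    using joined_split[OF x(1), of I] x(2) by (simp add: abcd)
  have J: "joined D (insert x I) = {(a, d), (b, c)} \<union> ?R"
    using joined_split[OF x(1), of "insert x I"] by (simp add: abcd)
  have pair: "(u, v) \<in> equiv_closure ?R"
    if uv: "{u, v} = {a, b} \<and> {w, z} = {c, d} \<or> {u, v} = {c, d} \<and> {w, z} = {a, b}" for u v w z
  proof -
    let ?S = "{e. (u, e) \<in> equiv_closure ?R}"
    have "even (length (filter (\<lambda>e. e \<in> ?S) [a, b, c, d]))"
    proof -
      have "s \<in> ?S \<longleftrightarrow> t \<in> ?S" if "(s, t) \<in> ?R" for s t
        using equiv_closure_base[OF that] unfolding mem_Collect_eq equiv_closure_iff_class by simp
      then have "even (length (filter (\<lambda>e. e \<in> ?S) (ends (crossings D ! x))))"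
        by (rule even_ends_closed[OF D x(1)])
      then show ?thesis by (simp only: abcd ends.simps)
    qed
    moreover have "w \<notin> ?S" "z \<notin> ?S"
    proof -
      have sub: "(s, t) \<in> same_circle D I" if "(s, t) \<in> equiv_closure ?R" for s t
        by (rule equiv_closure_mono[OF _ that]) (auto simp: I)
      have "(a, b) \<in> same_circle D I" "(c, d) \<in> same_circle D I"
        by (auto simp: I intro: equiv_closure_base)
      then have "(u, w) \<notin> same_circle D I \<and> (u, z) \<notin> same_circle D I"
        using uv ac unfolding equiv_closure_iff_class doubleton_eq_iff by metis
      with sub show "w \<notin> ?S" "z \<notin> ?S" by auto
    qed
    moreover have "u \<in> ?S" by simp
    \<comment> \<open>An even count cannot consist of \<open>u\<close> alone. The ends are counted
      as list entries, so coinciding labels make no exception.\<close>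
    ultimately have "v \<in> ?S"
      using uv unfolding doubleton_eq_iff by (elim disjE conjE) (auto split: if_splits)
    then show ?thesis by simp
  qed
  let ?Q = "insert (a, c) (joined D I)"
  have "(a, b) \<in> equiv_closure ?R" "(c, d) \<in> equiv_closure ?R"
    by (rule pair[of _ _ c d], simp) (rule pair[of _ _ a b], simp)
  then have "(a, b) \<in> same_circle D (insert x I)" "(c, d) \<in> same_circle D (insert x I)"
    by (auto intro: equiv_closure_mono[rotated] simp: J)
  moreover have "(a, d) \<in> same_circle D (insert x I)" "(b, c) \<in> same_circle D (insert x I)"
    by (auto intro: equiv_closure_base simp: J)
  moreover have "?R \<subseteq> same_circle D (insert x I)"
    by (auto intro: equiv_closure_base simp: J)
  ultimately have "?Q \<subseteq> same_circle D (insert x I)"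
    by (auto simp: I intro: equiv_closure_trans)
  moreover have "(a, b) \<in> equiv_closure ?Q" "(c, d) \<in> equiv_closure ?Q" "(a, c) \<in> equiv_closure ?Q"
    by (auto intro: equiv_closure_base simp: I)
  then have "(a, d) \<in> equiv_closure ?Q" "(b, c) \<in> equiv_closure ?Q"
    unfolding equiv_closure_iff_class by auto
  then have "joined D (insert x I) \<subseteq> equiv_closure ?Q"
    by (auto intro: equiv_closure_base simp: I J)
  ultimately show ?thesis by (simp add: equiv_closure_subset_iff set_eq_subset)
qed

text \<open>Both relations put all four ends into one class and have the same generators away from
  \<open>x\<close>. The case that \<open>a\<close> and \<open>b\<close> already share a circle after
  the change is included.\<close>

lemma same_circle_split:
  assumes x: "x < num_crossings D" "x \<notin> I"
    and abcd: "crossings D ! x = Crossing a b c d"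
    and ac: "(a, c) \<in> same_circle D I"
  shows "same_circle D I = equiv_closure (insert (a, b) (joined D (insert x I)))"
proof -
  let ?R = "joined_away D x I"
  have I: "joined D I = {(a, b), (c, d)} \<union> ?R"
    using joined_split[OF x(1), of I] x(2) by (simp add: abcd)
  have J: "joined D (insert x I) = {(a, d), (b, c)} \<union> ?R"
    using joined_split[OF x(1), of "insert x I"] by (simp add: abcd)
  let ?Q = "insert (a, b) (joined D (insert x I))"
  have "(a, b) \<in> same_circle D I" "(c, d) \<in> same_circle D I"
    by (auto intro: equiv_closure_base simp: I)
  then have "(a, b) \<in> same_circle D I" "(a, d) \<in> same_circle D I" "(b, c) \<in> same_circle D I"
    using ac unfolding equiv_closure_iff_class by auto
  then have "?Q \<subseteq> same_circle D I"
    by (auto intro: equiv_closure_base simp: I J)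
  moreover have "(a, b) \<in> equiv_closure ?Q" "(a, d) \<in> equiv_closure ?Q" "(b, c) \<in> equiv_closure ?Q"
    by (auto intro: equiv_closure_base simp: J)
  then have "(a, b) \<in> equiv_closure ?Q" "(c, d) \<in> equiv_closure ?Q"
    unfolding equiv_closure_iff_class by auto
  then have "joined D I \<subseteq> equiv_closure ?Q"
    by (auto intro: equiv_closure_base simp: I J)
  ultimately show ?thesis by (simp add: equiv_closure_subset_iff set_eq_subset)
qed

text \<open>\<open>f\<close> and \<open>f'\<close> label the circles through the edges; those of \<open>f'\<close> are the circles of \<open>f\<close> with
  the ones through \<open>u\<close> and \<open>v\<close> united.\<close>

definition joins :: "('a \<Rightarrow> 'b) \<Rightarrow> 'a \<Rightarrow> 'a \<Rightarrow> ('a \<Rightarrow> 'c) \<Rightarrow> bool" where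
  "joins f u v f' \<longleftrightarrow>
     (\<forall>e e'. f' e = f' e' \<longleftrightarrow> f e = f e' \<or> f e \<in> {f u, f v} \<and> f e' \<in> {f u, f v})"

lemma joinsD:
  "joins f u v f' \<Longrightarrow> f' e = f' e' \<longleftrightarrow> f e = f e' \<or> f e \<in> {f u, f v} \<and> f e' \<in> {f u, f v}"
  by (simp add: joins_def)

text \<open>Renaming the class \<open>f v\<close> to \<open>f u\<close> gives a labelling with the
  fibres of \<open>f'\<close>; exactly one name is lost unless the two classes coincide from the
  start.\<close>

lemma card_joins:
  assumes "finite E" "u \<in> E" "v \<in> E" "joins f u v f'"
  shows "card (f ` E) = card (f' ` E) + (if f u = f v then 0 else 1)"
proof -
  let ?g = "\<lambda>e. if f e = f v then f u else f e"
  have "card (f' ` E) = card (?g ` E)"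
    by (rule card_image_eq_kernel) (auto simp: joinsD[OF assms(4)])
  also have "?g ` E = (if f u = f v then f ` E else f ` E - {f v})"
  proof (cases "f u = f v")
    case True
    then have "?g = f" by (intro ext) simp
    with True show ?thesis by (simp only: refl if_True)
  next
    case False
    then show ?thesis using assms(2) by auto
  qed
  finally show ?thesis
    using assms(1,3) card_Suc_Diff1[of "f ` E" "f v"] by auto
qed

text \<open>Surgery between the strands through \<open>p\<close> and \<open>s\<close>; the new strands pass through \<open>p\<close> and \<open>q\<close>.\<close>

definition surgery :: "('a \<Rightarrow> 'b) \<Rightarrow> 'a \<Rightarrow> 'a \<Rightarrow> 'a \<Rightarrow> ('a \<Rightarrow> 'b) \<Rightarrow> bool" where
  "surgery f p q s f' \<longleftrightarrow>
     f p = f q \<and> (if f p = f s then joins f' p q f else joins f p s f')"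

text \<open>The value 0 is the third possibility beside merge and split: one circle is reconnected
  into one circle.\<close>

lemma card_surgery:
  assumes "finite E" "p \<in> E" "q \<in> E" "s \<in> E" "surgery f p q s f'"
  shows "int (card (f' ` E)) = int (card (f ` E)) +
    (if f p \<noteq> f s then - 1 else if f' p = f' q then 0 else 1)"
  using assms card_joins[of E p s f f'] card_joins[of E p q f' f]
  by (auto simp: surgery_def split: if_splits)

lemma surgery_merge_eq: "surgery f p q s f' \<Longrightarrow> f p \<noteq> f s \<Longrightarrow> f' p = f' q"
  unfolding surgery_def joins_def by metis

text \<open>The propositional core of the next lemma: \<open>k\<close>, \<open>kx\<close>, \<open>ky\<close>, \<open>l\<close> count the circles at the
  vertices of a square, and \<open>x0\<close>, \<open>y0\<close>, \<open>x1\<close>, \<open>y1\<close> say which edges are not merges.\<close>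

lemma square_parity:
  fixes k kx ky l :: int
  assumes "kx = k + (if \<not> x0 then - 1 else if u then 0 else 1)"
    and "ky = k + (if \<not> y0 then - 1 else if w then 0 else 1)"
    and "l = kx + (if \<not> y1 then - 1 else if Y then 0 else 1)"
    and "l = ky + (if \<not> x1 then - 1 else if X then 0 else 1)"
    and "x1 \<or> X" "y1 \<or> Y"
    and "\<not> (x0 \<and> \<not> y0 \<and> y1 \<and> u)" "\<not> (y0 \<and> \<not> x0 \<and> x1 \<and> w)"
  shows "(x0 \<longleftrightarrow> x1) \<and> (y0 \<longleftrightarrow> y1) \<or> \<not> x0 \<and> \<not> y0 \<and> x1 \<and> y1 \<or>
    (x0 \<and> X \<or> y1 \<and> Y) \<and> (y0 \<and> Y \<or> x1 \<and> X)"
  using assms by (auto split: if_splits)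

text \<open>The cases are cut to fit the edge maps. In \<open>both_zero\<close> each composite
  contains a wedge with a difference that is 0 at the last vertex. In \<open>parallel\<close> each
  crossing acts in the same way in both orders. In \<open>twice_joined\<close> both arcs connect the
  same two circles, and either composite wedges with a difference of the same two final
  circles.\<close>

lemma surgery_square:
  fixes p q s p' q' s' :: 'a
  assumes E: "finite E" "p \<in> E" "q \<in> E" "s \<in> E" "p' \<in> E" "q' \<in> E" "s' \<in> E"
    and x0: "surgery f p q s fx" and y0: "surgery f p' q' s' fy"
    and y1: "surgery fx p' q' s' g" and x1: "surgery fy p q s g"
  obtains
    (both_zero) "f p = f s \<and> g p = g q \<or> fx p' = fx s' \<and> g p' = g q'"
      "f p' = f s' \<and> g p' = g q' \<or> fy p = fy s \<and> g p = g q"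
  | (parallel) "f p = f s \<longleftrightarrow> fy p = fy s" "f p' = f s' \<longleftrightarrow> fx p' = fx s'"
  | (twice_joined) "f p \<noteq> f s" "f p' \<noteq> f s'" "fy p = fy s" "fx p' = fx s'"
      "{g p, g q} = {g p', g q'}"
proof -
  note c = card_surgery[OF E(1-4) x0] card_surgery[OF E(1,5-7) y0]
    card_surgery[OF E(1,5-7) y1] card_surgery[OF E(1-4) x1]
  have twice: "{g p, g q} = {g p', g q'}"
    if m: "f p \<noteq> f s" "f p' \<noteq> f s'" "fy p = fy s" "fx p' = fx s'"
  proof -
    have jx: "joins f p s fx" and jy: "joins f p' s' fy"
      and kx: "joins g p' q' fx" and ky: "joins g p q fy"
      and eq: "f p = f q" "f p' = f q'"
      using x0 y0 x1 y1 m by (auto simp: surgery_def)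
    \<comment> \<open>Strands that are apart in \<open>f\<close> and together in \<open>fx\<close>
      lie on the two circles joined by the first surgery; the same holds with the crossings
      exchanged.\<close>
    have "f p' \<in> {f p, f s}" "f p \<in> {f p', f s'}"
      using m joinsD[OF jx, of p' s'] joinsD[OF jy, of p s] by auto
    then have "fx p = fx p'" "fx q = fx p'" "fy p' = fy p" "fy q' = fy p"
      using joinsD[OF jx] joinsD[OF jy] eq by auto
    then have "g p \<in> {g p', g q'}" "g q \<in> {g p', g q'}" "g p' \<in> {g p, g q}" "g q' \<in> {g p, g q}"
      using joinsD[OF kx] joinsD[OF ky] by auto
    then show ?thesis by auto
  qed
  show thesis
  proof (cases "(f p = f s \<longleftrightarrow> fy p = fy s) \<and> (f p' = f s' \<longleftrightarrow> fx p' = fx s')")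
    case True
    then show thesis using parallel by blast
  next
    case mixed: False
    have XY: "fy p = fy s \<or> g p = g q" "fx p' = fx s' \<or> g p' = g q'"
      using surgery_merge_eq[OF x1] surgery_merge_eq[OF y1] by auto
    \<comment> \<open>If a surgery turns one circle into one circle, the partition is unchanged, so
      the other surgery cannot stop being a merge.\<close>
    have no_split_y: "\<not> (f p' = f s' \<and> \<not> f p = f s \<and> fy p = fy s \<and> fy p' = fy q')"
      using y0 joinsD[of fy p' q' f p s] by (auto simp: surgery_def)
    have no_split_x: "\<not> (f p = f s \<and> \<not> f p' = f s' \<and> fx p' = fx s' \<and> fx p = fx q)"
      using x0 joinsD[of fx p q f p' s'] by (auto simp: surgery_def)
    show thesis
    proof (cases "f p \<noteq> f s \<and> f p' \<noteq> f s' \<and> fy p = fy s \<and> fx p' = fx s'")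
      case True
      then show thesis using twice twice_joined by blast
    next
      case False
      note square_parity[OF c XY no_split_x no_split_y]
      with False mixed have "(f p = f s \<and> g p = g q \<or> fx p' = fx s' \<and> g p' = g q') \<and>
        (f p' = f s' \<and> g p' = g q' \<or> fy p = fy s \<and> g p = g q)"
        by blast
      then show thesis using both_zero by blast
    qed
  qed
qed

text \<open>The third label of a surgery: \<open>dual_tail\<close> and \<open>dual_head\<close> are
  \<open>a\<close> and \<open>b\<close> in some order, both on the strand \<open>ab\<close> of the
  0-resolution, while \<open>c\<close> marks its other strand.\<close>

fun far_strand :: "'e crossing \<Rightarrow> 'e" where
  "far_strand (Crossing a b c d) = c"

locale link_diagram =
  fixes D :: diagram and pos :: "nat \<Rightarrow> bool"
  assumes oriented: "oriented_diagram D pos"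
begin

lemma wf [simp]: "wf_diagram D"
  using oriented by (rule oriented_diagram_wf)

lemma finite_edges: "finite (edges D)"
  using wf by (simp add: wf_diagram_def)

lemma is_merge_iff:
  assumes "x < num_crossings D" "x \<notin> I"
  shows "is_merge D I x \<longleftrightarrow>
    circle_of D I (dual_tail r (crossings D ! x)) \<noteq> circle_of D I (far_strand (crossings D ! x))"
proof -
  obtain a b c d where abcd: "crossings D ! x = Crossing a b c d" by (cases "crossings D ! x")
  have "(a, b) \<in> joined D I"
    using joined_split[OF assms(1), of I] assms(2) by (simp add: abcd)
  then have "circle_of D I a = circle_of D I b"
    by (simp add: circle_of_eq_iff equiv_closure_base)
  then show ?thesis by (simp add: is_merge_def abcd)
qed

text \<open>The bridge from crossings to abstract surgery: \<open>same_circle_split\<close> supplies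
  the branch with equal circles, \<open>same_circle_merge\<close> the other.\<close>

lemma surgery_circle_of:
  assumes x: "x < num_crossings D" "x \<notin> I"
  shows "surgery (circle_of D I) (dual_tail r (crossings D ! x)) (dual_head r (crossings D ! x))
    (far_strand (crossings D ! x)) (circle_of D (insert x I))"
proof -
  obtain a b c d where abcd: "crossings D ! x = Crossing a b c d" by (cases "crossings D ! x")
  let ?f = "circle_of D I" and ?g = "circle_of D (insert x I)"
  have "(a, b) \<in> joined D I"
    using joined_split[OF x(1), of I] x(2) by (simp add: abcd)
  then have ab: "?f a = ?f b"
    by (simp add: circle_of_eq_iff equiv_closure_base)
  have "joins ?g a b ?f" if "?f a = ?f c"
  proof -
    have "(a, c) \<in> same_circle D I" using that by (simp add: circle_of_eq_iff)
    note eq = same_circle_split[OF x abcd this]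
    show ?thesis
      unfolding joins_def circle_of_eq_iff[OF wf] insert_iff empty_iff eq
      by (simp add: equiv_closure_insert_iff)
  qed
  moreover have "joins ?f a c ?g" if "?f a \<noteq> ?f c"
  proof -
    have "(a, c) \<notin> same_circle D I" using that by (simp add: circle_of_eq_iff)
    note eq = same_circle_merge[OF oriented x abcd this]
    show ?thesis
      unfolding joins_def circle_of_eq_iff[OF wf] insert_iff empty_iff eq
      by (simp add: equiv_closure_insert_iff)
  qed
  ultimately show ?thesis using ab
    by (auto simp: surgery_def abcd joins_def)
qed

lemma crossing_in_edges:
  assumes "x < num_crossings D"
  shows "dual_tail r (crossings D ! x) \<in> edges D" "dual_head r (crossings D ! x) \<in> edges D"
    "far_strand (crossings D ! x) \<in> edges D"
proof -
  have "set_crossing (crossings D ! x) \<subseteq> edges D"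
    using wf assms by (simp add: wf_diagram_def)
  then show "dual_tail r (crossings D ! x) \<in> edges D" "dual_head r (crossings D ! x) \<in> edges D"
    "far_strand (crossings D ! x) \<in> edges D"
    by (cases "crossings D ! x"; simp)+
qed

lemma card_circles_insert:
  assumes "x < num_crossings D" "x \<notin> I"
  shows "int (card (circles D (insert x I))) = int (card (circles D I)) +
    (if is_merge D I x then - 1
     else if circle_of D (insert x I) (dual_tail r (crossings D ! x))
       = circle_of D (insert x I) (dual_head r (crossings D ! x)) then 0 else 1)"
  using card_surgery[OF finite_edges crossing_in_edges[OF assms(1)] surgery_circle_of[OF assms, of r]]
  by (simp add: is_merge_iff[OF assms, of r] circles_def)

end

section \<open>Exterior algebras\<close>

text \<open>Carries identities from monomials to all elements. Compatibility with differences
  suffices because \<open>frag_induction\<close> builds elements from generators by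
  subtraction.\<close>

lemma frag_extend_ext:
  fixes f g :: "('a \<Rightarrow>\<^sub>0 int) \<Rightarrow> 'b::group_add"
  assumes "Poly_Mapping.keys u \<subseteq> S" "\<And>A. A \<in> S \<Longrightarrow> f (frag_of A) = g (frag_of A)"
    and "\<And>v w. f (v - w) = f v - f w" "\<And>v w. g (v - w) = g v - g w"
  shows "f u = g u"
  using assms(1)
proof (induction u rule: frag_induction)
  case zero
  show ?case using assms(3)[of 0 0] assms(4)[of 0 0] by simp
qed (simp_all add: assms)

lemma frag_cmul_minus: "frag_cmul k (- u) = frag_cmul (- k) u"
  by (rule poly_mapping_eqI) simp

lemma wedge_diff_right: "wedge u (v - w) = wedge u v - wedge u w"
  unfolding wedge_def frag_extend_diff frag_extend_def[of _ u] sum_subtractf[symmetric]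
  by (intro sum.cong refl poly_mapping_eqI) (simp add: lookup_minus right_diff_distrib)

lemma wedge_diff_left: "wedge (u - v) w = wedge u w - wedge v w"
  by (simp add: wedge_def frag_extend_diff)

lemma wedge_gen: "wedge (gen a) u = frag_extend (wedge_monomials {a}) u"
  by (simp add: wedge_def gen_def)

lemma wedge_0 [simp]: "wedge u 0 = 0"
  using wedge_diff_right[of u 0 0] by simp

lemma wedge_gen_cmul: "wedge (gen a) (frag_cmul k u) = frag_cmul k (wedge (gen a) u)"
  by (simp add: wedge_gen frag_extend_cmul)

lemma wedge_gen_monomial:
  "wedge (gen a) (frag_of A) = 
     (if a \<in> A then 0 else frag_cmul ((- 1) ^ card {b \<in> A. b < a}) (frag_of (insert a A)))"
proof -
  have "{(a', b). a' = a \<and> b \<in> A \<and> b < a'} = Pair a ` {b \<in> A. b < a}" by auto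
  then have "card {(a', b). a' = a \<and> b \<in> A \<and> b < a'} = card {b \<in> A. b < a}"
    by (simp add: card_image inj_on_def)
  then show ?thesis by (simp add: wedge_gen wedge_monomials_def)
qed

lemma wedge_gen_self: "wedge (gen a) (wedge (gen a) u) = 0"
  by (rule frag_extend_ext[OF subset_UNIV, where f = "\<lambda>u. wedge (gen a) (wedge (gen a) u)" and g = "\<lambda>_. 0"])
    (auto simp: wedge_gen_monomial wedge_gen_cmul wedge_diff_right)

text \<open>For \<open>a < b\<close> the presence of \<open>a\<close> adds one element below
  \<open>b\<close>, whereas \<open>b\<close> adds none below \<open>a\<close>. This single extra
  inversion is the sign.\<close>

lemma wedge_gen_anticommute:
  "wedge (gen a) (wedge (gen b) u) = - wedge (gen b) (wedge (gen a) u)"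
proof (cases "a = b")
  case True
  then show ?thesis by (simp add: wedge_gen_self)
next
  case False
  have less: "wedge (gen a) (wedge (gen b) (frag_of A)) = - wedge (gen b) (wedge (gen a) (frag_of A))"
    if "a < b" for a b A
  proof -
    have "{c \<in> insert b A. c < a} = {c \<in> A. c < a}" using that by auto
    then have ba: "card {c \<in> insert b A. c < a} = card {c \<in> A. c < a}" by (rule arg_cong)
    have "{c \<in> insert a A. c < b} = insert a {c \<in> A. c < b}" using that by auto
    then have "card {c \<in> insert a A. c < b} = card (insert a {c \<in> A. c < b})" by (rule arg_cong)
    then have ab: "a \<notin> A \<Longrightarrow> card {c \<in> insert a A. c < b} = Suc (card {c \<in> A. c < b})" by simp
    show ?thesis
    proof (cases "a \<in> A \<or> b \<in> A")
      case True
      then show ?thesis by (auto simp: wedge_gen_monomial wedge_gen_cmul)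
    next
      case False
      then have "wedge (gen a) (frag_of (insert b A)) =
          frag_cmul ((- 1) ^ card {c \<in> A. c < a}) (frag_of (insert a (insert b A)))"
        "wedge (gen b) (frag_of (insert a A)) =
          frag_cmul ((- 1) ^ Suc (card {c \<in> A. c < b})) (frag_of (insert a (insert b A)))"
        unfolding wedge_gen_monomial ba[symmetric] using that ab by (auto simp: insert_commute)
      moreover have "wedge (gen a) (frag_of A) = frag_cmul ((- 1) ^ card {c \<in> A. c < a}) (frag_of (insert a A))"
        "wedge (gen b) (frag_of A) = frag_cmul ((- 1) ^ card {c \<in> A. c < b}) (frag_of (insert b A))"
        using False by (simp_all add: wedge_gen_monomial)
      ultimately show ?thesis by (simp add: wedge_gen_cmul mult.commute)
    qed
  qed
  have mono: "wedge (gen a) (wedge (gen b) (frag_of A)) = - wedge (gen b) (wedge (gen a) (frag_of A))" for A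
  proof (cases "a < b")
    case True
    then show ?thesis by (rule less)
  next
    case False
    with \<open>a \<noteq> b\<close> have "b < a" by simp
    from less[OF this, of A] show ?thesis by (simp only: minus_minus)
  qed
  show ?thesis
    by (rule frag_extend_ext[OF subset_UNIV, where f = "\<lambda>u. wedge (gen a) (wedge (gen b) u)"
          and g = "\<lambda>u. - wedge (gen b) (wedge (gen a) u)"])
      (rule mono, simp_all add: wedge_diff_right)
qed

lemma wedge_gen_diff_anticommute:
  "wedge (gen a - gen b) (wedge (gen c) u) = - wedge (gen c) (wedge (gen a - gen b) u)"
  using wedge_gen_anticommute[of a c] wedge_gen_anticommute[of b c]
  by (simp add: wedge_diff_left wedge_diff_right)

lemma wedge_diff_diff_anticommute:
  "wedge (gen a - gen b) (wedge (gen c - gen d) u) = - wedge (gen c - gen d) (wedge (gen a - gen b) u)"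
  by (simp add: wedge_diff_left[of "gen c" "gen d"] wedge_diff_right wedge_gen_diff_anticommute)

lemma keys_wedge_gen:
  "Poly_Mapping.keys (wedge (gen a) u) \<subseteq> insert a ` {A \<in> Poly_Mapping.keys u. a \<notin> A}"
proof -
  have "Poly_Mapping.keys (wedge_monomials {a} A) \<subseteq> (if a \<in> A then {} else {insert a A})" for A
    using wedge_gen_monomial[of a A] keys_cmul[of _ "frag_of (insert a A)"]
    by (simp add: wedge_gen)
  then have "(\<Union>A\<in>Poly_Mapping.keys u. Poly_Mapping.keys (wedge_monomials {a} A)) \<subseteq>
      (\<Union>A\<in>Poly_Mapping.keys u. if a \<in> A then {} else {insert a A})"
    by (intro UN_mono subset_refl)
  also have "\<dots> \<subseteq> insert a ` {A \<in> Poly_Mapping.keys u. a \<notin> A}"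
    by (auto split: if_splits)
  finally show ?thesis
    unfolding wedge_gen by (rule order_trans[OF keys_frag_extend])
qed

section \<open>Induced homomorphisms, and products with a difference of generators\<close>

definition wedge_list :: "(nat \<Rightarrow> nat) \<Rightarrow> nat list \<Rightarrow> (nat set \<Rightarrow>\<^sub>0 int)" where
  "wedge_list f xs = foldr (\<lambda>a. wedge (gen (f a))) xs (frag_of {})"

lemma wedge_list_simps [simp]:
  "wedge_list f [] = frag_of {}" "wedge_list f (a # xs) = wedge (gen (f a)) (wedge_list f xs)"
  by (simp_all add: wedge_list_def)

lemma exterior_map_monomial: "exterior_map f (frag_of A) = wedge_list f (sorted_list_of_set A)"
  by (simp add: exterior_map_def wedge_list_def)

lemma exterior_map_diff: "exterior_map f (u - v) = exterior_map f u - exterior_map f v"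
  by (simp add: exterior_map_def frag_extend_diff)

lemma exterior_map_0 [simp]: "exterior_map f 0 = 0"
  by (simp add: exterior_map_def)

lemma exterior_map_cmul: "exterior_map f (frag_cmul k u) = frag_cmul k (exterior_map f u)"
  by (simp add: exterior_map_def frag_extend_cmul)

text \<open>Each smaller factor that \<open>a\<close> passes costs one transposition. The exponent
  is the one of \<open>wedge_gen_monomial\<close>, so the two signs cancel in
  \<open>exterior_map_wedge_gen\<close>.\<close>

lemma wedge_list_insort:
  assumes "sorted xs"
  shows "wedge_list f (insort a xs) =
    frag_cmul ((- 1) ^ length (filter (\<lambda>b. b < a) xs)) (wedge (gen (f a)) (wedge_list f xs))"
  using assms
proof (induction xs)
  case (Cons x xs)
  show ?case
  proof (cases "a \<le> x")
    case True
    then have "filter (\<lambda>b. b < a) (x # xs) = []"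
      using Cons.prems by (auto simp: filter_empty_conv)
    then show ?thesis using True by (simp del: filter.simps)
  next
    case False
    then show ?thesis
      using Cons wedge_gen_anticommute[of "f x" "f a"]
      by (simp add: wedge_gen_cmul frag_cmul_minus)
  qed
qed simp

lemma wedge_gen_wedge_list: "a \<in> set xs \<Longrightarrow> wedge (gen (f a)) (wedge_list f xs) = 0"
proof (induction xs)
  case (Cons x xs)
  show ?case
  proof (cases "a = x")
    case True
    then show ?thesis by (simp add: wedge_gen_self)
  next
    case False
    then have "wedge (gen (f a)) (wedge_list f xs) = 0" using Cons by simp
    then show ?thesis
      using wedge_gen_anticommute[of "f a" "f x" "wedge_list f xs"] by (simp add: wedge_gen)
  qed
qed simp

text \<open>Multiplicativity is claimed for finite monomials only, since
  \<open>sorted_list_of_set\<close> turns an infinite set into the empty list.\<close>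

lemma exterior_map_wedge_gen:
  assumes "Poly_Mapping.keys u \<subseteq> Collect finite"
  shows "exterior_map f (wedge (gen a) u) = wedge (gen (f a)) (exterior_map f u)"
  using assms
proof (rule frag_extend_ext[where f = "\<lambda>u. exterior_map f (wedge (gen a) u)"])
  fix A :: "nat set" assume "A \<in> Collect finite"
  then have A: "finite A" by simp
  have len: "length (filter (\<lambda>b. b < a) (sorted_list_of_set A)) = card {b \<in> A. b < a}"
    using A by (simp add: distinct_length_filter Int_def conj_commute)
  show "exterior_map f (wedge (gen a) (frag_of A)) = wedge (gen (f a)) (exterior_map f (frag_of A))"
  proof (cases "a \<in> A")
    case True
    then show ?thesis
      using A by (simp add: wedge_gen_monomial exterior_map_monomial wedge_gen_wedge_list)
  next
    case False
    then show ?thesis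
      using A by (simp add: wedge_gen_monomial exterior_map_monomial exterior_map_cmul
          sorted_list_of_set_insert wedge_list_insort len flip: power_add)
  qed
qed (simp_all add: wedge_diff_right exterior_map_diff)

lemma exterior_map_wedge_diff:
  assumes "Poly_Mapping.keys u \<subseteq> Collect finite"
  shows "exterior_map f (wedge (gen a - gen b) u) = wedge (gen (f a) - gen (f b)) (exterior_map f u)"
  by (simp add: wedge_diff_left exterior_map_diff exterior_map_wedge_gen[OF assms])

lemma keys_wedge_list:
  "Poly_Mapping.keys (wedge_list f xs) \<subseteq> {A. A \<subseteq> f ` set xs \<and> card A = length xs}"
proof (induction xs)
  case (Cons a xs)
  show ?case
  proof
    fix A assume "A \<in> Poly_Mapping.keys (wedge_list f (a # xs))"
    then obtain B where A: "A = insert (f a) B" "f a \<notin> B" and "B \<in> Poly_Mapping.keys (wedge_list f xs)"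
      using keys_wedge_gen[of "f a" "wedge_list f xs"] by auto
    then have B: "B \<subseteq> f ` set xs" "card B = length xs" using Cons by auto
    then have "finite B" by (rule_tac finite_subset) auto
    with A B show "A \<in> {A. A \<subseteq> f ` set (a # xs) \<and> card A = length (a # xs)}" by auto
  qed
qed simp

lemma finite_keys_wedge_list: "Poly_Mapping.keys (wedge_list f xs) \<subseteq> Collect finite"
proof
  fix A assume "A \<in> Poly_Mapping.keys (wedge_list f xs)"
  then have "A \<subseteq> f ` set xs" using keys_wedge_list by blast
  then have "finite A" by (rule finite_subset) simp
  then show "A \<in> Collect finite" by simp
qed

lemma exterior_map_wedge_list:
  "exterior_map f (wedge_list g xs) = wedge_list (\<lambda>a. f (g a)) xs"
  by (induction xs) (simp_all add: exterior_map_wedge_gen finite_keys_wedge_list exterior_map_monomial)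

lemma exterior_map_comp:
  assumes "Poly_Mapping.keys u \<subseteq> Collect finite"
  shows "exterior_map f (exterior_map g u) = exterior_map (\<lambda>a. f (g a)) u"
  using assms
  by (rule frag_extend_ext[where f = "\<lambda>u. exterior_map f (exterior_map g u)"])
    (simp_all add: exterior_map_monomial exterior_map_wedge_list exterior_map_diff)

lemma exterior_map_cong:
  assumes "Poly_Mapping.keys u \<subseteq> Pow S" "\<And>a. a \<in> S \<Longrightarrow> f a = g a"
  shows "exterior_map f u = exterior_map g u"
  unfolding exterior_map_def
proof (rule frag_extend_eq)
  fix A assume "A \<in> Poly_Mapping.keys u"
  then have "A \<subseteq> S" using assms(1) by auto
  then have "set (sorted_list_of_set A) \<subseteq> S" by (cases "finite A") auto
  then show "foldr (\<lambda>a. wedge (gen (f a))) (sorted_list_of_set A) (frag_of {}) =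
      foldr (\<lambda>a. wedge (gen (g a))) (sorted_list_of_set A) (frag_of {})"
    using assms(2) by (intro foldr_cong) auto
qed

lemma wedge_list_id: "sorted_wrt (<) xs \<Longrightarrow> wedge_list (\<lambda>a. a) xs = frag_of (set xs)"
proof (induction xs)
  case (Cons x xs)
  then have "{b \<in> set xs. b < x} = {}" "x \<notin> set xs" by auto
  then have "wedge (gen x) (frag_of (set xs)) = frag_of (set (x # xs))"
    by (simp only: wedge_gen_monomial if_False card.empty power_0 frag_cmul_one list.set)
  with Cons show ?case by simp
qed simp

lemma exterior_map_id:
  assumes "Poly_Mapping.keys u \<subseteq> Collect finite"
  shows "exterior_map (\<lambda>a. a) u = u"
  using assms
  by (rule frag_extend_ext[where g = "\<lambda>u. u"])
    (simp_all add: exterior_map_monomial wedge_list_id exterior_map_diff)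

text \<open>Both \<open>(a - b) \<and> a\<close> and \<open>(a - b) \<and> b\<close> equal
  \<open>a \<and> b\<close>, so next to the factor \<open>a - b\<close> the generators
  \<open>a\<close> and \<open>b\<close> are interchangeable. Anticommutation brings that factor next
  to every entry of the list.\<close>

lemma wedge_diff_wedge_list:
  assumes "\<And>e. s e = e \<or> {s e, e} \<subseteq> {a, b}"
  shows "wedge (gen a - gen b) (wedge_list s xs) = wedge (gen a - gen b) (wedge_list (\<lambda>a. a) xs)"
proof (induction xs)
  case (Cons x xs)
  have "wedge (gen a - gen b) (wedge (gen a) u) = wedge (gen a - gen b) (wedge (gen b) u)" for u
    using wedge_gen_anticommute[of a b u] by (simp add: wedge_diff_left wedge_gen_self)
  then have "wedge (gen a - gen b) (wedge (gen (s x)) u) = wedge (gen a - gen b) (wedge (gen x) u)" for u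
    using assms[of x] by auto
  then show ?case
    using Cons by (simp add: wedge_gen_diff_anticommute)
qed simp

text \<open>The algebraic reason why a split map does not depend on the lift.\<close>

lemma wedge_diff_exterior_map:
  assumes "Poly_Mapping.keys u \<subseteq> Collect finite" "\<And>e. s e = e \<or> {s e, e} \<subseteq> {a, b}"
  shows "wedge (gen a - gen b) (exterior_map s u) = wedge (gen a - gen b) u"
  using assms(1)
  by (rule frag_extend_ext[where f = "\<lambda>u. wedge (gen a - gen b) (exterior_map s u)"])
    (simp_all add: exterior_map_monomial wedge_diff_wedge_list[OF assms(2)] wedge_list_id
      exterior_map_diff wedge_diff_right)

section \<open>The differential\<close>

context link_diagram
begin

text \<open>Written \<open>[w]\<^sub>I\<close> in the overview. Its arguments may involve all edges
  of the diagram, so the same \<open>w\<close> can be followed from vertex to vertex.\<close>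

abbreviation circle_map :: "nat set \<Rightarrow> (nat set \<Rightarrow>\<^sub>0 int) \<Rightarrow> (nat set \<Rightarrow>\<^sub>0 int)" where
  "circle_map I \<equiv> exterior_map (circle_of D I)"

lemma finite_subsets_edges: "Pow (edges D) \<subseteq> Collect finite"
  using finite_edges by (auto intro: finite_subset)

lemma exterior_edges_finite: "u \<in> exterior (edges D) \<Longrightarrow> Poly_Mapping.keys u \<subseteq> Collect finite"
  using finite_subsets_edges by (auto simp: exterior_def)

lemma exterior_circles_subset: "u \<in> exterior (circles D I) \<Longrightarrow> u \<in> exterior (edges D)"
  using circles_subset[OF wf, of I] by (auto simp: exterior_def)

lemma circle_map_circles:
  assumes "u \<in> exterior (circles D I)"
  shows "circle_map I u = u"
proof -
  have "circle_map I u = exterior_map (\<lambda>a. a) u"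
    using assms by (intro exterior_map_cong[where S = "circles D I"]) (auto simp: exterior_def circles_def)
  then show ?thesis
    by (simp add: exterior_map_id exterior_edges_finite exterior_circles_subset[OF assms])
qed

lemma circle_map_in_circles:
  assumes "u \<in> exterior (edges D)"
  shows "circle_map I u \<in> exterior (circles D I)"
proof -
  have "Poly_Mapping.keys (wedge_list (circle_of D I) (sorted_list_of_set A)) \<subseteq> Pow (circles D I)"
    if "A \<in> Poly_Mapping.keys u" for A
  proof -
    have "A \<subseteq> edges D" using assms that by (auto simp: exterior_def)
    then have "circle_of D I ` set (sorted_list_of_set A) \<subseteq> circles D I"
      using finite_edges finite_subset by (fastforce simp: circles_def)
    then show ?thesis using keys_wedge_list by fastforce
  qed
  then show ?thesis
    unfolding exterior_def exterior_map_def wedge_list_def[symmetric] carrier_free_Abelian_group_iff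
    by (intro order_trans[OF keys_frag_extend]) blast
qed

text \<open>The edge map lifted to the exterior algebra on the edges. It wedges with labels at the
  crossing, not with circles, so the target vertex enters only through a later
  \<open>circle_map\<close>.\<close>

definition edge_factor :: "(nat \<Rightarrow> bool) \<Rightarrow> nat set \<Rightarrow> nat \<Rightarrow> (nat set \<Rightarrow>\<^sub>0 int) \<Rightarrow> (nat set \<Rightarrow>\<^sub>0 int)" where
  "edge_factor arr I x u =
     (if is_merge D I x then u
      else wedge (gen (dual_tail (arr x) (crossings D ! x)) - gen (dual_head (arr x) (crossings D ! x))) u)"

lemma wedge_gen_in_exterior:
  assumes "a \<in> S" "u \<in> exterior S"
  shows "wedge (gen a) u \<in> exterior S"
  using keys_wedge_gen[of a u] assms by (auto simp: exterior_def)

lemma exterior_diff: "u \<in> exterior S \<Longrightarrow> v \<in> exterior S \<Longrightarrow> u - v \<in> exterior S"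
  using keys_diff[of u v] by (auto simp: exterior_def)

lemma edge_factor_in_exterior:
  assumes "x < num_crossings D" "u \<in> exterior (edges D)"
  shows "edge_factor arr I x u \<in> exterior (edges D)"
  using assms crossing_in_edges[OF assms(1)]
  by (simp add: edge_factor_def wedge_diff_left exterior_diff wedge_gen_in_exterior)

text \<open>\<open>t\<close> sends a circle of \<open>I\<close> back to a circle of
  \<open>J\<close>, the divided one to the circle through \<open>p\<close>. Going to
  \<open>I\<close> and back therefore moves names only between the circles through \<open>p\<close>
  and \<open>q\<close>, which the factor in front does not notice. So only
  \<open>circle_map I w\<close> matters, not the lift \<open>w\<close>.\<close>

lemma wedge_diff_lift:
  assumes J: "joins (circle_of D J) p q (circle_of D I)"
    and w: "w \<in> exterior (circles D J)"
  defines "t \<equiv> \<lambda>c. if c = circle_of D I p then circle_of D J p else circle_of D J c"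
  shows "wedge (gen (circle_of D J p) - gen (circle_of D J q)) w =
    wedge (gen (circle_of D J p) - gen (circle_of D J q)) (exterior_map t (circle_map I w))"
proof -
  let ?W = "wedge (gen (circle_of D J p) - gen (circle_of D J q))"
  \<comment> \<open>On names of circles of \<open>J\<close> this is the passage to \<open>I\<close>
    and back; elsewhere the identity is a filler, as \<open>wedge_diff_exterior_map\<close> asks for
    a condition on all labels.\<close>
  let ?s = "\<lambda>e. if e \<in> circles D J then t (circle_of D I e) else e"
  have fin: "Poly_Mapping.keys w \<subseteq> Collect finite"
    by (intro exterior_edges_finite exterior_circles_subset[OF w])
  have "?s e = e \<or> {?s e, e} \<subseteq> {circle_of D J p, circle_of D J q}" for e
  proof (cases "e \<in> circles D J")
    case True
    then have e: "circle_of D J e = e" by (auto simp: circles_def)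
    show ?thesis
    proof (cases "circle_of D I e = circle_of D I p")
      case True
      then have "e \<in> {circle_of D J p, circle_of D J q}"
        using joinsD[OF J, of e p] e by auto
      then show ?thesis using True by (auto simp: t_def)
    next
      case False
      then have "circle_of D J e \<notin> {circle_of D J p, circle_of D J q}"
        using joinsD[OF J, of e p] by auto
      moreover have "circle_of D I (circle_of D I e) = circle_of D I e" by simp
      ultimately have "circle_of D J (circle_of D I e) = circle_of D J e"
        using joinsD[OF J, of "circle_of D I e" e] by auto
      then show ?thesis using False e by (auto simp: t_def)
    qed
  qed simp
  then have "?W w = ?W (exterior_map ?s w)"
    by (intro wedge_diff_exterior_map[OF fin, symmetric])
  also have "exterior_map ?s w = exterior_map (\<lambda>e. t (circle_of D I e)) w"
    using w by (intro exterior_map_cong[where S = "circles D J"]) (auto simp: exterior_def)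
  also have "\<dots> = exterior_map t (circle_map I w)"
    by (rule exterior_map_comp[OF fin, symmetric])
  finally show ?thesis .
qed

text \<open>For a merge, renaming by \<open>I\<close> and then by \<open>J\<close> is the same as
  renaming by \<open>J\<close>. Otherwise renaming by \<open>J\<close> and then by \<open>I\<close>
  is the same as renaming by \<open>I\<close>, so \<open>circle_map ?J u\<close> is an explicit lift
  of \<open>circle_map I u\<close>.\<close>

lemma edge_map_circle_map:
  assumes x: "x < num_crossings D" "x \<notin> I" and u: "u \<in> exterior (edges D)"
  shows "edge_map D arr I x (circle_map I u) = circle_map (insert x I) (edge_factor arr I x u)"
proof -
  let ?J = "insert x I" and ?p = "dual_tail (arr x) (crossings D ! x)"
    and ?q = "dual_head (arr x) (crossings D ! x)" and ?s = "far_strand (crossings D ! x)"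
  let ?W = "wedge (gen (circle_of D ?J ?p) - gen (circle_of D ?J ?q))"
  have fin: "Poly_Mapping.keys u \<subseteq> Collect finite" using u by (rule exterior_edges_finite)
  have surg: "surgery (circle_of D I) ?p ?q ?s (circle_of D ?J)"
    using x by (rule surgery_circle_of)
  show ?thesis
  proof (cases "is_merge D I x")
    case True
    then have "joins (circle_of D I) ?p ?s (circle_of D ?J)"
      using surg is_merge_iff[OF x] by (auto simp: surgery_def)
    from joinsD[OF this] have "circle_of D ?J (circle_of D I e) = circle_of D ?J e" for e
      by simp
    then show ?thesis
      using True exterior_map_comp[OF fin, of "circle_of D ?J" "circle_of D I"]
      by (simp add: edge_map_def merge_map_def edge_factor_def)
  next
    case False
    then have J: "joins (circle_of D ?J) ?p ?q (circle_of D I)"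
      using surg is_merge_iff[OF x] by (auto simp: surgery_def)
    from joinsD[OF this] have "circle_of D I (circle_of D ?J e) = circle_of D I e" for e
      by simp
    then have lift: "circle_map I (circle_map ?J u) = circle_map I u"
      using exterior_map_comp[OF fin, of "circle_of D I" "circle_of D ?J"] by simp
    define w where
      "w = (SOME w. w \<in> exterior (circles D ?J) \<and> circle_map I w = circle_map I u)"
    have w: "w \<in> exterior (circles D ?J) \<and> circle_map I w = circle_map I u"
      unfolding w_def by (rule someI[of _ "circle_map ?J u"]) (simp add: circle_map_in_circles[OF u] lift)
    have "edge_map D arr I x (circle_map I u) = ?W w"
      using False by (simp add: edge_map_def split_map_def Let_def w_def)
    \<comment> \<open>The chosen lift and the explicit one have the same image at \<open>I\<close>,
      so \<open>wedge_diff_lift\<close> exchanges them.\<close>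
    also have "\<dots> = ?W (circle_map ?J u)"
      using wedge_diff_lift[OF J, of w] wedge_diff_lift[OF J circle_map_in_circles[OF u]] w lift by simp
    also have "\<dots> = circle_map ?J (edge_factor arr I x u)"
      using False by (simp add: edge_factor_def exterior_map_wedge_diff[OF fin])
    finally show ?thesis .
  qed
qed

section \<open>The two composites around a square\<close>

lemma square_map_eq:
  assumes "x < num_crossings D" "x \<notin> I" "y < num_crossings D" "y \<notin> insert x I"
    and v: "v \<in> exterior (circles D I)"
  shows "square_map D arr I x y v =
    circle_map (insert y (insert x I)) (edge_factor arr (insert x I) y (edge_factor arr I x v))"
proof -
  have v': "v \<in> exterior (edges D)" using v by (rule exterior_circles_subset)
  have "edge_map D arr I x v = circle_map (insert x I) (edge_factor arr I x v)"
    using edge_map_circle_map[OF assms(1,2) v', of arr] circle_map_circles[OF v] by simp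
  then show ?thesis
    unfolding square_map_def
    by (simp only: edge_map_circle_map[OF assms(3,4) edge_factor_in_exterior[OF assms(1) v']])
qed

lemma circle_map_edge_factor:
  assumes "u \<in> exterior (edges D)"
  shows "circle_map K (edge_factor arr I x u) =
    (if is_merge D I x then circle_map K u
     else wedge (gen (circle_of D K (dual_tail (arr x) (crossings D ! x)))
        - gen (circle_of D K (dual_head (arr x) (crossings D ! x)))) (circle_map K u))"
  by (simp add: edge_factor_def exterior_map_wedge_diff exterior_edges_finite[OF assms])

text \<open>Each alternative holds for all \<open>v\<close> at once, as \<open>type_C\<close> and
  \<open>type_A\<close> require. All factors are differences of circles of the last vertex
  \<open>?K\<close>, so the cases of \<open>surgery_square\<close> decide.\<close>

lemma square_map_sign:
  assumes "(I, x, y) \<in> hypercube_squares D"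
  obtains "\<And>v. v \<in> exterior (circles D I) \<Longrightarrow> square_map D arr I x y v = square_map D arr I y x v"
  | "\<And>v. v \<in> exterior (circles D I) \<Longrightarrow> square_map D arr I x y v = - square_map D arr I y x v"
proof -
  have x: "x < num_crossings D" "x \<notin> I" "x \<notin> insert y I"
    and y: "y < num_crossings D" "y \<notin> I" "y \<notin> insert x I"
    using assms by (auto simp: hypercube_squares_def)
  let ?K = "insert y (insert x I)"
  have K: "insert x (insert y I) = ?K" by auto
  let ?p = "dual_tail (arr x) (crossings D ! x)" and ?q = "dual_head (arr x) (crossings D ! x)"
  let ?p' = "dual_tail (arr y) (crossings D ! y)" and ?q' = "dual_head (arr y) (crossings D ! y)"
  let ?g = "circle_of D ?K"
  let ?X = "wedge (gen (?g ?p) - gen (?g ?q))" and ?Y = "wedge (gen (?g ?p') - gen (?g ?q'))"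
  let ?F = "\<lambda>v. square_map D arr I x y v" and ?G = "\<lambda>v. square_map D arr I y x v"
  have F: "?F v = (let w = circle_map ?K v; u = (if is_merge D I x then w else ?X w)
      in if is_merge D (insert x I) y then u else ?Y u)" if "v \<in> exterior (circles D I)" for v
    using that x y
    by (simp add: square_map_eq circle_map_edge_factor edge_factor_in_exterior
        exterior_circles_subset Let_def)
  have G: "?G v = (let w = circle_map ?K v; u = (if is_merge D I y then w else ?Y w)
      in if is_merge D (insert y I) x then u else ?X u)" if "v \<in> exterior (circles D I)" for v
    using that x y
    by (simp add: square_map_eq circle_map_edge_factor edge_factor_in_exterior
        exterior_circles_subset Let_def K)
  have zero: "wedge (gen c - gen c) u = 0" for c u by (simp add: wedge_def)
  have merge: "is_merge D I x \<longleftrightarrow> circle_of D I ?p \<noteq> circle_of D I (far_strand (crossings D ! x))"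
    "is_merge D (insert y I) x \<longleftrightarrow>
      circle_of D (insert y I) ?p \<noteq> circle_of D (insert y I) (far_strand (crossings D ! x))"
    "is_merge D I y \<longleftrightarrow> circle_of D I ?p' \<noteq> circle_of D I (far_strand (crossings D ! y))"
    "is_merge D (insert x I) y \<longleftrightarrow>
      circle_of D (insert x I) ?p' \<noteq> circle_of D (insert x I) (far_strand (crossings D ! y))"
    by (rule is_merge_iff[OF x(1,2)] is_merge_iff[OF x(1,3)]
        is_merge_iff[OF y(1,2)] is_merge_iff[OF y(1,3)])+
  note E = finite_edges crossing_in_edges(1,2)[OF x(1), of "arr x"] crossing_in_edges(3)[OF x(1)]
    crossing_in_edges(1,2)[OF y(1), of "arr y"] crossing_in_edges(3)[OF y(1)]
  show thesis
  proof (rule surgery_square[OF E surgery_circle_of[OF x(1,2)] surgery_circle_of[OF y(1,2)]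
        surgery_circle_of[OF y(1,3)] surgery_circle_of[OF x(1,3), unfolded K]])
    assume 
      "circle_of D I ?p = circle_of D I (far_strand (crossings D ! x)) \<and> ?g ?p = ?g ?q \<or>
       circle_of D (insert x I) ?p' = circle_of D (insert x I) (far_strand (crossings D ! y)) \<and> ?g ?p' = ?g ?q'"
      "circle_of D I ?p' = circle_of D I (far_strand (crossings D ! y)) \<and> ?g ?p' = ?g ?q' \<or>
       circle_of D (insert y I) ?p = circle_of D (insert y I) (far_strand (crossings D ! x)) \<and> ?g ?p = ?g ?q"
    then have "?F v = 0" "?G v = 0" if "v \<in> exterior (circles D I)" for v
      using that merge zero by (auto simp: F G Let_def)
    \<comment> \<open>Both composites are 0, so either alternative could be chosen.\<close>
    then show thesis by (intro that(1)) simp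
  next
    assume "circle_of D I ?p = circle_of D I (far_strand (crossings D ! x)) \<longleftrightarrow>
        circle_of D (insert y I) ?p = circle_of D (insert y I) (far_strand (crossings D ! x))"
      "circle_of D I ?p' = circle_of D I (far_strand (crossings D ! y)) \<longleftrightarrow>
        circle_of D (insert x I) ?p' = circle_of D (insert x I) (far_strand (crossings D ! y))"
    then have m: "is_merge D (insert y I) x = is_merge D I x" "is_merge D (insert x I) y = is_merge D I y"
      using merge by auto
    show thesis
    \<comment> \<open>With at most one wedge factor the order is immaterial; two such factors
      anticommute.\<close>
    proof (cases "is_merge D I x \<or> is_merge D I y")
      case True
      then show thesis by (intro that(1)) (auto simp: F G Let_def m)
    next
      case False
      then show thesis
        by (intro that(2)) (simp add: F G Let_def m wedge_diff_diff_anticommute[of "?g ?p'"])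
    qed
  next
    assume "circle_of D I ?p \<noteq> circle_of D I (far_strand (crossings D ! x))"
      "circle_of D I ?p' \<noteq> circle_of D I (far_strand (crossings D ! y))"
      "circle_of D (insert y I) ?p = circle_of D (insert y I) (far_strand (crossings D ! x))"
      "circle_of D (insert x I) ?p' = circle_of D (insert x I) (far_strand (crossings D ! y))"
      and pq: "{?g ?p, ?g ?q} = {?g ?p', ?g ?q'}"
    then have m: "is_merge D I x" "is_merge D I y" "\<not> is_merge D (insert y I) x" "\<not> is_merge D (insert x I) y"
      using merge by auto
    \<comment> \<open>The two differences are equal or opposite, according to whether the dual
      arrows point the same way between the two circles.\<close>
    from pq consider "?g ?p = ?g ?p'" "?g ?q = ?g ?q'" | "?g ?p = ?g ?q'" "?g ?q = ?g ?p'"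
      unfolding doubleton_eq_iff by blast
    then show thesis
    proof cases
      case 1
      then show thesis by (intro that(1)) (simp add: F G Let_def m)
    next
      case 2
      then show thesis by (intro that(2)) (simp add: F G Let_def m wedge_diff_left)
    qed
  qed
qed

end

text \<open>The number of negative signs is even exactly when the product of all four is 1. The
  conditions on \<open>x\<close>, \<open>y\<close> and \<open>I\<close> make the four edges
  distinct, so the cardinality counts each of them.\<close>

lemma even_square_iff:
  assumes sgn: "\<And>e. e \<in> square_edges I x y \<Longrightarrow> \<epsilon> e = 1 \<or> \<epsilon> e = - 1"
    and "x \<noteq> y" "x \<notin> I" "y \<notin> I"
  shows "even_square \<epsilon> I x y \<longleftrightarrow> \<epsilon> (I, x) * \<epsilon> (insert x I, y) = \<epsilon> (I, y) * \<epsilon> (insert y I, x)"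
proof -
  let ?n = "\<lambda>e. if \<epsilon> e = - 1 then 1 else 0 :: nat"
  have "card {e \<in> square_edges I x y. \<epsilon> e = - 1} = (\<Sum>e\<in>square_edges I x y. ?n e)"
    by (subst sum.inter_filter[symmetric]) (auto simp: square_edges_def)
  moreover have "I \<noteq> insert x I" "I \<noteq> insert y I" using assms by auto
  ultimately have "card {e \<in> square_edges I x y. \<epsilon> e = - 1} =
      ?n (I, x) + ?n (insert x I, y) + ?n (I, y) + ?n (insert y I, x)"
    using assms(2-) by (simp add: square_edges_def)
  moreover have "\<epsilon> (I, x) = 1 \<or> \<epsilon> (I, x) = - 1" "\<epsilon> (I, y) = 1 \<or> \<epsilon> (I, y) = - 1"
    "\<epsilon> (insert x I, y) = 1 \<or> \<epsilon> (insert x I, y) = - 1"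
    "\<epsilon> (insert y I, x) = 1 \<or> \<epsilon> (insert y I, x) = - 1"
    using sgn by (simp_all add: square_edges_def)
  moreover have "even ((if a = - 1 then 1 else 0) + (if b = - 1 then 1 else 0)
      + (if c = - 1 then 1 else 0) + (if d = - 1 then 1 else 0 :: nat)) \<longleftrightarrow> a * b = c * d"
    if "a = 1 \<or> a = - 1" "c = 1 \<or> c = - 1" "b = 1 \<or> b = - 1" "d = 1 \<or> d = - 1" for a b c d :: int
    using that by (elim disjE) simp_all
  ultimately show ?thesis
    unfolding even_square_def by (simp only:)
qed

text \<open>Exchanging the indices shows that the sum is its own negative; its integer coefficients
  are then 0.\<close>

lemma sum_antisymmetric_eq_0:
  fixes T :: "'a \<Rightarrow> 'a \<Rightarrow> 'b \<Rightarrow>\<^sub>0 int"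
  assumes "finite S" "\<And>x y. x \<in> S \<Longrightarrow> y \<in> S \<Longrightarrow> x \<noteq> y \<Longrightarrow> T x y = - T y x"
  shows "(\<Sum>x\<in>S. \<Sum>y\<in>S - {x}. T x y) = 0"
proof -
  let ?P = "SIGMA x:S. S - {x}" and ?s = "\<Sum>x\<in>S. \<Sum>y\<in>S - {x}. T x y"
  have "?s = (\<Sum>(x, y)\<in>?P. T x y)" using assms(1) by (subst sum.Sigma) auto
  also have "\<dots> = (\<Sum>(x, y)\<in>?P. T y x)"
    by (rule sum.reindex_bij_witness[of _ prod.swap prod.swap]) auto
  also have "\<dots> = (\<Sum>(x, y)\<in>?P. - T x y)"
    by (rule sum.cong) (use assms(2) in auto)
  also have "\<dots> = - (\<Sum>(x, y)\<in>?P. T x y)" by (simp add: sum_negf case_prod_unfold)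
  also have "(\<Sum>(x, y)\<in>?P. T x y) = ?s" using assms(1) by (subst sum.Sigma) auto
  finally have *: "?s = - ?s" .
  show ?thesis
  proof (rule poly_mapping_eqI)
    fix k
    have "Poly_Mapping.lookup ?s k = - Poly_Mapping.lookup ?s k"
      by (subst *) simp
    then show "Poly_Mapping.lookup ?s k = Poly_Mapping.lookup 0 k" by simp
  qed
qed

lemma frag_cmul_diff_right: "frag_cmul k (u - v) = frag_cmul k u - frag_cmul k v"
  by (rule poly_mapping_eqI) (simp add: lookup_minus right_diff_distrib)

lemma at_vertex_diff: "at_vertex I (u - v) = at_vertex I u - at_vertex I v"
  by (simp add: at_vertex_def frag_extend_diff)

lemma at_vertex_minus: "at_vertex I (- u) = - at_vertex I u"
  by (simp add: at_vertex_def frag_extend_minus)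

lemma at_vertex_frag_of [simp]: "at_vertex I (frag_of A) = frag_of (I, A)"
  by (simp add: at_vertex_def)

lemma keys_at_vertex: "Poly_Mapping.keys (at_vertex I u) \<subseteq> Pair I ` Poly_Mapping.keys u"
  unfolding at_vertex_def using keys_frag_extend[of "\<lambda>A. frag_of (I, A)" u] by auto

definition generators :: "diagram \<Rightarrow> (nat set \<times> nat set) set" where
  "generators D = (SIGMA I:Pow {..<num_crossings D}. Pow (circles D I))"

context link_diagram
begin

lemma edge_factor_diff: "edge_factor arr I x (u - v) = edge_factor arr I x u - edge_factor arr I x v"
  by (simp add: edge_factor_def wedge_diff_right)

lemma edge_map_circles:
  assumes "x < num_crossings D" "x \<notin> I" "u \<in> exterior (circles D I)"
  shows "edge_map D arr I x u = circle_map (insert x I) (edge_factor arr I x u)"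
  using edge_map_circle_map[OF assms(1,2) exterior_circles_subset[OF assms(3)], of arr]
  by (simp add: circle_map_circles[OF assms(3)])

lemma edge_map_in_exterior:
  assumes "x < num_crossings D" "x \<notin> I" "u \<in> exterior (circles D I)"
  shows "edge_map D arr I x u \<in> exterior (circles D (insert x I))"
  unfolding edge_map_circles[OF assms]
  by (intro circle_map_in_circles edge_factor_in_exterior assms exterior_circles_subset[OF assms(3)])

lemma frag_of_in_exterior: "A \<subseteq> S \<Longrightarrow> frag_of A \<in> exterior S"
  by (simp add: exterior_def)

text \<open>\<open>differential\<close> is additive by construction but \<open>edge_map\<close> is
  not visibly so. The extension from monomials goes through \<open>circle_map\<close> and
  \<open>edge_factor\<close>, which are additive.\<close>

lemma differential_at_vertex:
  assumes "u \<in> exterior (circles D I)"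
  shows "differential D arr \<epsilon> (at_vertex I u) = (\<Sum>x\<in>{..<num_crossings D} - I.
    frag_cmul (\<epsilon> (I, x)) (at_vertex (insert x I) (edge_map D arr I x u)))"
proof -
  let ?g = "\<lambda>u. \<Sum>x\<in>{..<num_crossings D} - I.
    frag_cmul (\<epsilon> (I, x)) (at_vertex (insert x I) (circle_map (insert x I) (edge_factor arr I x u)))"
  have "differential D arr \<epsilon> (at_vertex I u) = ?g u"
  proof (rule frag_extend_ext[where S = "Pow (circles D I)" and g = ?g
        and f = "\<lambda>u. differential D arr \<epsilon> (at_vertex I u)"])
    fix A assume "A \<in> Pow (circles D I)"
    then show "differential D arr \<epsilon> (at_vertex I (frag_of A)) = ?g (frag_of A)"
      by (simp add: differential_def edge_map_circles frag_of_in_exterior)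
  qed (use assms in \<open>simp_all add: exterior_def differential_def frag_extend_diff at_vertex_diff
      edge_factor_diff exterior_map_diff frag_cmul_diff_right sum_subtractf\<close>)
  also have "\<dots> = (\<Sum>x\<in>{..<num_crossings D} - I.
      frag_cmul (\<epsilon> (I, x)) (at_vertex (insert x I) (edge_map D arr I x u)))"
    by (intro sum.cong) (simp_all add: edge_map_circles assms)
  finally show ?thesis .
qed

text \<open>For both kinds of edge assignments, \<open>type_A\<close> forces equal sign products
  along the two paths and \<open>type_C\<close> opposite ones; in either case the signed composites
  are negatives of each other.\<close>

lemma signed_squares_cancel:
  assumes \<epsilon>: "edge_assignment_X D arr \<epsilon> \<or> edge_assignment_Y D arr \<epsilon>"
    and sq: "(I, x, y) \<in> hypercube_squares D" and v: "v \<in> exterior (circles D I)"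
  shows "frag_cmul (\<epsilon> (I, x) * \<epsilon> (insert x I, y)) (square_map D arr I x y v) =
    - frag_cmul (\<epsilon> (I, y) * \<epsilon> (insert y I, x)) (square_map D arr I y x v)"
proof -
  let ?a = "\<epsilon> (I, x) * \<epsilon> (insert x I, y)" and ?b = "\<epsilon> (I, y) * \<epsilon> (insert y I, x)"
  have xy: "x \<noteq> y" "x \<notin> I" "y \<notin> I" "x < num_crossings D" "y < num_crossings D"
    "I \<subseteq> {..<num_crossings D}"
    using sq by (auto simp: hypercube_squares_def)
  have "square_edges I x y \<subseteq> hypercube_edges D"
    using xy by (auto simp: square_edges_def hypercube_edges_def)
  then have sgn: "\<epsilon> e = 1 \<or> \<epsilon> e = - 1" if "e \<in> square_edges I x y" for e
    using \<epsilon> that by (auto simp: edge_assignment_X_def edge_assignment_Y_def sign_assignment_def)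
  have even: "even_square \<epsilon> I x y \<longleftrightarrow> ?a = ?b"
    by (rule even_square_iff[OF sgn xy(1-3)])
  have ab: "?a = ?b \<or> ?a = - ?b"
    using sgn[of "(I, x)"] sgn[of "(I, y)"] sgn[of "(insert x I, y)"] sgn[of "(insert y I, x)"]
    by (auto simp: square_edges_def)
  have A: "type_A D arr I x y \<Longrightarrow> ?a = ?b" and C: "type_C D arr I x y \<Longrightarrow> ?a \<noteq> ?b"
    using \<epsilon> sq even by (auto simp: edge_assignment_X_def edge_assignment_Y_def)
  show ?thesis
  proof (cases "nonzero_square D arr I x y")
    case True
    from square_map_sign[OF sq, of arr] show ?thesis
    proof cases
      case 1
      then have "?a \<noteq> ?b" using True by (intro C) (auto simp: type_C_def)
      then show ?thesis using ab 1[OF v] by auto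
    next
      case 2
      then have "?a = ?b" using True by (intro A) (auto simp: type_A_def)
      then show ?thesis using 2[OF v] by (simp add: frag_cmul_minus)
    qed
  next
    case False
    \<comment> \<open>Maps that agree up to one common sign vanish together, so the failure of
      \<open>nonzero_square\<close> means that both are 0.\<close>
    from square_map_sign[OF sq, of arr]
    have "square_map D arr I x y v = 0 \<and> square_map D arr I y x v = 0"
      using False v unfolding nonzero_square_def by (metis neg_equal_0_iff_equal)
    then show ?thesis by simp
  qed
qed

text \<open>The terms are indexed by ordered pairs of crossings. A pair and its reversal end at the
  same vertex and cancel.\<close>

lemma differential_differential_frag_of:
  assumes \<epsilon>: "edge_assignment_X D arr \<epsilon> \<or> edge_assignment_Y D arr \<epsilon>"
    and I: "I \<subseteq> {..<num_crossings D}" and A: "A \<subseteq> circles D I"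
  shows "differential D arr \<epsilon> (differential D arr \<epsilon> (frag_of (I, A))) = 0"
proof -
  let ?d = "differential D arr \<epsilon>" and ?n = "{..<num_crossings D}"
  have u: "frag_of A \<in> exterior (circles D I)" using A by (rule frag_of_in_exterior)
  define T where "T x y = frag_cmul (\<epsilon> (I, x) * \<epsilon> (insert x I, y))
    (at_vertex (insert y (insert x I)) (square_map D arr I x y (frag_of A)))" for x y
  have "?d (frag_of (I, A)) = (\<Sum>x\<in>?n - I.
      frag_cmul (\<epsilon> (I, x)) (at_vertex (insert x I) (edge_map D arr I x (frag_of A))))"
    using differential_at_vertex[OF u] by simp
  then have "?d (?d (frag_of (I, A))) = (\<Sum>x\<in>?n - I.
      frag_cmul (\<epsilon> (I, x)) (?d (at_vertex (insert x I) (edge_map D arr I x (frag_of A)))))"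
    by (simp add: differential_def frag_extend_sum frag_extend_cmul)
  also have "\<dots> = (\<Sum>x\<in>?n - I. \<Sum>y\<in>?n - I - {x}. T x y)"
  proof (rule sum.cong[OF refl])
    fix x assume x: "x \<in> ?n - I"
    have "?n - insert x I = ?n - I - {x}" by auto
    then show "frag_cmul (\<epsilon> (I, x)) (?d (at_vertex (insert x I) (edge_map D arr I x (frag_of A)))) =
        (\<Sum>y\<in>?n - I - {x}. T x y)"
      using x by (simp add: differential_at_vertex edge_map_in_exterior u frag_cmul_sum T_def square_map_def)
  qed
  also have "\<dots> = 0"
  proof (rule sum_antisymmetric_eq_0)
    fix x y assume xy: "x \<in> ?n - I" "y \<in> ?n - I" "x \<noteq> y"
    then have "(I, x, y) \<in> hypercube_squares D" using I by (auto simp: hypercube_squares_def)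
    from signed_squares_cancel[OF \<epsilon> this u]
    have "at_vertex (insert y (insert x I)) (frag_cmul (\<epsilon> (I, x) * \<epsilon> (insert x I, y)) (square_map D arr I x y (frag_of A)))
      = at_vertex (insert y (insert x I)) (- frag_cmul (\<epsilon> (I, y) * \<epsilon> (insert y I, x)) (square_map D arr I y x (frag_of A)))"
      by (rule arg_cong)
    then show "T x y = - T y x"
      by (simp only: at_vertex_minus T_def) (simp add: at_vertex_def frag_extend_cmul insert_commute)
  qed simp
  finally show ?thesis .
qed

lemma differential_differential:
  assumes \<epsilon>: "edge_assignment_X D arr \<epsilon> \<or> edge_assignment_Y D arr \<epsilon>"
    and "Poly_Mapping.keys c \<subseteq> generators D"
  shows "differential D arr \<epsilon> (differential D arr \<epsilon> c) = 0"
  by (rule frag_extend_ext[OF assms(2), where f = "\<lambda>c. differential D arr \<epsilon> (differential D arr \<epsilon> c)"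
        and g = "\<lambda>_. 0"])
    (auto simp: generators_def differential_differential_frag_of[OF \<epsilon>],
      simp_all add: differential_def frag_extend_diff)

end

section \<open>Behaviour of the differential with respect to the bigrading\<close>

definition bigenerators :: "diagram \<Rightarrow> (nat \<Rightarrow> bool) \<Rightarrow> int \<Rightarrow> int \<Rightarrow> (nat set \<times> nat set) set" where
  "bigenerators D pos m s =
     {(I, A) \<in> generators D. homological_degree D pos (I, A) = m \<and> q_degree D pos (I, A) = s}"

lemma chain_group_eq: "chain_group D pos m s = free_Abelian_group (bigenerators D pos m s)"
proof -
  have "{(I, A). I \<subseteq> {..<num_crossings D} \<and> A \<subseteq> circles D I \<and>
      homological_degree D pos (I, A) = m \<and> q_degree D pos (I, A) = s} = bigenerators D pos m s"
    by (auto simp: bigenerators_def generators_def)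
  then show ?thesis by (simp only: chain_group_def)
qed

context link_diagram
begin

lemma finite_generators: "finite (generators D)"
  unfolding generators_def by (intro finite_SigmaI) (simp_all add: finite_circles)

lemma keys_circle_map_frag_of:
  assumes "A \<subseteq> circles D I" "B \<in> Poly_Mapping.keys (circle_map J (frag_of A))"
  shows "B \<subseteq> circles D J" "card B = card A"
proof -
  have A: "A \<subseteq> edges D" "finite A"
    using assms(1) circles_subset[OF wf, of I] finite_subset[OF _ finite_edges, of A] by auto
  from assms(2) A have "B \<subseteq> circle_of D J ` A \<and> card B = card A"
    using keys_wedge_list[of "circle_of D J" "sorted_list_of_set A"]
    by (auto simp: exterior_map_monomial)
  moreover have "circle_of D J ` A \<subseteq> circles D J" using A by (auto simp: circles_def)
  ultimately show "B \<subseteq> circles D J" "card B = card A" by auto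
qed

text \<open>A merge loses a circle and keeps the exterior degree; a split gains a circle and raises
  the exterior degree by 1. In both cases the difference drops by 1, which the growth of the vertex
  compensates.\<close>

lemma keys_edge_map:
  assumes x: "x < num_crossings D" "x \<notin> I" and A: "A \<subseteq> circles D I"
    and B: "B \<in> Poly_Mapping.keys (edge_map D arr I x (frag_of A))"
  shows "B \<subseteq> circles D (insert x I) \<and>
    int (card (circles D (insert x I))) - 2 * int (card B) + 1 = int (card (circles D I)) - 2 * int (card A)"
proof -
  let ?J = "insert x I" and ?p = "dual_tail (arr x) (crossings D ! x)"
    and ?q = "dual_head (arr x) (crossings D ! x)"
  let ?a = "circle_of D ?J ?p" and ?b = "circle_of D ?J ?q"
  let ?w = "circle_map ?J (frag_of A)"
  have u: "frag_of A \<in> exterior (circles D I)" using A by (rule frag_of_in_exterior)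
  have edge: "edge_map D arr I x (frag_of A) =
      (if is_merge D I x then ?w else wedge (gen ?a - gen ?b) ?w)"
    unfolding edge_map_circles[OF x u]
    by (rule circle_map_edge_factor[OF exterior_circles_subset[OF u]])
  show ?thesis
  proof (cases "is_merge D I x")
    case True
    then show ?thesis
      using B keys_circle_map_frag_of[OF A, of B ?J] card_circles_insert[OF x, of "arr x"]
      by (simp add: edge)
  next
    case False
    then have B': "B \<in> Poly_Mapping.keys (wedge (gen ?a - gen ?b) ?w)" using B by (simp add: edge)
    \<comment> \<open>Equality would mean an unchanged number of circles, which the grading would
      not tolerate; but then the map is 0 and there is no \<open>B\<close>.\<close>
    have ab: "?a \<noteq> ?b"
    proof
      assume "?a = ?b"
      then show False using B' by (simp add: wedge_def)
    qed
    have circ: "?a \<in> circles D ?J" "?b \<in> circles D ?J"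
      using crossing_in_edges(1,2)[OF x(1), of "arr x"] by (auto simp: circles_def)
    have "B \<in> Poly_Mapping.keys (wedge (gen ?a) ?w) \<union> Poly_Mapping.keys (wedge (gen ?b) ?w)"
      using B' keys_diff[of "wedge (gen ?a) ?w" "wedge (gen ?b) ?w"] by (auto simp: wedge_diff_left)
    then obtain c A' where c: "c \<in> {?a, ?b}" "B = insert c A'" "c \<notin> A'"
      and "A' \<in> Poly_Mapping.keys ?w"
      using keys_wedge_gen[of ?a ?w] keys_wedge_gen[of ?b ?w] by blast
    from keys_circle_map_frag_of[OF A this(4)] have A': "A' \<subseteq> circles D ?J" "card A' = card A" .
    then have "finite A'" using finite_subset[OF _ finite_circles[OF wf]] by simp
    then have "card B = card A + 1" "B \<subseteq> circles D ?J" using c A' circ by auto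
    then show ?thesis
      using card_circles_insert[OF x, of "arr x"] False ab by simp
  qed
qed

lemma keys_differential_frag_of:
  assumes "(I, A) \<in> bigenerators D pos m s"
  shows "Poly_Mapping.keys (differential D arr \<epsilon> (frag_of (I, A))) \<subseteq> bigenerators D pos (m + 1) s"
proof -
  have I: "I \<subseteq> {..<num_crossings D}" "A \<subseteq> circles D I" "finite I"
    using assms finite_subset[of I "{..<num_crossings D}"]
    by (auto simp: bigenerators_def generators_def)
  have "(J, B) \<in> bigenerators D pos (m + 1) s"
    if x: "x \<in> {..<num_crossings D} - I"
      and JB: "(J, B) \<in> Poly_Mapping.keys (at_vertex (insert x I) (edge_map D arr I x (frag_of A)))" for x J B
  proof -
    have J: "J = insert x I" "B \<in> Poly_Mapping.keys (edge_map D arr I x (frag_of A))"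
      using JB keys_at_vertex by fastforce+
    have x': "x < num_crossings D" "x \<notin> I" using x by auto
    show ?thesis
      using keys_edge_map[OF x' I(2) J(2)] J(1) I x assms
      by (auto simp: bigenerators_def generators_def homological_degree_def q_degree_def)
  qed
  then have "Poly_Mapping.keys (frag_cmul k (at_vertex (insert x I) (edge_map D arr I x (frag_of A))))
      \<subseteq> bigenerators D pos (m + 1) s" if "x \<in> {..<num_crossings D} - I" for x k
    using that keys_cmul[of k "at_vertex (insert x I) (edge_map D arr I x (frag_of A))"] by fastforce
  then show ?thesis
    unfolding differential_def frag_extend_of case_prod_conv
    by (intro order_trans[OF keys_sum]) blast
qed

lemma differential_hom:
  "differential D arr \<epsilon> \<in> hom (chain_group D pos m s) (chain_group D pos (m + 1) s)"
proof (rule homI)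
  fix c assume "c \<in> carrier (chain_group D pos m s)"
  then have c: "Poly_Mapping.keys c \<subseteq> bigenerators D pos m s" by (simp add: chain_group_eq)
  have "Poly_Mapping.keys (differential D arr \<epsilon> (frag_of g)) \<subseteq> bigenerators D pos (m + 1) s"
    if "g \<in> Poly_Mapping.keys c" for g
    using keys_differential_frag_of[of "fst g" "snd g" m s] c that by auto
  then have "(\<Union>g\<in>Poly_Mapping.keys c. Poly_Mapping.keys (differential D arr \<epsilon> (frag_of g)))
      \<subseteq> bigenerators D pos (m + 1) s"
    by (rule UN_least)
  moreover have "Poly_Mapping.keys (differential D arr \<epsilon> c) \<subseteq>
      (\<Union>g\<in>Poly_Mapping.keys c. Poly_Mapping.keys (differential D arr \<epsilon> (frag_of g)))"
    unfolding differential_def frag_extend_of by (rule keys_frag_extend)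
  ultimately show "differential D arr \<epsilon> c \<in> carrier (chain_group D pos (m + 1) s)"
    unfolding chain_group_eq carrier_free_Abelian_group_iff by (rule order_trans[rotated])
qed (simp_all add: chain_group_eq differential_def frag_extend_add)

end

section \<open>The state sum\<close>

lemma identify_closure: "(e, identify p e) \<in> equiv_closure {p}"
  by (cases p) (auto simp: max_def min_def intro: equiv_closure_base equiv_closure_sym)

text \<open>Together with \<open>glue_eq\<close> this says that \<open>glue ps\<close> picks one
  representative from each class generated by \<open>ps\<close>.\<close>

lemma glue_closure: "(e, glue ps e) \<in> equiv_closure (set ps)"
proof (induction ps e rule: glue.induct)
  case (2 p ps e)
  let ?C = "equiv_closure (set (p # ps))"
  have id: "(x, identify p x) \<in> ?C" for x
    by (rule equiv_closure_mono[OF _ identify_closure]) simp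
  have "set (map (map_prod (identify p) (identify p)) ps) \<subseteq> ?C"
  proof
    fix z assume "z \<in> set (map (map_prod (identify p) (identify p)) ps)"
    then obtain u v where uv: "(u, v) \<in> set ps" "z = (identify p u, identify p v)" by auto
    have "(u, v) \<in> ?C" using uv(1) by (intro equiv_closure_base) simp
    then show "z \<in> ?C"
      using id[of u] id[of v] unfolding uv(2) equiv_closure_iff_class by simp
  qed
  then have "equiv_closure (set (map (map_prod (identify p) (identify p)) ps)) \<subseteq> ?C"
    by (simp only: equiv_closure_subset_iff)
  from subsetD[OF this 2] show ?case
    using id[of e] by (auto intro: equiv_closure_trans)
qed simp

lemma glue_eq: "(u, v) \<in> set ps \<Longrightarrow> glue ps u = glue ps v"
proof (induction "length ps" arbitrary: ps u v)
  case (Suc n)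
  then obtain p qs where ps: "ps = p # qs" "length qs = n" by (cases ps) auto
  show ?case
  proof (cases "(u, v) = p")
    case True
    then have "identify p u = identify p v" by (auto simp: max_def min_def)
    then show ?thesis by (simp add: ps)
  next
    case False
    then have "(u, v) \<in> set qs" using Suc.prems ps by auto
    then have "(identify p u, identify p v) \<in> set (map (map_prod (identify p) (identify p)) qs)"
      by force
    then show ?thesis
      using Suc.hyps(1)[of "map (map_prod (identify p) (identify p)) qs"] ps by simp
  qed
qed simp

text \<open>Passing to representatives modulo \<open>S\<close> and then generating by the images of
  \<open>T\<close> is generating by \<open>S\<close> and \<open>T\<close> at once; minimality of the
  closures proves both directions.\<close>

lemma equiv_closure_quotient:
  assumes g: "\<And>e. (e, g e) \<in> equiv_closure S" "\<And>u v. (u, v) \<in> S \<Longrightarrow> g u = g v"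
  shows "(g e, g e') \<in> equiv_closure (map_prod g g ` T) \<longleftrightarrow> (e, e') \<in> equiv_closure (S \<union> T)"
proof
  let ?C = "equiv_closure (S \<union> T)"
  have g': "(x, g x) \<in> ?C" for x by (rule equiv_closure_mono[OF _ g(1)]) simp
  have "map_prod g g ` T \<subseteq> ?C"
  proof
    fix z assume "z \<in> map_prod g g ` T"
    then obtain u v where uv: "(u, v) \<in> T" "z = (g u, g v)" by auto
    have "(u, v) \<in> ?C" using uv(1) by (intro equiv_closure_base) simp
    then show "z \<in> ?C"
      using g'[of u] g'[of v] unfolding uv(2) equiv_closure_iff_class by simp
  qed
  then have "equiv_closure (map_prod g g ` T) \<subseteq> ?C" by (simp only: equiv_closure_subset_iff)
  moreover assume "(g e, g e') \<in> equiv_closure (map_prod g g ` T)"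
  ultimately have "(g e, g e') \<in> ?C" by (rule subsetD)
  then show "(e, e') \<in> ?C"
    using g'[of e] g'[of e'] unfolding equiv_closure_iff_class by simp
next
  have "equiv_closure (S \<union> T) \<subseteq> {(e, e'). (g e, g e') \<in> equiv_closure (map_prod g g ` T)}"
  proof (rule equiv_closure_least)
    show "S \<union> T \<subseteq> {(e, e'). (g e, g e') \<in> equiv_closure (map_prod g g ` T)}"
      using g(2) by (auto intro: equiv_closure_base)
    show "equiv UNIV {(e, e'). (g e, g e') \<in> equiv_closure (map_prod g g ` T)}"
      unfolding equiv_closure_iff_class by (rule equivI) (auto simp: refl_on_def sym_def trans_def)
  qed
  moreover assume "(e, e') \<in> equiv_closure (S \<union> T)"
  ultimately show "(g e, g e') \<in> equiv_closure (map_prod g g ` T)" by blast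
qed

lemma wf_resolve: "wf_diagram D \<Longrightarrow> crossings D = c # cs \<Longrightarrow> wf_diagram (resolve r 0 D)"
  by (auto simp: wf_diagram_def resolve_def crossing.set_map)

text \<open>Removing crossing 0 shifts the remaining indices down by one, hence \<open>Suc\<close>;
  the vertex contains 0 exactly for the 1-resolution.\<close>

lemma card_circles_resolve:
  assumes wf: "wf_diagram D" and D: "crossings D = c # cs"
  shows "card (circles (resolve r 0 D) I) = card (circles D ((if r then {0} else {}) \<union> Suc ` I))"
proof -
  let ?g = "glue (smoothing r c)" and ?I = "(if r then {0} else {}) \<union> Suc ` I"
  let ?T = "\<Union>y<length cs. set (smoothing (y \<in> I) (cs ! y))"
  have res: "joined (resolve r 0 D) I = map_prod ?g ?g ` ?T"
    by (auto simp: joined_def resolve_def D smoothing_map image_UN)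
  have "joined D ?I = set (smoothing r c) \<union> ?T"
    unfolding joined_def D list.size(4) add_Suc_right add_0_right lessThan_Suc_eq_insert_0
    by (auto simp: image_iff)
  then have "(?g e, ?g e') \<in> same_circle (resolve r 0 D) I \<longleftrightarrow> (e, e') \<in> same_circle D ?I" for e e'
    unfolding res by (simp only: equiv_closure_quotient[OF glue_closure glue_eq])
  then have "card ((\<lambda>e. circle_of (resolve r 0 D) I (?g e)) ` edges D) = card (circle_of D ?I ` edges D)"
    by (intro card_image_eq_kernel) (simp only: circle_of_eq_iff wf wf_resolve[OF wf D])
  moreover have "edges (resolve r 0 D) = ?g ` edges D" by (simp add: resolve_def D)
  ultimately show ?thesis by (simp add: circles_def image_image)
qed

section \<open>The bracket and the Jones polynomial as sums over generators\<close>

lemma qpow_add: "qpow (a + b) = qpow a * qpow b"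
  by (simp add: qpow_def mult_single)

lemma qpow_0 [simp]: "qpow 0 = 1"
  by (simp add: qpow_def)

text \<open>The vertices without and with crossing 0 are those of its two resolutions. The
  coefficient \<open>- q\<close> of the second accounts for the one additional element of the
  vertex.\<close>

lemma bracket_state_sum:
  assumes "wf_diagram D"
  shows "bracket D = (\<Sum>I\<in>Pow {..<num_crossings D}.
    (- 1) ^ card I * qpow (int (card I)) * (qpow 1 + qpow (- 1)) ^ card (circles D I))"
  using assms
proof (induction "num_crossings D" arbitrary: D)
  case 0
  then have D: "crossings D = []" by simp
  have "same_circle D {} = Id" by (simp add: joined_def D equiv_closure_def)
  then have "inj_on (circle_of D {}) (edges D)"
    using circle_of_eq_iff[OF 0(2)] by (intro inj_onI) simp
  then have "card (circles D {}) = card (edges D)" by (simp add: circles_def card_image)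
  then show ?case by (simp add: bracket.simps[of D] D)
next
  case (Suc n)
  then obtain c cs where D: "crossings D = c # cs" "length cs = n" by (cases "crossings D") auto
  let ?t = "\<lambda>D I. (- 1) ^ card I * qpow (int (card I)) * (qpow 1 + qpow (- 1)) ^ card (circles D I)"
  have len: "num_crossings (resolve r 0 D) = n" for r by (simp add: resolve_def D)
  have IH: "bracket (resolve r 0 D) = (\<Sum>I\<in>Pow {..<n}. ?t (resolve r 0 D) I)" for r
    using Suc.hyps(1)[OF len[symmetric] wf_resolve[OF Suc.prems D(1)]] by (simp only: len)
  have inj: "inj_on ((`) Suc) X" for X by (rule inj_onI) (simp add: inj_image_eq_iff)
  have inj0: "inj_on (insert 0) (Pow (Suc ` {..<n}))"
    by (rule inj_onI) (auto simp: insert_eq_iff subset_iff image_iff)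
  have Pow: "Pow (Suc ` {..<n}) = (`) Suc ` Pow {..<n}"
    by (rule image_Pow_surj[symmetric]) simp
  have False_sum: "(\<Sum>I\<in>Pow (Suc ` {..<n}). ?t D I) = bracket (resolve False 0 D)"
    unfolding Pow IH
    by (simp add: sum.reindex[OF inj] card_circles_resolve[OF Suc.prems D(1)] card_image)
  have True_term: "?t D (insert 0 (Suc ` I)) = - qpow 1 * ?t (resolve True 0 D) I" if "I \<in> Pow {..<n}" for I
  proof -
    have "finite I" using that finite_subset by auto
    then have "card (insert 0 (Suc ` I)) = Suc (card I)" by (simp add: card_image)
    then show ?thesis
      using qpow_add[of 1 "int (card I)"]
      by (simp add: card_circles_resolve[OF Suc.prems D(1)] mult_ac)
  qed
  have True_sum: "(\<Sum>I\<in>Pow (Suc ` {..<n}). ?t D (insert 0 I)) = - qpow 1 * bracket (resolve True 0 D)"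
    unfolding Pow IH sum_distrib_left
    by (simp only: sum.reindex[OF inj] o_def) (rule sum.cong[OF refl True_term])
  have "(\<Sum>I\<in>Pow {..<num_crossings D}. ?t D I) =
      (\<Sum>I\<in>Pow (Suc ` {..<n}). ?t D I) + (\<Sum>I\<in>insert 0 ` Pow (Suc ` {..<n}). ?t D I)"
    unfolding Suc.hyps(2)[symmetric] lessThan_Suc_eq_insert_0 Pow_insert
    by (rule sum.union_disjoint) auto
  also have "\<dots> = bracket (resolve False 0 D) - qpow 1 * bracket (resolve True 0 D)"
    using True_sum by (simp add: sum.reindex[OF inj0] False_sum)
  also have "\<dots> = bracket D" using D by (simp add: bracket.simps[of D])
  finally show ?case by simp
qed

lemma power_qpow: "qpow a ^ n = qpow (int n * a)"
  by (induction n) (simp_all add: qpow_add[symmetric] algebra_simps)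

text \<open>A circle in \<open>A\<close> contributes the inverse of \<open>q\<close>, any other
  circle \<open>q\<close>. The exponent is thus the part of the \<open>q\<close>-grading that
  belongs to the monomial \<open>A\<close>.\<close>

lemma circle_power:
  assumes "finite S"
  shows "(qpow 1 + qpow (- 1)) ^ card S = (\<Sum>A\<in>Pow S. qpow (int (card S) - 2 * int (card A)))"
proof -
  have "(qpow 1 + qpow (- 1)) ^ card S = (\<Prod>i\<in>S. qpow (- 1) + qpow 1)"
    by (simp add: add.commute)
  also have "\<dots> = (\<Sum>A\<in>Pow S. (\<Prod>i\<in>A. qpow (- 1)) * (\<Prod>i\<in>S - A. qpow 1))"
    using assms by (rule prod_add)
  also have "\<dots> = (\<Sum>A\<in>Pow S. qpow (int (card S) - 2 * int (card A)))"
  proof (rule sum.cong[OF refl])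
    fix A assume "A \<in> Pow S"
    then have "card (S - A) = card S - card A" "card A \<le> card S"
      using assms by (auto simp: card_Diff_subset finite_subset card_mono)
    then show "(\<Prod>i\<in>A. qpow (- 1)) * (\<Prod>i\<in>S - A. qpow 1) = qpow (int (card S) - 2 * int (card A))"
      by (simp add: power_qpow of_nat_diff flip: qpow_add)
  qed
  finally show ?thesis .
qed

lemma unnormalized_jones_generators:
  assumes "wf_diagram D"
  shows "unnormalized_jones D pos = (\<Sum>g\<in>generators D.
    (- 1) ^ nat \<bar>homological_degree D pos g\<bar> * qpow (q_degree D pos g))"
proof -
  let ?N = "n_minus D pos" and ?w = "int (n_plus D pos) - 2 * int (n_minus D pos)"
  have summand: "(- 1) ^ ?N * qpow ?w * ((- 1) ^ card I * qpow (int (card I)) * qpow (int (card (circles D I)) - 2 * int (card A)))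
      = (- 1) ^ nat \<bar>homological_degree D pos (I, A)\<bar> * qpow (q_degree D pos (I, A))" for I A
  proof -
    \<comment> \<open>The exponent of a sign must be a natural number, hence the absolute value;
      only its parity matters, and a difference has the parity of the sum.\<close>
    have "even (nat \<bar>int (card I) - int ?N\<bar>) \<longleftrightarrow> even (?N + card I)"
      by (simp add: even_nat_iff add.commute)
    then have sgn: "(- 1 :: laurent) ^ nat \<bar>int (card I) - int ?N\<bar> = (- 1) ^ (?N + card I)"
      by (simp add: minus_one_power_iff)
    have "q_degree D pos (I, A) = ?w + (int (card I) + (int (card (circles D I)) - 2 * int (card A)))"
      by (simp add: q_degree_def)
    then show ?thesis
      by (simp add: homological_degree_def sgn power_add qpow_add mult_ac del: add_diff_eq)
  qed
  have "unnormalized_jones D pos = (\<Sum>I\<in>Pow {..<num_crossings D}. \<Sum>A\<in>Pow (circles D I).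
      (- 1) ^ ?N * qpow ?w * ((- 1) ^ card I * qpow (int (card I)) * qpow (int (card (circles D I)) - 2 * int (card A))))"
    unfolding unnormalized_jones_def bracket_state_sum[OF assms] circle_power[OF finite_circles[OF assms]]
    by (simp only: sum_distrib_left)
  also have "\<dots> = (\<Sum>g\<in>generators D.
    (- 1) ^ nat \<bar>homological_degree D pos g\<bar> * qpow (q_degree D pos g))"
    unfolding summand generators_def
    by (subst sum.Sigma) (auto simp: finite_circles[OF assms] case_prod_unfold)
  finally show ?thesis .
qed

section \<open>Ranks of subquotients of free abelian groups\<close>

text \<open>Rational functions on the generators replace the tensor product with the rationals;
  \<open>rat_vec\<close> embeds the integral chains.\<close>

definition rat_scale :: "rat \<Rightarrow> ('a \<Rightarrow> rat) \<Rightarrow> 'a \<Rightarrow> rat" where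
  "rat_scale c f = (\<lambda>x. c * f x)"

interpretation rat_fun: vector_space rat_scale
  by unfold_locales (auto simp: rat_scale_def fun_eq_iff algebra_simps)

definition rat_vec :: "('a \<Rightarrow>\<^sub>0 int) \<Rightarrow> 'a \<Rightarrow> rat" where
  "rat_vec z = (\<lambda>k. of_int (Poly_Mapping.lookup z k))"

lemma rat_vec_0 [simp]: "rat_vec 0 = 0"
  by (simp add: rat_vec_def fun_eq_iff)

lemma rat_vec_add: "rat_vec (u + v) = rat_vec u + rat_vec v"
  by (simp add: rat_vec_def fun_eq_iff lookup_add)

lemma rat_vec_cmul: "rat_vec (frag_cmul k u) = rat_scale (of_int k) (rat_vec u)"
  by (simp add: rat_vec_def rat_scale_def fun_eq_iff)

lemma rat_vec_sum: "rat_vec (sum f S) = (\<Sum>x\<in>S. rat_vec (f x))"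
  by (induction S rule: infinite_finite_induct) (simp_all add: rat_vec_add)

lemma inj_rat_vec: "inj rat_vec"
  by (rule injI) (simp add: rat_vec_def fun_eq_iff poly_mapping_eqI)

lemma common_denominator:
  fixes u :: "'a \<Rightarrow> rat"
  assumes "finite S"
  obtains N :: int and c :: "'a \<Rightarrow> int" where "N \<noteq> 0" "\<And>x. x \<in> S \<Longrightarrow> of_int (c x) = of_int N * u x"
proof -
  have "\<exists>N c. N \<noteq> 0 \<and> (\<forall>x\<in>S. of_int (c x) = of_int N * u x)"
    using assms
  proof (induction S)
    case empty
    then show ?case by (intro exI[of _ 1]) simp
  next
    case (insert y S)
    then obtain N c where N: "N \<noteq> 0" and c: "\<forall>x\<in>S. of_int (c x) = of_int N * u x" by blast
    obtain p q where q: "q > 0" "u y = Fract p q" by (cases "u y") auto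
    have "of_int (q * c x) = of_int (q * N) * u x" if "x \<in> S" for x
      using c that by (simp add: mult.assoc)
    moreover have "of_int (N * p) = of_int (q * N) * u y"
      using q by (simp add: Fract_of_int_quotient)
    ultimately show ?case
      using N q insert.hyps(2)
      by (intro exI[of _ "q * N"] exI[of _ "\<lambda>x. if x = y then N * p else q * c x"]) auto
  qed
  with that show thesis by blast
qed

text \<open>Multiplying a rational relation by a common denominator makes it integral, and
  \<open>rat_vec\<close> is injective.\<close>

lemma independent_rat_vec_iff:
  assumes "finite S"
  shows "rat_fun.independent (rat_vec ` S) \<longleftrightarrow>
    (\<forall>c. (\<Sum>z\<in>S. frag_cmul (c z) z) = 0 \<longrightarrow> (\<forall>z\<in>S. c z = 0))"
proof -
  have inj: "inj_on rat_vec S" using inj_rat_vec by (rule inj_on_subset) simp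
  have sum: "(\<Sum>v\<in>rat_vec ` S. rat_scale (u v) v) = (\<Sum>z\<in>S. rat_scale (u (rat_vec z)) (rat_vec z))" for u
    by (simp add: sum.reindex[OF inj])
  have "rat_fun.independent (rat_vec ` S) \<longleftrightarrow>
      (\<forall>u. (\<Sum>z\<in>S. rat_scale (u z) (rat_vec z)) = 0 \<longrightarrow> (\<forall>z\<in>S. u z = 0))"
  proof
    assume ind: "rat_fun.independent (rat_vec ` S)"
    show "\<forall>u. (\<Sum>z\<in>S. rat_scale (u z) (rat_vec z)) = 0 \<longrightarrow> (\<forall>z\<in>S. u z = 0)"
    proof (intro allI impI ballI)
      fix u z assume eq: "(\<Sum>z\<in>S. rat_scale (u z) (rat_vec z)) = 0" and z: "z \<in> S"
      let ?u = "\<lambda>v. u (inv_into UNIV rat_vec v)"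
      have "(\<Sum>v\<in>rat_vec ` S. rat_scale (?u v) v) = 0"
        using eq by (simp add: sum inv_f_f[OF inj_rat_vec])
      then have "?u (rat_vec z) = 0"
        using rat_fun.independentD[OF ind, of "rat_vec ` S" ?u] assms z by blast
      then show "u z = 0" by (simp add: inv_f_f[OF inj_rat_vec])
    qed
  next
    assume *: "\<forall>u. (\<Sum>z\<in>S. rat_scale (u z) (rat_vec z)) = 0 \<longrightarrow> (\<forall>z\<in>S. u z = 0)"
    then show "rat_fun.independent (rat_vec ` S)"
      using assms by (auto simp: rat_fun.dependent_finite sum)
  qed
  also have "\<dots> \<longleftrightarrow> (\<forall>c. (\<Sum>z\<in>S. frag_cmul (c z) z) = 0 \<longrightarrow> (\<forall>z\<in>S. c z = 0))"
  proof
    assume *: "\<forall>u. (\<Sum>z\<in>S. rat_scale (u z) (rat_vec z)) = 0 \<longrightarrow> (\<forall>z\<in>S. u z = 0)"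
    show "\<forall>c. (\<Sum>z\<in>S. frag_cmul (c z) z) = 0 \<longrightarrow> (\<forall>z\<in>S. c z = 0)"
    proof (intro allI impI ballI)
      fix c z assume eq: "(\<Sum>z\<in>S. frag_cmul (c z) z) = 0" and z: "z \<in> S"
      have "(\<Sum>z\<in>S. rat_scale (of_int (c z)) (rat_vec z)) = rat_vec (\<Sum>z\<in>S. frag_cmul (c z) z)"
        by (simp add: rat_vec_sum rat_vec_cmul)
      then show "c z = 0" using *[rule_format, of "\<lambda>z. of_int (c z)"] eq z by simp
    qed
  next
    assume *: "\<forall>c. (\<Sum>z\<in>S. frag_cmul (c z) z) = 0 \<longrightarrow> (\<forall>z\<in>S. c z = 0)"
    show "\<forall>u. (\<Sum>z\<in>S. rat_scale (u z) (rat_vec z)) = 0 \<longrightarrow> (\<forall>z\<in>S. u z = 0)"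
    proof (intro allI impI ballI)
      fix u z assume eq: "(\<Sum>z\<in>S. rat_scale (u z) (rat_vec z)) = 0" and z: "z \<in> S"
      obtain N c where N: "N \<noteq> 0" and c: "\<And>z. z \<in> S \<Longrightarrow> of_int (c z) = of_int N * u z"
        using common_denominator[OF assms] by metis
      have "rat_vec (\<Sum>z\<in>S. frag_cmul (c z) z) = (\<Sum>z\<in>S. rat_scale (of_int N * u z) (rat_vec z))"
        unfolding rat_vec_sum rat_vec_cmul by (intro sum.cong refl) (simp add: c)
      also have "\<dots> = rat_scale (of_int N) (\<Sum>z\<in>S. rat_scale (u z) (rat_vec z))"
        by (simp add: rat_fun.scale_sum_right)
      finally have "rat_vec (\<Sum>z\<in>S. frag_cmul (c z) z) = rat_vec 0" by (simp add: eq)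
      then have "(\<Sum>z\<in>S. frag_cmul (c z) z) = 0" by (rule injD[OF inj_rat_vec])
      then have "c z = 0" using * z by blast
      then have "of_int N * u z = 0" using c[OF z] by simp
      then show "u z = 0" using N by simp
    qed
  qed
  finally show ?thesis .
qed

section \<open>Dimensions of subgroups and independence modulo a subgroup\<close>

definition frag_subgroup :: "('a \<Rightarrow>\<^sub>0 int) set \<Rightarrow> bool" where
  "frag_subgroup Z \<longleftrightarrow> 0 \<in> Z \<and> (\<forall>u\<in>Z. \<forall>v\<in>Z. u - v \<in> Z)"

lemma frag_subgroup_minus: "frag_subgroup Z \<Longrightarrow> u \<in> Z \<Longrightarrow> - u \<in> Z"
  unfolding frag_subgroup_def by (metis diff_0)

lemma frag_subgroup_add: "frag_subgroup Z \<Longrightarrow> u \<in> Z \<Longrightarrow> v \<in> Z \<Longrightarrow> u + v \<in> Z"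
  using frag_subgroup_minus[of Z v] unfolding frag_subgroup_def
  by (metis diff_minus_eq_add)

lemma frag_subgroup_cmul: assumes "frag_subgroup Z" "u \<in> Z" shows "frag_cmul k u \<in> Z"
proof -
  have nat: "frag_cmul (int n) u \<in> Z" for n
    by (induction n) (use assms in \<open>auto simp: frag_cmul_distrib frag_subgroup_add frag_subgroup_def\<close>)
  show ?thesis
  proof (cases k)
    case (nonneg n)
    then show ?thesis by (simp add: nat)
  next
    case (neg n)
    then have "frag_cmul k u = - frag_cmul (int (Suc n)) u" by simp
    then show ?thesis using frag_subgroup_minus[OF assms(1) nat] by metis
  qed
qed

lemma frag_subgroup_sum:
  "frag_subgroup Z \<Longrightarrow> (\<And>x. x \<in> S \<Longrightarrow> f x \<in> Z) \<Longrightarrow> sum f S \<in> Z"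
  by (induction S rule: infinite_finite_induct)
    (auto simp: frag_subgroup_add, auto simp: frag_subgroup_def)

definition frag_rank :: "('a \<Rightarrow>\<^sub>0 int) set \<Rightarrow> nat" where
  "frag_rank Z = rat_fun.dim (rat_vec ` Z)"

text \<open>Linear independence in the quotient by \<open>B\<close>, expressed by representatives so
  that no cosets appear.\<close>

definition independent_mod :: "('a \<Rightarrow>\<^sub>0 int) set \<Rightarrow> ('a \<Rightarrow>\<^sub>0 int) set \<Rightarrow> bool" where
  "independent_mod B S \<longleftrightarrow> finite S \<and>
     (\<forall>c. (\<Sum>z\<in>S. frag_cmul (c z) z) \<in> B \<longrightarrow> (\<forall>z\<in>S. c z = 0))"

lemma rat_vec_in_span:
  assumes "finite G" "Poly_Mapping.keys z \<subseteq> G"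
  shows "rat_vec z \<in> rat_fun.span (rat_vec ` frag_of ` G)"
proof -
  have "z = (\<Sum>g\<in>Poly_Mapping.keys z. frag_cmul (Poly_Mapping.lookup z g) (frag_of g))"
    using frag_expansion[of z] by (simp add: frag_extend_def)
  then have "rat_vec z = (\<Sum>g\<in>Poly_Mapping.keys z. rat_scale (of_int (Poly_Mapping.lookup z g)) (rat_vec (frag_of g)))"
    by (metis (no_types, lifting) rat_vec_cmul rat_vec_sum sum.cong)
  also have "\<dots> \<in> rat_fun.span (rat_vec ` frag_of ` G)"
    using assms(2) by (intro rat_fun.span_sum rat_fun.span_scale rat_fun.span_base) auto
  finally show ?thesis .
qed

lemma rat_vec_image_subset_span:
  assumes "finite G" "Z \<subseteq> {z. Poly_Mapping.keys z \<subseteq> G}"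
  shows "rat_vec ` Z \<subseteq> rat_fun.span (rat_vec ` frag_of ` G)"
  using rat_vec_in_span[OF assms(1)] assms(2) by (auto simp: subset_iff image_iff)

lemma frag_basis:
  assumes "finite G" "Z \<subseteq> {z. Poly_Mapping.keys z \<subseteq> G}"
  obtains b where "b \<subseteq> Z" "finite b" "rat_fun.independent (rat_vec ` b)"
    "rat_vec ` Z \<subseteq> rat_fun.span (rat_vec ` b)" "card b = frag_rank Z"
proof -
  obtain V where V: "V \<subseteq> rat_vec ` Z" "rat_fun.independent V" "rat_vec ` Z \<subseteq> rat_fun.span V"
    "card V = rat_fun.dim (rat_vec ` Z)"
    by (rule rat_fun.basis_exists)
  have "V \<subseteq> rat_fun.span (rat_vec ` frag_of ` G)"
    by (rule order_trans[OF V(1) rat_vec_image_subset_span[OF assms]])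
  then have fin: "finite V"
    using rat_fun.independent_span_bound[of "rat_vec ` frag_of ` G" V] assms(1) V(2) by simp
  obtain b where b: "b \<subseteq> Z" "V = rat_vec ` b" using V(1) by (auto simp: subset_image_iff)
  have inj: "inj_on rat_vec b" using inj_rat_vec by (rule inj_on_subset) simp
  show thesis
    by (rule that[of b]) (use b V fin inj in \<open>auto simp: finite_image_iff card_image frag_rank_def\<close>)
qed

lemma card_le_frag_rank:
  assumes "finite G" "Z \<subseteq> {z. Poly_Mapping.keys z \<subseteq> G}"
    and "S \<subseteq> Z" "rat_fun.independent (rat_vec ` S)"
  shows "card S \<le> frag_rank Z"
proof -
  obtain b where b: "b \<subseteq> Z" "finite b" "rat_vec ` Z \<subseteq> rat_fun.span (rat_vec ` b)"
    "card b = frag_rank Z"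
    using frag_basis[OF assms(1,2)] by metis
  have "rat_vec ` S \<subseteq> rat_fun.span (rat_vec ` b)" using b assms(3) by blast
  then have "card (rat_vec ` S) \<le> card (rat_vec ` b)"
    using rat_fun.independent_span_bound[of "rat_vec ` b"] b(2) assms(4) by blast
  also have "\<dots> \<le> card b" using b(2) by (rule card_image_le)
  also have "card (rat_vec ` S) = card S"
    by (intro card_image inj_on_subset[OF inj_rat_vec]) simp
  finally show ?thesis using b by simp
qed

text \<open>Adjoining a basis of \<open>B\<close> keeps \<open>S\<close> independent: in a relation
  the part from \<open>S\<close> lies in \<open>B\<close>, so its coefficients vanish, and then
  those of the basis do.\<close>

lemma card_independent_mod:
  assumes G: "finite G" "Z \<subseteq> {z. Poly_Mapping.keys z \<subseteq> G}"
    and B: "B \<subseteq> Z" "frag_subgroup B"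
    and S: "S \<subseteq> Z" "independent_mod B S"
  shows "card S + frag_rank B \<le> frag_rank Z"
proof -
  have "B \<subseteq> {z. Poly_Mapping.keys z \<subseteq> G}" using B G by blast
  then obtain b where b: "b \<subseteq> B" "finite b" "rat_fun.independent (rat_vec ` b)" "card b = frag_rank B"
    using frag_basis[OF G(1)] by metis
  have finS: "finite S" using S by (simp add: independent_mod_def)
  have disj: "S \<inter> b = {}"
  proof -
    have False if "z \<in> S" "z \<in> B" for z
    proof -
      \<comment> \<open>With indicator coefficients an element \<open>z\<close> common to
        \<open>S\<close> and \<open>B\<close> is a combination in \<open>B\<close> with a nonzero
        coefficient.\<close>
      have "(\<Sum>w\<in>S. frag_cmul (if w = z then 1 else 0) w) = (\<Sum>w\<in>{z}. w)"
        using finS that by (intro sum.mono_neutral_cong_right) auto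
      then have "(if z = z then 1 else 0 :: int) = 0"
        using S(2) that unfolding independent_mod_def
        by (elim conjE allE[of _ "\<lambda>w. if w = z then 1 else 0"]) auto
      then show False by simp
    qed
    then show ?thesis using b(1) by blast
  qed
  have "rat_fun.independent (rat_vec ` (S \<union> b))"
    unfolding independent_rat_vec_iff[OF finite_UnI[OF finS b(2)]]
  proof (intro allI impI)
    fix c assume "(\<Sum>z\<in>S \<union> b. frag_cmul (c z) z) = 0"
    then have 0: "(\<Sum>z\<in>S. frag_cmul (c z) z) + (\<Sum>z\<in>b. frag_cmul (c z) z) = 0"
      using sum.union_disjoint[OF finS b(2) disj] by metis
    then have "(\<Sum>z\<in>S. frag_cmul (c z) z) = - (\<Sum>z\<in>b. frag_cmul (c z) z)"
      by (simp add: eq_neg_iff_add_eq_0)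
    also have "\<dots> \<in> B"
      using b(1) by (intro frag_subgroup_minus frag_subgroup_sum frag_subgroup_cmul B(2)) auto
    finally have c: "\<forall>z\<in>S. c z = 0" using S(2) by (simp add: independent_mod_def)
    then have "(\<Sum>z\<in>b. frag_cmul (c z) z) = 0" using 0 by simp
    then have "\<forall>z\<in>b. c z = 0" using b(3) by (simp add: independent_rat_vec_iff[OF b(2)])
    with c show "\<forall>z\<in>S \<union> b. c z = 0" by blast
  qed
  moreover have "S \<union> b \<subseteq> Z" using S(1) b(1) B(1) by blast
  ultimately have "card (S \<union> b) \<le> frag_rank Z"
    by (intro card_le_frag_rank[OF G])
  then show ?thesis using b(4) by (simp add: card_Un_disjoint[OF finS b(2) disj])
qed

text \<open>A basis of \<open>B\<close> is extended to a basis of \<open>Z\<close>; the added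
  vectors form the required set.\<close>

lemma independent_mod_exists:
  assumes G: "finite G" "Z \<subseteq> {z. Poly_Mapping.keys z \<subseteq> G}" and B: "B \<subseteq> Z"
  obtains S where "S \<subseteq> Z" "independent_mod B S" "card S + frag_rank B = frag_rank Z"
proof -
  have "B \<subseteq> {z. Poly_Mapping.keys z \<subseteq> G}" using B G by blast
  then obtain b where b: "b \<subseteq> B" "finite b" "rat_fun.independent (rat_vec ` b)"
    "rat_vec ` B \<subseteq> rat_fun.span (rat_vec ` b)" "card b = frag_rank B"
    using frag_basis[OF G(1)] by metis
  have "rat_vec ` b \<subseteq> rat_vec ` Z" using b(1) B by blast
  then obtain V where V: "rat_vec ` b \<subseteq> V" "V \<subseteq> rat_vec ` Z" "rat_fun.independent V"
    "rat_vec ` Z \<subseteq> rat_fun.span V"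
    using rat_fun.maximal_independent_subset_extend[OF _ b(3)] by metis
  then obtain b' where b': "b' \<subseteq> Z" "V = rat_vec ` b'" by (auto simp: subset_image_iff)
  have inj: "inj_on rat_vec X" for X using inj_rat_vec by (rule inj_on_subset) simp
  have bb': "b \<subseteq> b'" using V(1) b'(2) inj_image_subset_iff[OF inj_rat_vec] by blast
  have "V \<subseteq> rat_fun.span (rat_vec ` frag_of ` G)"
    by (rule order_trans[OF V(2) rat_vec_image_subset_span[OF G]])
  then have finV: "finite V"
    using rat_fun.independent_span_bound[of "rat_vec ` frag_of ` G" V] G(1) V(3) by simp
  then have fin: "finite b'" using b'(2) by (simp add: finite_image_iff[OF inj])
  have card: "card b' = frag_rank Z"
    using rat_fun.basis_card_eq_dim[OF V(2,4,3)] b'(2) by (simp add: frag_rank_def card_image[OF inj])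
  have "independent_mod B (b' - b)"
    unfolding independent_mod_def
  proof (intro conjI allI impI ballI)
    fix c z assume "(\<Sum>z\<in>b' - b. frag_cmul (c z) z) \<in> B" and z: "z \<in> b' - b"
    then have "rat_vec (\<Sum>z\<in>b' - b. frag_cmul (c z) z) \<in> rat_fun.span (rat_vec ` b)"
      using b(4) by blast
    then obtain u where u: "rat_vec (\<Sum>z\<in>b' - b. frag_cmul (c z) z) = (\<Sum>v\<in>rat_vec ` b. rat_scale (u v) v)"
      using rat_fun.span_finite[of "rat_vec ` b"] b(2) by auto
    \<comment> \<open>A combination of added vectors that lies in the span of \<open>b\<close> is
      rewritten as a relation in the basis \<open>V\<close>: its coordinates on \<open>b\<close>
      enter negatively.\<close>
    let ?c = "\<lambda>v. if v \<in> rat_vec ` b then - u v else of_int (c (inv_into UNIV rat_vec v))"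
    have "(\<Sum>v\<in>rat_vec ` (b' - b). rat_scale (?c v) v) = (\<Sum>z\<in>b' - b. rat_scale (?c (rat_vec z)) (rat_vec z))"
      by (simp add: sum.reindex[OF inj])
    also have "\<dots> = (\<Sum>z\<in>b' - b. rat_scale (of_int (c z)) (rat_vec z))"
      by (intro sum.cong refl) (auto simp: inv_f_f[OF inj_rat_vec] dest: injD[OF inj_rat_vec])
    also have "\<dots> = rat_vec (\<Sum>z\<in>b' - b. frag_cmul (c z) z)"
      by (simp add: rat_vec_sum rat_vec_cmul)
    finally have 1: "(\<Sum>v\<in>rat_vec ` (b' - b). rat_scale (?c v) v) = (\<Sum>v\<in>rat_vec ` b. rat_scale (u v) v)"
      using u by simp
    have 2: "(\<Sum>v\<in>rat_vec ` b. rat_scale (?c v) v) = - (\<Sum>v\<in>rat_vec ` b. rat_scale (u v) v)"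
      by (simp add: sum_negf rat_fun.scale_minus_left)
    have "rat_vec ` (b' - b) = V - rat_vec ` b"
      using b'(2) by (simp add: image_set_diff[OF inj_rat_vec])
    then have "(\<Sum>v\<in>V. rat_scale (?c v) v) =
        (\<Sum>v\<in>rat_vec ` (b' - b). rat_scale (?c v) v) + (\<Sum>v\<in>rat_vec ` b. rat_scale (?c v) v)"
      using sum.subset_diff[OF V(1) finV, of "\<lambda>v. rat_scale (?c v) v"] by (simp only:)
    then have "(\<Sum>v\<in>V. rat_scale (?c v) v) = 0" by (simp only: 1 2 add.right_inverse)
    then have "?c (rat_vec z) = 0"
      using rat_fun.independentD[OF V(3) finV subset_refl, of ?c] z b'(2) by blast
    moreover have "rat_vec z \<notin> rat_vec ` b" using z by (auto dest: injD[OF inj_rat_vec])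
    ultimately show "c z = 0" by (simp add: inv_f_f[OF inj_rat_vec])
  qed (use fin in simp)
  moreover have "card (b' - b) + frag_rank B = frag_rank Z"
    using card_Diff_subset[OF b(2) bb'] card_mono[OF fin bb'] card b(5) by simp
  ultimately show thesis using that b'(1) by blast
qed

lemma frag_rank_free:
  assumes "finite G"
  shows "frag_rank {z. Poly_Mapping.keys z \<subseteq> G} = card G"
proof -
  let ?b = "frag_of ` G :: ('a \<Rightarrow>\<^sub>0 int) set"
  have inj: "inj_on rat_vec X" for X :: "('a \<Rightarrow>\<^sub>0 int) set"
    using inj_rat_vec by (rule inj_on_subset) simp
  have inj': "inj_on frag_of G" by (rule inj_onI) (simp add: frag_of_eq)
  have "rat_fun.independent (rat_vec ` ?b)"
    unfolding independent_rat_vec_iff[OF finite_imageI[OF assms]]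
  proof (intro allI impI ballI)
    fix c :: "('a \<Rightarrow>\<^sub>0 int) \<Rightarrow> int" and z
    assume 0: "(\<Sum>z\<in>?b. frag_cmul (c z) z) = 0" and "z \<in> ?b"
    then obtain g where g: "g \<in> G" "z = frag_of g" by blast
    have "Poly_Mapping.lookup (\<Sum>z\<in>?b. frag_cmul (c z) z) g =
        (\<Sum>h\<in>G. c (frag_of h) * (if g = h then 1 else 0))"
      by (simp add: sum.reindex[OF inj'] lookup_sum)
    also have "\<dots> = (\<Sum>h\<in>G. if g = h then c (frag_of h) else 0)" by (intro sum.cong) auto
    also have "\<dots> = c (frag_of g)" using g(1) sum.delta'[OF assms, of g "\<lambda>h. c (frag_of h)"] by simp
    finally show "c z = 0" using 0 g by simp
  qed
  moreover have "rat_vec ` ?b \<subseteq> rat_vec ` {z. Poly_Mapping.keys z \<subseteq> G}" by auto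
  moreover have "rat_vec ` {z. Poly_Mapping.keys z \<subseteq> G} \<subseteq> rat_fun.span (rat_vec ` ?b)"
    by (rule rat_vec_image_subset_span[OF assms subset_refl])
  ultimately have "card (rat_vec ` ?b) = frag_rank {z. Poly_Mapping.keys z \<subseteq> G}"
    unfolding frag_rank_def by (intro rat_fun.basis_card_eq_dim)
  then show ?thesis by (simp add: card_image[OF inj] card_image[OF inj'])
qed

lemma frag_rank_0: "frag_rank {0} = 0"
  using frag_rank_free[of "{}"] by simp

section \<open>Ranks of quotients, kernels and homology groups\<close>

lemma finprod_additive:
  assumes Q: "comm_group Q" and Z: "frag_subgroup Z"
    and \<phi>: "\<And>z. z \<in> Z \<Longrightarrow> \<phi> z \<in> carrier Q"
      "\<And>u v. u \<in> Z \<Longrightarrow> v \<in> Z \<Longrightarrow> \<phi> (u + v) = \<phi> u \<otimes>\<^bsub>Q\<^esub> \<phi> v"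
    and S: "finite S" "S \<subseteq> Z"
  shows "finprod Q (\<lambda>z. \<phi> z [^]\<^bsub>Q\<^esub> (e z :: int)) S = \<phi> (\<Sum>z\<in>S. frag_cmul (e z) z)"
proof -
  interpret Q: comm_group Q by (rule Q)
  have zero: "\<phi> 0 = \<one>\<^bsub>Q\<^esub>"
    using \<phi>(1)[of 0] \<phi>(2)[of 0 0] Z Q.l_cancel_one[of "\<phi> 0" "\<phi> 0"] by (simp add: frag_subgroup_def)
  have nat: "\<phi> (frag_cmul (int n) z) = \<phi> z [^]\<^bsub>Q\<^esub> n" if "z \<in> Z" for n z
  proof (induction n)
    case (Suc n)
    have "frag_cmul (int (Suc n)) z = frag_cmul (int n) z + z"
      using frag_cmul_distrib[of "int n" 1 z] by (simp add: add.commute)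
    then show ?case using Suc that by (simp add: \<phi> frag_subgroup_cmul[OF Z])
  qed (simp add: zero)
  have minus: "\<phi> (- z) = inv\<^bsub>Q\<^esub> \<phi> z" if "z \<in> Z" for z
  proof (rule Q.inv_equality[symmetric])
    show "\<phi> (- z) \<otimes>\<^bsub>Q\<^esub> \<phi> z = \<one>\<^bsub>Q\<^esub>"
      using \<phi>(2)[of "- z" z] that frag_subgroup_minus[OF Z that] zero by simp
  qed (use that frag_subgroup_minus[OF Z that] \<phi> in auto)
  have pow: "\<phi> z [^]\<^bsub>Q\<^esub> k = \<phi> (frag_cmul k z)" if "z \<in> Z" for z and k :: int
  proof (cases k)
    case (nonneg n)
    then show ?thesis by (simp add: nat that int_pow_int)
  next
    case (neg n)
    have "frag_cmul k z = - frag_cmul (int (Suc n)) z" using neg by simp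
    then have "\<phi> (frag_cmul k z) = inv\<^bsub>Q\<^esub> (\<phi> z [^]\<^bsub>Q\<^esub> Suc n)"
      by (simp only: minus frag_subgroup_cmul[OF Z that] nat[OF that])
    also have "\<dots> = \<phi> z [^]\<^bsub>Q\<^esub> k"
      using that \<phi>(1) unfolding neg by (simp only: Q.int_pow_neg int_pow_int)
    finally show ?thesis by simp
  qed
  show ?thesis
    using S
  proof (induction S)
    case (insert z S)
    then have "finprod Q (\<lambda>z. \<phi> z [^]\<^bsub>Q\<^esub> (e z)) (insert z S) =
        \<phi> (frag_cmul (e z) z) \<otimes>\<^bsub>Q\<^esub> \<phi> (\<Sum>z\<in>S. frag_cmul (e z) z)"
      using \<phi>(1) by (subst Q.finprod_insert) (auto simp: pow Pi_iff subset_iff frag_subgroup_cmul[OF Z])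
    also have "\<dots> = \<phi> (\<Sum>z\<in>insert z S. frag_cmul (e z) z)"
      using insert \<phi>(2)[of "frag_cmul (e z) z" "\<Sum>z\<in>S. frag_cmul (e z) z"]
      by (simp add: frag_subgroup_cmul[OF Z] frag_subgroup_sum[OF Z] subset_iff)
    finally show ?case .
  qed (simp add: zero)
qed

text \<open>\<open>Q\<close> is the quotient of \<open>Z\<close> by \<open>B\<close>. Independent
  subsets of \<open>Q\<close> lift to sets independent modulo \<open>B\<close>, and these map
  injectively to independent subsets, so both have the same possible sizes.\<close>

lemma ab_rank_epi:
  assumes Q: "comm_group Q" and Z: "frag_subgroup Z" and B: "frag_subgroup B" "B \<subseteq> Z"
    and G: "finite G" "Z \<subseteq> {z. Poly_Mapping.keys z \<subseteq> G}"
    and \<phi>: "\<phi> ` Z = carrier Q"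
      "\<And>u v. u \<in> Z \<Longrightarrow> v \<in> Z \<Longrightarrow> \<phi> (u + v) = \<phi> u \<otimes>\<^bsub>Q\<^esub> \<phi> v"
      "\<And>z. z \<in> Z \<Longrightarrow> \<phi> z = \<one>\<^bsub>Q\<^esub> \<longleftrightarrow> z \<in> B"
  shows "ab_rank Q + frag_rank B = frag_rank Z"
proof -
  interpret Q: comm_group Q by (rule Q)
  have \<phi>': "\<phi> z \<in> carrier Q" if "z \<in> Z" for z using \<phi>(1) that by blast
  have prod: "finprod Q (\<lambda>z. \<phi> z [^]\<^bsub>Q\<^esub> (e z :: int)) S = \<one>\<^bsub>Q\<^esub> \<longleftrightarrow>
      (\<Sum>z\<in>S. frag_cmul (e z) z) \<in> B" if "finite S" "S \<subseteq> Z" for e S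
  proof -
    have "(\<Sum>z\<in>S. frag_cmul (e z) z) \<in> Z"
      using that(2) by (intro frag_subgroup_sum[OF Z] frag_subgroup_cmul[OF Z]) auto
    then show ?thesis
      using \<phi>(3) by (simp add: finprod_additive[OF Q Z \<phi>' \<phi>(2) that])
  qed
  have down: "\<exists>T\<subseteq>Z. independent_mod B T \<and> card T = card S" if S: "int_independent Q S" for S
  proof -
    from S have S': "S \<subseteq> \<phi> ` Z" "finite S" by (auto simp: int_independent_def \<phi>(1))
    then obtain T where T: "T \<subseteq> Z" "\<phi> ` T = S" "inj_on \<phi> T"
      unfolding subset_image_inj by blast
    have fin: "finite T" using S'(2) finite_image_iff[OF T(3)] T(2) by simp
    have "independent_mod B T"
      unfolding independent_mod_def
    proof (intro conjI fin allI impI ballI)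
      fix c z assume "(\<Sum>z\<in>T. frag_cmul (c z) z) \<in> B" and z: "z \<in> T"
      then have "finprod Q (\<lambda>z. \<phi> z [^]\<^bsub>Q\<^esub> c z) T = \<one>\<^bsub>Q\<^esub>"
        using prod[OF fin T(1)] by simp
      also have "finprod Q (\<lambda>z. \<phi> z [^]\<^bsub>Q\<^esub> c z) T =
          finprod Q (\<lambda>z. \<phi> z [^]\<^bsub>Q\<^esub> c (inv_into T \<phi> (\<phi> z))) T"
        using T \<phi>' by (intro Q.finprod_cong' refl) (auto simp: inv_into_f_f)
      also have "\<dots> = finprod Q (\<lambda>x. x [^]\<^bsub>Q\<^esub> c (inv_into T \<phi> x)) (\<phi> ` T)"
        by (rule Q.finprod_reindex[symmetric, OF _ T(3)]) (use T(1) \<phi>' in auto)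
      also have "\<phi> ` T = S" by (rule T(2))
      finally have "\<forall>x\<in>S. c (inv_into T \<phi> x) = 0"
        by (rule S[unfolded int_independent_def, THEN conjunct2, THEN conjunct2, rule_format, THEN ballI])
      moreover have "\<phi> z \<in> S" using z T(2) by auto
      ultimately show "c z = 0" using z T(3) by (auto simp: inv_into_f_f)
    qed
    moreover have "card T = card S" using T(2) card_image[OF T(3)] by simp
    ultimately show ?thesis using T(1) by blast
  qed
  have up: "int_independent Q (\<phi> ` T) \<and> card (\<phi> ` T) = card T" if T: "T \<subseteq> Z" "independent_mod B T" for T
  proof -
    have fin: "finite T" using T(2) by (simp add: independent_mod_def)
    have inj: "inj_on \<phi> T"
    proof (rule inj_onI, rule ccontr)
      fix u v assume uv: "u \<in> T" "v \<in> T" "\<phi> u = \<phi> v" "u \<noteq> v"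
      \<comment> \<open>If two elements had the same image, \<open>u - v\<close> would be a
        nontrivial combination in \<open>B\<close>.\<close>
      define c :: "_ \<Rightarrow> int" where "c w = (if w = u then 1 else if w = v then - 1 else 0)" for w
      have "(\<Sum>w\<in>T. frag_cmul (c w) w) = (\<Sum>w\<in>{u, v}. frag_cmul (c w) w)"
        using uv fin by (intro sum.mono_neutral_right) (auto simp: c_def)
      also have "\<dots> = u - v" using uv(4) by (simp add: c_def)
      finally have sum: "(\<Sum>w\<in>T. frag_cmul (c w) w) = u - v" .
      have mem: "u \<in> Z" "v \<in> Z" "u - v \<in> Z" using uv T(1) Z by (auto simp: frag_subgroup_def)
      have "\<phi> (u - v) \<otimes>\<^bsub>Q\<^esub> \<phi> v = \<phi> v" using \<phi>(2)[of "u - v" v] mem uv(3) by simp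
      then have "\<phi> (u - v) = \<one>\<^bsub>Q\<^esub>" using mem \<phi>' by (metis Q.r_cancel_one)
      then have "u - v \<in> B" using \<phi>(3) mem by simp
      then have "c u = 0" using T(2) uv(1) sum by (simp add: independent_mod_def)
      then show False by (simp add: c_def)
    qed
    have "int_independent Q (\<phi> ` T)"
      unfolding int_independent_def
    proof (intro conjI allI impI ballI)
      fix c :: "_ \<Rightarrow> int" and x
      assume 1: "finprod Q (\<lambda>x. x [^]\<^bsub>Q\<^esub> c x) (\<phi> ` T) = \<one>\<^bsub>Q\<^esub>" and x: "x \<in> \<phi> ` T"
      have "finprod Q (\<lambda>x. x [^]\<^bsub>Q\<^esub> c x) (\<phi> ` T) = finprod Q (\<lambda>z. \<phi> z [^]\<^bsub>Q\<^esub> c (\<phi> z)) T"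
        by (rule Q.finprod_reindex[OF _ inj]) (use T(1) \<phi>' in auto)
      then have "(\<Sum>z\<in>T. frag_cmul (c (\<phi> z)) z) \<in> B" using prod[OF fin T(1), of "\<lambda>z. c (\<phi> z)"] 1 by metis
      then show "c x = 0" using T(2) x by (auto simp: independent_mod_def)
    qed (use T(1) \<phi>' fin in auto)
    then show ?thesis using card_image[OF inj] by simp
  qed
  obtain T where T: "T \<subseteq> Z" "independent_mod B T" "card T + frag_rank B = frag_rank Z"
    using independent_mod_exists[OF G B(2)] .
  have "ab_rank Q = card T"
    unfolding ab_rank_def
  \<comment> \<open>The supremum is attained: \<open>up\<close> realises the size of
    \<open>T\<close>, and \<open>down\<close> with \<open>card_independent_mod\<close> bounds all
    others.\<close>
  proof (rule cSup_eq_maximum)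
    show "card T \<in> {card S |S. int_independent Q S}" using up[OF T(1,2)] by force
  next
    fix k assume "k \<in> {card S |S. int_independent Q S}"
    then obtain S where S: "k = card S" "int_independent Q S" by blast
    then obtain T' where "T' \<subseteq> Z" "independent_mod B T'" "card T' = k" using down[OF S(2)] by blast
    then show "k \<le> card T"
      using card_independent_mod[OF G B(2,1), of T'] T(3) by simp
  qed
  then show ?thesis using T(3) by simp
qed

lemma frag_subgroup_carrier: "frag_subgroup {z. Poly_Mapping.keys z \<subseteq> G}"
  using keys_diff by (fastforce simp: frag_subgroup_def)

lemma carrier_free_Abelian_group: "carrier (free_Abelian_group G) = {z. Poly_Mapping.keys z \<subseteq> G}"
  by auto

lemma frag_subgroup_image:
  assumes "f \<in> hom (free_Abelian_group G) (free_Abelian_group H)"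
  shows "frag_subgroup (f ` carrier (free_Abelian_group G))"
  unfolding frag_subgroup_def
proof (intro conjI ballI)
  have "f 0 = f 0 - f 0" using hom_frag_diff[OF assms, of 0 0] by simp
  then have "f 0 = 0" by simp
  then show "0 \<in> f ` carrier (free_Abelian_group G)" by (force simp: image_iff)
next
  fix u v assume "u \<in> f ` carrier (free_Abelian_group G)" "v \<in> f ` carrier (free_Abelian_group G)"
  then obtain c d where cd: "Poly_Mapping.keys c \<subseteq> G" "Poly_Mapping.keys d \<subseteq> G" "u = f c" "v = f d"
    by auto
  then have "u - v = f (c - d)" by (simp add: hom_frag_diff[OF assms])
  moreover have "Poly_Mapping.keys (c - d) \<subseteq> G" using cd(1,2) keys_diff[of c d] by blast
  ultimately show "u - v \<in> f ` carrier (free_Abelian_group G)" by auto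
qed

text \<open>The image group is presented twice: through \<open>g\<close> as a quotient by
  \<open>K\<close>, and through the identity as a quotient by 0. Comparing its two ranks gives rank
  and nullity.\<close>

lemma frag_rank_kernel_image:
  assumes g: "g \<in> hom (free_Abelian_group G) (free_Abelian_group H)" and fin: "finite G" "finite H"
  defines "K \<equiv> kernel (free_Abelian_group G) (free_Abelian_group H) g"
  shows "frag_rank K + frag_rank (g ` carrier (free_Abelian_group G)) = card G"
proof -
  let ?Z = "carrier (free_Abelian_group G)" and ?Y = "g ` carrier (free_Abelian_group G)"
  let ?Q = "subgroup_generated (free_Abelian_group H) ?Y"
  interpret h: group_hom "free_Abelian_group G" "free_Abelian_group H" g
    by (simp add: group_hom_def group_hom_axioms_def g)
  have sub: "subgroup ?Y (free_Abelian_group H)" by (rule h.img_is_subgroup)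
  then have carrier: "carrier ?Q = ?Y" by (rule subgroup.carrier_subgroup_generated_subgroup)
  have Q: "comm_group ?Q"
    by (rule group.abelian_subgroup_generated[OF group_free_Abelian_group abelian_free_Abelian_group])
  have Y: "?Y \<subseteq> {z. Poly_Mapping.keys z \<subseteq> H}"
    using subgroup.subset[OF sub] by (simp add: carrier_free_Abelian_group)
  have Z: "frag_subgroup ?Z" "?Z \<subseteq> {z. Poly_Mapping.keys z \<subseteq> G}"
    unfolding carrier_free_Abelian_group by (simp_all add: frag_subgroup_carrier)
  have K: "frag_subgroup K"
    unfolding frag_subgroup_def K_def kernel_def
    using hom_frag_diff[OF g] keys_diff Z(1) h.hom_one by (fastforce simp: frag_subgroup_def)
  have "ab_rank ?Q + frag_rank K = frag_rank ?Z"
    by (rule ab_rank_epi[OF Q Z(1) K _ fin(1) Z(2), of g])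
      (auto simp: carrier K_def kernel_def hom_frag_add[OF g])
  moreover have "ab_rank ?Q + frag_rank {0 :: 'b \<Rightarrow>\<^sub>0 int} = frag_rank ?Y"
    by (rule ab_rank_epi[OF Q frag_subgroup_image[OF g] _ _ fin(2) Y, of _ "\<lambda>z. z"])
      (use frag_subgroup_image[OF g] carrier in \<open>auto simp: frag_subgroup_def\<close>)
  ultimately show ?thesis
    by (simp add: frag_rank_0 carrier_free_Abelian_group frag_rank_free[OF fin(1)])
qed

text \<open>\<open>gf\<close> puts the image of \<open>f\<close> inside \<open>K\<close>, and
  passing to the quotient subtracts its rank. The rank of \<open>K\<close> itself is then eliminated
  by rank and nullity for \<open>g\<close>.\<close>

lemma ab_rank_homology:
  fixes f :: "('a \<Rightarrow>\<^sub>0 int) \<Rightarrow> ('b \<Rightarrow>\<^sub>0 int)" and g :: "('b \<Rightarrow>\<^sub>0 int) \<Rightarrow> ('c \<Rightarrow>\<^sub>0 int)"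
  assumes f: "f \<in> hom (free_Abelian_group F) (free_Abelian_group G)"
    and g: "g \<in> hom (free_Abelian_group G) (free_Abelian_group H)"
    and fin: "finite G" "finite H"
    and gf: "\<And>c. c \<in> carrier (free_Abelian_group F) \<Longrightarrow> g (f c) = 0"
  defines "K \<equiv> kernel (free_Abelian_group G) (free_Abelian_group H) g"
  shows "ab_rank (subgroup_generated (free_Abelian_group G) K Mod f ` carrier (free_Abelian_group F))
    + frag_rank (f ` carrier (free_Abelian_group F))
    + frag_rank (g ` carrier (free_Abelian_group G)) = card G"
proof -
  let ?B = "f ` carrier (free_Abelian_group F)" and ?Z = "subgroup_generated (free_Abelian_group G) K"
  interpret h: group_hom "free_Abelian_group G" "free_Abelian_group H" g
    by (simp add: group_hom_def group_hom_axioms_def g)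
  interpret f: group_hom "free_Abelian_group F" "free_Abelian_group G" f
    by (simp add: group_hom_def group_hom_axioms_def f)
  have K_sub: "subgroup K (free_Abelian_group G)" unfolding K_def by (rule h.subgroup_kernel)
  then have carrier: "carrier ?Z = K" by (rule subgroup.carrier_subgroup_generated_subgroup)
  interpret Z: comm_group ?Z
    by (rule group.abelian_subgroup_generated[OF group_free_Abelian_group abelian_free_Abelian_group])
  have B_sub: "subgroup ?B (free_Abelian_group G)" by (rule f.img_is_subgroup)
  have BK: "?B \<subseteq> K" using gf f.hom_closed by (auto simp: K_def kernel_def simp del: carrier_free_Abelian_group_iff)
  then have B_Z: "subgroup ?B ?Z"
    using B_sub by (simp add: group.subgroup_subgroup_generated_iff carrier)
  have normal: "?B \<lhd> ?Z" by (rule Z.subgroup_imp_normal[OF B_Z])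
  have Q: "comm_group (?Z Mod ?B)" by (rule Z.abelian_FactGroup[OF B_Z])
  have K: "frag_subgroup K"
    unfolding frag_subgroup_def
  proof (intro conjI ballI)
    show "0 \<in> K" using subgroup.one_closed[OF K_sub] by simp
    fix u v assume uv: "u \<in> K" "v \<in> K"
    then have keys: "Poly_Mapping.keys u \<subseteq> G" "Poly_Mapping.keys v \<subseteq> G"
      using uv[THEN subsetD[OF subgroup.subset[OF K_sub]]] by simp_all
    have "u + inv\<^bsub>free_Abelian_group G\<^esub> v \<in> K"
      using subgroup.m_closed[OF K_sub uv(1) subgroup.m_inv_closed[OF K_sub uv(2)]] by simp
    then show "u - v \<in> K" using keys by simp
  qed
  have K_keys: "K \<subseteq> {z. Poly_Mapping.keys z \<subseteq> G}"
    using subgroup.subset[OF K_sub] by (simp add: carrier_free_Abelian_group)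
  have "ab_rank (?Z Mod ?B) + frag_rank ?B = frag_rank K"
  proof (rule ab_rank_epi[OF Q K frag_subgroup_image[OF f] BK fin(1) K_keys])
    show "(\<lambda>z. ?B #>\<^bsub>?Z\<^esub> z) ` K = carrier (?Z Mod ?B)"
      by (simp add: carrier_FactGroup carrier)
    show "?B #>\<^bsub>?Z\<^esub> (u + v) = (?B #>\<^bsub>?Z\<^esub> u) \<otimes>\<^bsub>?Z Mod ?B\<^esub> (?B #>\<^bsub>?Z\<^esub> v)"
      if "u \<in> K" "v \<in> K" for u v
      using hom_mult[OF normal.r_coset_hom_Mod[OF normal], of u v] that carrier by simp
    show "?B #>\<^bsub>?Z\<^esub> z = \<one>\<^bsub>?Z Mod ?B\<^esub> \<longleftrightarrow> z \<in> ?B" if "z \<in> K" for z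
      using Z.coset_join1[OF _ _ B_Z, of z] Z.coset_join2[OF _ B_Z, of z] that carrier BK
      by auto
  qed
  then show ?thesis
    using frag_rank_kernel_image[OF g fin] by (simp add: K_def)
qed

section \<open>The Euler characteristic\<close>

text \<open>\<open>r m\<close> plays the rank of the differential leaving degree \<open>m\<close>;
  it is counted in degrees \<open>m\<close> and \<open>m + 1\<close>, with opposite signs.\<close>

lemma alternating_telescope:
  fixes r :: "int \<Rightarrow> nat"
  assumes "\<And>m. N \<le> \<bar>m\<bar> \<Longrightarrow> r m = 0"
  shows "(\<Sum>m\<in>{- N..N}. (- 1) ^ nat \<bar>m\<bar> * of_nat (r m + r (m - 1))) = (0 :: laurent)"
proof -
  let ?t = "\<lambda>m. (- 1) ^ nat \<bar>m\<bar> * of_nat (r m) :: laurent"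
  have sgn: "(- 1 :: laurent) ^ nat \<bar>m\<bar> = - ((- 1) ^ nat \<bar>m - 1\<bar>)" for m :: int
  proof -
    have "even (nat \<bar>m\<bar>) \<longleftrightarrow> \<not> even (nat \<bar>m - 1\<bar>)" by (simp add: even_nat_iff)
    then show ?thesis by (simp add: minus_one_power_iff)
  qed
  have "(\<Sum>m\<in>{- N..N}. (- 1) ^ nat \<bar>m\<bar> * of_nat (r m + r (m - 1))) =
      (\<Sum>m\<in>{- N..N}. ?t m) - (\<Sum>m\<in>{- N..N}. ?t (m - 1))"
    unfolding sum_subtractf[symmetric]
  proof (rule sum.cong[OF refl])
    fix m show "(- 1) ^ nat \<bar>m\<bar> * of_nat (r m + r (m - 1)) = ?t m - ?t (m - 1)"
      using sgn[of m] by (simp add: distrib_left)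
  qed
  also have "(\<Sum>m\<in>{- N..N}. ?t (m - 1)) = (\<Sum>m\<in>{- N - 1..N - 1}. ?t m)"
    by (rule sum.reindex_bij_witness[of _ "\<lambda>m. m + 1" "\<lambda>m. m - 1"]) auto
  \<comment> \<open>The two ranges differ only in \<open>- N - 1\<close> and \<open>N\<close>, where
    \<open>r\<close> vanishes.\<close>
  also have "\<dots> = (\<Sum>m\<in>{- N..N}. ?t m)"
    by (rule sum.mono_neutral_cong) (use assms in auto)
  finally show ?thesis by simp
qed

lemma (in link_diagram) card_bigenerators:
  assumes "edge_assignment_X D arr \<epsilon> \<or> edge_assignment_Y D arr \<epsilon>"
  defines "r \<equiv> \<lambda>m s. frag_rank (differential D arr \<epsilon> ` carrier (chain_group D pos m s))"
  shows "ab_rank (odd_khovanov D pos arr \<epsilon> m s) + (r m s + r (m - 1) s) = card (bigenerators D pos m s)"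
proof -
  let ?d = "differential D arr \<epsilon>"
  have fin: "finite (bigenerators D pos k s)" for k
    by (rule finite_subset[OF _ finite_generators]) (auto simp: bigenerators_def)
  have d: "?d \<in> hom (free_Abelian_group (bigenerators D pos (m - 1) s)) (free_Abelian_group (bigenerators D pos m s))"
    using differential_hom[of arr \<epsilon> "m - 1" s] by (simp add: chain_group_eq)
  have d': "?d \<in> hom (free_Abelian_group (bigenerators D pos m s)) (free_Abelian_group (bigenerators D pos (m + 1) s))"
    using differential_hom[of arr \<epsilon> m s] by (simp add: chain_group_eq)
  have "?d (?d c) = 0" if "c \<in> carrier (free_Abelian_group (bigenerators D pos (m - 1) s))" for c
  proof (rule differential_differential[OF assms(1)])
    show "Poly_Mapping.keys c \<subseteq> generators D" using that by (auto simp: bigenerators_def)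
  qed
  from ab_rank_homology[OF d d' fin fin this] show ?thesis
    by (simp add: odd_khovanov_def r_def chain_group_eq)
qed

theorem proposition1p4:
  fixes D :: diagram
    and pos arr :: "nat \<Rightarrow> bool"
    and \<epsilon> :: "nat set \<times> nat \<Rightarrow> int"
  assumes "oriented_diagram D pos" and "planar D"
    and "edge_assignment_X D arr \<epsilon> \<or> edge_assignment_Y D arr \<epsilon>"
  shows "unnormalized_jones D pos =
    Sum_any (\<lambda>(m, s). (- 1) ^ nat \<bar>m\<bar> * of_nat (ab_rank (odd_khovanov D pos arr \<epsilon> m s)) * qpow s)"
proof -
  interpret link_diagram D pos by unfold_locales (rule assms(1))
  let ?deg = "\<lambda>g. (homological_degree D pos g, q_degree D pos g)"
  let ?h = "\<lambda>m s. ab_rank (odd_khovanov D pos arr \<epsilon> m s)"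
  let ?b = "\<lambda>m s. card (bigenerators D pos m s)"
  define r where "r m s = frag_rank (differential D arr \<epsilon> ` carrier (chain_group D pos m s))" for m s
  have rank: "?h m s + (r m s + r (m - 1) s) = ?b m s" for m s
    unfolding r_def by (rule card_bigenerators[OF assms(3)])
  \<comment> \<open>The additional 1 keeps the degrees \<open>- N\<close> and \<open>N\<close> free
    of generators, as the telescoping sum requires at its boundary.\<close>
  define N where "N = Max ((\<lambda>g. \<bar>homological_degree D pos g\<bar>) ` generators D) + 1"
  have N: "\<bar>homological_degree D pos g\<bar> < N" if "g \<in> generators D" for g
    using finite_generators that by (simp add: N_def)
  define T where "T = q_degree D pos ` generators D"
  have T: "finite T" using finite_generators by (simp add: T_def)
  have box: "?deg ` generators D \<subseteq> {- N..N} \<times> T"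
    using N by (force simp: T_def)
  have empty: "?b m s = 0" if "N \<le> \<bar>m\<bar> \<or> s \<notin> T" for m s
  proof -
    have "bigenerators D pos m s = {}"
      using that N by (force simp: bigenerators_def T_def)
    then show ?thesis by simp
  qed
  \<comment> \<open>Ranks are natural numbers, so in an empty bidegree every summand of
    \<open>rank\<close> is 0.\<close>
  have r0: "r m s = 0" if "N \<le> \<bar>m\<bar>" for m s
    using rank[of m s] empty[of m s] that by simp
  have h0: "?h m s = 0" if "(m, s) \<notin> {- N..N} \<times> T" for m s
  proof -
    have "N \<le> \<bar>m\<bar> \<or> s \<notin> T" using that by auto
    from empty[OF this] show ?thesis using rank[of m s] by simp
  qed
  have "unnormalized_jones D pos = (\<Sum>g\<in>generators D.
      (- 1) ^ nat \<bar>homological_degree D pos g\<bar> * qpow (q_degree D pos g))"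
    by (rule unnormalized_jones_generators) simp
  also have "\<dots> = (\<Sum>y\<in>{- N..N} \<times> T. \<Sum>g\<in>{g \<in> generators D. ?deg g = y}.
      (- 1) ^ nat \<bar>homological_degree D pos g\<bar> * qpow (q_degree D pos g))"
    by (rule sum.group[OF finite_generators _ box, symmetric]) (use T in simp)
  also have "\<dots> = (\<Sum>(m, s)\<in>{- N..N} \<times> T. (- 1) ^ nat \<bar>m\<bar> * of_nat (?b m s) * qpow s)"
  proof (rule sum.cong[OF refl])
    fix y :: "int \<times> int"
    obtain m s where y: "y = (m, s)" by (cases y)
    have "{g \<in> generators D. ?deg g = y} = bigenerators D pos m s"
      by (auto simp: bigenerators_def y)
    moreover have "(\<Sum>g\<in>bigenerators D pos m s.
        (- 1) ^ nat \<bar>homological_degree D pos g\<bar> * qpow (q_degree D pos g)) =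
        (\<Sum>g\<in>bigenerators D pos m s. (- 1) ^ nat \<bar>m\<bar> * qpow s)"
      by (rule sum.cong) (auto simp: bigenerators_def)
    ultimately show "(\<Sum>g\<in>{g \<in> generators D. ?deg g = y}.
        (- 1) ^ nat \<bar>homological_degree D pos g\<bar> * qpow (q_degree D pos g)) =
        (case y of (m, s) \<Rightarrow> (- 1) ^ nat \<bar>m\<bar> * of_nat (?b m s) * qpow s)"
      by (simp add: y mult_ac)
  qed
  \<comment> \<open>The number of generators is split into the rank of homology and the ranks of the
    two adjacent differentials; the latter telescope for each fixed \<open>s\<close>.\<close>
  also have "\<dots> = (\<Sum>(m, s)\<in>{- N..N} \<times> T. (- 1) ^ nat \<bar>m\<bar> * of_nat (?h m s) * qpow s) +
      (\<Sum>(m, s)\<in>{- N..N} \<times> T. (- 1) ^ nat \<bar>m\<bar> * of_nat (r m s + r (m - 1) s) * qpow s)"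
    unfolding sum.distrib[symmetric] rank[symmetric]
    by (intro sum.cong refl) (simp add: case_prod_unfold algebra_simps)
  also have "(\<Sum>(m, s)\<in>{- N..N} \<times> T. (- 1) ^ nat \<bar>m\<bar> * of_nat (r m s + r (m - 1) s) * qpow s) =
      (\<Sum>s\<in>T. (\<Sum>m\<in>{- N..N}. (- 1) ^ nat \<bar>m\<bar> * of_nat (r m s + r (m - 1) s)) * qpow s)"
    unfolding sum_distrib_right sum.cartesian_product[symmetric] by (rule sum.swap)
  also have "\<dots> = 0"
    using alternating_telescope[of N "\<lambda>m. r m s" for s] r0 by (simp del: of_nat_add)
  also have "(\<Sum>(m, s)\<in>{- N..N} \<times> T. (- 1) ^ nat \<bar>m\<bar> * of_nat (?h m s) * qpow s) + 0 =
      Sum_any (\<lambda>(m, s). (- 1) ^ nat \<bar>m\<bar> * of_nat (?h m s) * qpow s)"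
  proof -
    \<comment> \<open>\<open>Sum_any\<close> sums over the support, which has to be enclosed in a
      finite box before the sums can be compared.\<close>
    have "{y. (case y of (m, s) \<Rightarrow> (- 1 :: laurent) ^ nat \<bar>m\<bar> * of_nat (?h m s) * qpow s) \<noteq> 0} \<subseteq> {- N..N} \<times> T"
    proof (rule subsetI, rule ccontr)
      fix y assume y: "y \<notin> {- N..N} \<times> T"
        "y \<in> {y. (case y of (m, s) \<Rightarrow> (- 1 :: laurent) ^ nat \<bar>m\<bar> * of_nat (?h m s) * qpow s) \<noteq> 0}"
      obtain m s where ms: "y = (m, s)" by (cases y)
      have "?h m s = 0" using y(1) unfolding ms by (rule h0)
      with y(2) show False by (simp add: ms)
    qed
    then show ?thesis using T by (subst Sum_any.expand_superset) auto
  qed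
  finally show ?thesis .
qed

end
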